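(* Let $\mathbf X=(X,\{X^i:i\in I\})$, $\mathbf Y=(Y,\{Y^j:j\in J\})$, $\mathbf Z=(Z,\{Z^k:k\in K\})$ be s-manifolds of dimensions $l,m,n$, and let $g:\mathbf X\to\mathbf Z$, $h:\mathbf Y\to\mathbf Z$ be transverse smooth maps. Let $W=\{(x,y)\in X\times Y:g(x)=h(y)\}$ with the subspace topology, let $e:W\to X$, $f:W\to Y$ be the projections $e(x,y)=x$, $f(x,y)=y$, and let $\mathbf W=(W,\{W^{ijk}:(i,j,k)\in H\})$, where for $(i,j,k)\in I\times J\times K$ with $g(X^i),h(Y^j)\subseteq Z^k$ we set $$W^{ijk}=\{(x,y)\in W:x\in X^i,\ y\in Y^j\}=X^i\times_{g|_{X^i},Z^k,h|_{Y^j}}Y^j,$$ with the smooth manifold structure of dimension $\dim X^i+\dim Y^j-\dim Z^k$ of a transverse fibre product of manifolds, and $H$ is the set of such $(i,j,k)$ with $W^{ijk}\ne\emptyset$. Then $\mathbf W$ is an s-manifold with $\dim\mathbf W=d:=l+m-n$, where $d\ge0$ if $\mathbf W\ne\emptyset$, and $e:\mathbf W\to\mathbf X$, $f:\mathbf W\to\mathbf Y$ are smooth maps with $g\circ e=h\circ f$. The square formed by $e,f,g,h$ is Cartesian in the category $\mathbf{SMan}$ of s-manifolds and smooth maps. Thus $\mathbf W$ is a fibre product $\mathbf X\times_{g,\mathbf Z,h}\mathbf Y$ in $\mathbf{SMan}$.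
   Context: **S-manifolds.** An s-manifold of dimension $n\ge 0$ is data $\mathbf X=(X,\{X^i:i\in I\})$ such that: (a) $X$ is a locally compact, Hausdorff, second countable topological space. (b) $I$ is finite or countable, and the $X^i$ (the strata) are nonempty, locally closed, pairwise disjoint subsets with $X=\coprod_{i\in I}X^i$ as sets. (c) Each $X^i$, with the subspace topology, is equipped with the structure of a smooth manifold (without boundary) of dimension $\dim X^i\le n$. (d) Each $x\in X$ has an open neighbourhood $U$ and a continuous map $f:U\to\mathbb R^N$ for some $N$ such that $f:U\to f(U)$ is a homeomorphism and $f|_{U\cap X^i}$ is a smooth embedding of manifolds for all $i\in I$. (e) Each $x\in X$ has an open neighbourhood $V$ such that $I_V=\{i\in I:V\cap X^i\ne\emptyset\}$ is finite, and there is a partial order $\preceq$ on $I_V$ such that: (i) for each $i\in I_V$ the closure of $V\cap X^i$ in $V$ is contained in $\coprod_{j\in I_V:\,i\preceq j}(V\cap X^j)$; (ii) if $i\ne j$ in $I_V$ with $i\preceq j$, then either $\dim X^i\in\{n-1,n\}$ and $\dim X^j<\dim X^i$, or $\dim X^i\le n-2$ and $\dim X^j\le n-2$. **Smooth maps.** A smooth map $f:\mathbf X\to\mathbf Y$ of s-manifolds is a continuous map $f:X\to Y$ such that for each stratum $X^i$ there is a unique stratum $Y^j$ with $f(X^i)\subseteq Y^j$, and $f|_{X^i}:X^i\to Y^j$ is a smooth map of manifolds. $\mathbf{SMan}$ is the category of s-manifolds and smooth maps. For $x\in X^i$ put $\dim_x\mathbf X=\dim X^i$, $T_x\mathbf X=T_xX^i$,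 and let $T_xf:T_x\mathbf X\to T_{f(x)}\mathbf Y$ be $T_x(f|_{X^i})$. **Transversality.** With $\dim\mathbf X=l$, $\dim\mathbf Y=m$, $\dim\mathbf Z=n$, smooth maps $g:\mathbf X\to\mathbf Z$, $h:\mathbf Y\to\mathbf Z$ are transverse if whenever $x\in X$, $y\in Y$ with $g(x)=h(y)=z$: (a) $T_xg\oplus T_yh:T_x\mathbf X\oplus T_y\mathbf Y\to T_z\mathbf Z$ is surjective; and (b) one of the following holds: (i) $(\dim_x\mathbf X,\dim_y\mathbf Y,\dim_z\mathbf Z)=(l,m,n)$; (ii) it equals $(l-1,m,n)$; (iii) it equals $(l,m-1,n)$; (iv) it equals $(l-1,m-1,n-1)$; or (v) $\dim_x\mathbf X+\dim_y\mathbf Y-\dim_z\mathbf Z\le l+m-n-2$. *)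

theory Defs
  imports "HOL-Analysis.Analysis"
begin

section \<open>Smooth functions on open subsets of Euclidean space\<close>

text \<open>
  The dimensions of the strata of one space vary, so \<open>\<real>\<^sup>n\<close> is rendered by the topology
  \<^term>\<open>Euclidean_space n\<close>, whose points are the functions \<open>p :: nat \<Rightarrow> real\<close> with \<open>p i = 0\<close> for
  all \<open>i \<ge> n\<close>. In particular \<open>\<real>\<^sup>d \<subseteq> \<real>\<^sup>n\<close> literally, as the slice \<open>p d = \<dots> = p (n - 1) = 0\<close>,
  when \<open>d \<le> n\<close>.
\<close>

definition partial_deriv :: "nat \<Rightarrow> ((nat \<Rightarrow> real) \<Rightarrow> real) \<Rightarrow> (nat \<Rightarrow> real) \<Rightarrow> real" where
  "partial_deriv j f p = deriv (\<lambda>t. f (p(j := t))) (p j)"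

text \<open>\<open>f\<close> is of class \<open>C\<^sup>k\<close> on \<open>V\<close>, an open subset of \<open>\<real>\<^sup>n\<close>: all iterated partial derivatives of
  order at most \<open>k\<close> exist and are continuous on \<open>V\<close>. Values of \<open>f\<close> outside \<open>V\<close> are irrelevant,
  because \<open>V\<close> is open.\<close>

primrec Ck_on :: "nat \<Rightarrow> nat \<Rightarrow> (nat \<Rightarrow> real) set \<Rightarrow> ((nat \<Rightarrow> real) \<Rightarrow> real) \<Rightarrow> bool" where
  "Ck_on 0 n V f \<longleftrightarrow> continuous_map (subtopology (Euclidean_space n) V) euclideanreal f"
| "Ck_on (Suc k) n V f \<longleftrightarrow>
     continuous_map (subtopology (Euclidean_space n) V) euclideanreal f \<and>
     (\<forall>j<n. (\<forall>p\<in>V. (\<lambda>t. f (p(j := t))) field_differentiable at (p j)) \<and>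
            Ck_on k n V (partial_deriv j f))"

definition smooth_vec_on ::
    "nat \<Rightarrow> (nat \<Rightarrow> real) set \<Rightarrow> ((nat \<Rightarrow> real) \<Rightarrow> (nat \<Rightarrow> real)) \<Rightarrow> bool" where
  "smooth_vec_on n V F \<longleftrightarrow> (\<forall>i k. Ck_on k n V (\<lambda>p. F p i))"

text \<open>The derivative of \<open>F\<close> at \<open>p \<in> \<real>\<^sup>n\<close>, applied to \<open>w \<in> \<real>\<^sup>n\<close> (the Jacobian matrix times \<open>w\<close>).\<close>

definition jac ::
    "nat \<Rightarrow> ((nat \<Rightarrow> real) \<Rightarrow> (nat \<Rightarrow> real)) \<Rightarrow> (nat \<Rightarrow> real) \<Rightarrow> (nat \<Rightarrow> real) \<Rightarrow> (nat \<Rightarrow> real)" where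
  "jac n F p w = (\<lambda>i. \<Sum>j<n. partial_deriv j (\<lambda>q. F q i) p * w j)"


section \<open>Smooth manifolds without boundary\<close>

text \<open>A chart \<open>(U, \<phi>)\<close> consists of its domain and its coordinate map; only \<open>\<phi>\<close> on \<open>U\<close> matters.\<close>

type_synonym 'a chart = "'a set \<times> ('a \<Rightarrow> nat \<Rightarrow> real)"

record 'a mfd =
  mtop :: "'a topology"
  mdim :: nat
  atlas :: "'a chart set"

definition coord_rep ::
    "'a chart \<Rightarrow> 'b chart \<Rightarrow> ('a \<Rightarrow> 'b) \<Rightarrow> (nat \<Rightarrow> real) \<Rightarrow> (nat \<Rightarrow> real)" where
  "coord_rep c c' f = snd c' \<circ> f \<circ> inv_into (fst c) (snd c)"

definition is_chart :: "'a mfd \<Rightarrow> 'a chart \<Rightarrow> bool" where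
  "is_chart M c \<longleftrightarrow>
     openin (mtop M) (fst c) \<and>
     openin (Euclidean_space (mdim M)) (snd c ` fst c) \<and>
     embedding_map (subtopology (mtop M) (fst c)) (Euclidean_space (mdim M)) (snd c)"

definition smooth_transition :: "'a mfd \<Rightarrow> 'a chart \<Rightarrow> 'a chart \<Rightarrow> bool" where
  "smooth_transition M c c' \<longleftrightarrow>
     smooth_vec_on (mdim M) (snd c ` (fst c \<inter> fst c')) (coord_rep c c' id)"

text \<open>The smooth structure is given by a smooth atlas, which is not required to be maximal: it
  determines the maximal one, \<open>max_atlas\<close> below, and none of the notions that follow changes when
  the atlas is enlarged by compatible charts.\<close>

definition smooth_manifold :: "'a mfd \<Rightarrow> bool" where
  "smooth_manifold M \<longleftrightarrow>
     Hausdorff_space (mtop M) \<and> second_countable (mtop M) \<and>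
     (\<forall>c\<in>atlas M. is_chart M c) \<and>
     (\<Union>c\<in>atlas M. fst c) = topspace (mtop M) \<and>
     (\<forall>c\<in>atlas M. \<forall>c'\<in>atlas M. smooth_transition M c c')"

definition max_atlas :: "'a mfd \<Rightarrow> 'a chart set" where
  "max_atlas M = {c. is_chart M c \<and>
     (\<forall>c'\<in>atlas M. smooth_transition M c c' \<and> smooth_transition M c' c)}"

definition smooth_map :: "'a mfd \<Rightarrow> 'b mfd \<Rightarrow> ('a \<Rightarrow> 'b) \<Rightarrow> bool" where
  "smooth_map M N f \<longleftrightarrow>
     continuous_map (mtop M) (mtop N) f \<and>
     (\<forall>c\<in>atlas M. \<forall>c'\<in>atlas N.
        smooth_vec_on (mdim M) (snd c ` (fst c \<inter> f -` fst c')) (coord_rep c c' f))"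

definition charts_at :: "'a mfd \<Rightarrow> 'a \<Rightarrow> 'a chart set" where
  "charts_at M x = {c \<in> atlas M. x \<in> fst c}"

text \<open>A tangent vector at \<open>x\<close> is the family of its coordinate vectors in the charts around \<open>x\<close>,
  which transform by the Jacobians of the transition maps (and \<open>0\<close> at all other arguments).
  The vector space operations are pointwise.\<close>

definition tangent_space :: "'a mfd \<Rightarrow> 'a \<Rightarrow> ('a chart \<Rightarrow> nat \<Rightarrow> real) set" where
  "tangent_space M x = {v.
     (\<forall>c. c \<notin> charts_at M x \<longrightarrow> v c = (\<lambda>i. 0)) \<and>
     (\<forall>c\<in>charts_at M x. v c \<in> topspace (Euclidean_space (mdim M))) \<and>
     (\<forall>c\<in>charts_at M x. \<forall>c'\<in>charts_at M x.
        v c' = jac (mdim M) (coord_rep c c' id) (snd c x) (v c))}"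

text \<open>\<open>T\<^sub>xf\<close>; by the chain rule the chosen chart around \<open>x\<close> does not matter.\<close>

definition tangent_map ::
    "'a mfd \<Rightarrow> 'b mfd \<Rightarrow> ('a \<Rightarrow> 'b) \<Rightarrow> 'a \<Rightarrow> ('a chart \<Rightarrow> nat \<Rightarrow> real) \<Rightarrow> ('b chart \<Rightarrow> nat \<Rightarrow> real)" where
  "tangent_map M N f x v = (let c = (SOME c. c \<in> charts_at M x) in
     (\<lambda>c'. if c' \<in> charts_at N (f x)
           then jac (mdim M) (coord_rep c c' f) (snd c x) (v c)
           else (\<lambda>i. 0)))"

definition smooth_embedding :: "'a mfd \<Rightarrow> 'b mfd \<Rightarrow> ('a \<Rightarrow> 'b) \<Rightarrow> bool" where
  "smooth_embedding M N f \<longleftrightarrow>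
     smooth_map M N f \<and>
     (\<forall>x\<in>topspace (mtop M). inj_on (tangent_map M N f x) (tangent_space M x)) \<and>
     embedding_map (mtop M) (mtop N) f"

definition eucl_mfd :: "nat \<Rightarrow> (nat \<Rightarrow> real) mfd" where
  "eucl_mfd N = \<lparr>mtop = Euclidean_space N, mdim = N,
                 atlas = {(topspace (Euclidean_space N), \<lambda>p. p)}\<rparr>"

definition open_submfd :: "'a mfd \<Rightarrow> 'a set \<Rightarrow> 'a mfd" where
  "open_submfd M U = \<lparr>mtop = subtopology (mtop M) U, mdim = mdim M,
                      atlas = {(fst c \<inter> U, snd c) | c. c \<in> atlas M}\<rparr>"

definition prod_chart :: "nat \<Rightarrow> 'a chart \<Rightarrow> 'b chart \<Rightarrow> ('a \<times> 'b) chart" where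
  "prod_chart m c c' =
     (fst c \<times> fst c', \<lambda>(x, y) i. if i < m then snd c x i else snd c' y (i - m))"

definition prod_mfd :: "'a mfd \<Rightarrow> 'b mfd \<Rightarrow> ('a \<times> 'b) mfd" where
  "prod_mfd M N = \<lparr>mtop = prod_topology (mtop M) (mtop N), mdim = mdim M + mdim N,
     atlas = {prod_chart (mdim M) c c' | c c'. c \<in> atlas M \<and> c' \<in> atlas N}\<rparr>"

text \<open>The structure of a \<open>d\<close>-dimensional embedded submanifold on \<open>S \<subseteq> M\<close>, given by the slice charts:
  those charts of the maximal atlas of \<open>M\<close> in which \<open>S\<close> corresponds to \<open>\<real>\<^sup>d\<close>. Such charts restrict
  to charts of \<open>S\<close> without change of the coordinate map, as \<open>\<real>\<^sup>d\<close> is itself a set of points of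
  \<open>\<real>\<^sup>n\<close>. That they cover \<open>S\<close> is not part of the definition.\<close>

definition embedded_submfd :: "'a mfd \<Rightarrow> 'a set \<Rightarrow> nat \<Rightarrow> 'a mfd" where
  "embedded_submfd M S d = \<lparr>mtop = subtopology (mtop M) S, mdim = d,
     atlas = {(fst c \<inter> S, snd c) | c. c \<in> max_atlas M \<and>
       snd c ` (fst c \<inter> S) = snd c ` fst c \<inter> topspace (Euclidean_space d)}\<rparr>"

text \<open>The smooth structure of a transverse fibre product \<open>M \<times>\<^bsub>g,P,h\<^esub> N\<close>. For transverse \<open>g\<close>, \<open>h\<close>
  and nonempty fibre product the subtraction in \<^typ>\<open>nat\<close> does not truncate.\<close>

definition fibre_product_mfd ::
    "'a mfd \<Rightarrow> 'b mfd \<Rightarrow> 'c mfd \<Rightarrow> ('a \<Rightarrow> 'c) \<Rightarrow> ('b \<Rightarrow> 'c) \<Rightarrow> ('a \<times> 'b) mfd" where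
  "fibre_product_mfd M N P g h =
     embedded_submfd (prod_mfd M N)
       {(x, y). x \<in> topspace (mtop M) \<and> y \<in> topspace (mtop N) \<and> g x = h y}
       (mdim M + mdim N - mdim P)"


section \<open>S-manifolds\<close>

text \<open>The data \<open>(X, {X\<^sup>i : i \<in> I})\<close>, with dimension and atlas of each stratum.\<close>

record ('a, 'i) smfd =
  stop :: "'a topology"
  sidx :: "'i set"
  stratum :: "'i \<Rightarrow> 'a set"
  sdim :: "'i \<Rightarrow> nat"
  satlas :: "'i \<Rightarrow> 'a chart set"

definition stratum_mfd :: "('a, 'i) smfd \<Rightarrow> 'i \<Rightarrow> 'a mfd" where
  "stratum_mfd X i =
     \<lparr>mtop = subtopology (stop X) (stratum X i), mdim = sdim X i, atlas = satlas X i\<rparr>"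

definition sm_locally_embedded :: "('a, 'i) smfd \<Rightarrow> bool" where
  "sm_locally_embedded X \<longleftrightarrow>
     (\<forall>x\<in>topspace (stop X). \<exists>U N f. openin (stop X) U \<and> x \<in> U \<and>
        embedding_map (subtopology (stop X) U) (Euclidean_space N) f \<and>
        (\<forall>i\<in>sidx X. smooth_embedding (open_submfd (stratum_mfd X i) U) (eucl_mfd N) f))"

definition sm_frontier_condition :: "int \<Rightarrow> ('a, 'i) smfd \<Rightarrow> bool" where
  "sm_frontier_condition n X \<longleftrightarrow>
     (\<forall>x\<in>topspace (stop X). \<exists>V. openin (stop X) V \<and> x \<in> V \<and>
        (let I\<^sub>V = {i \<in> sidx X. V \<inter> stratum X i \<noteq> {}} in
          finite I\<^sub>V \<and>
          (\<exists>R. partial_order_on I\<^sub>V R \<and>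
            (\<forall>i\<in>I\<^sub>V. subtopology (stop X) V closure_of (V \<inter> stratum X i)
                      \<subseteq> (\<Union>j\<in>{j \<in> I\<^sub>V. (i, j) \<in> R}. V \<inter> stratum X j)) \<and>
            (\<forall>i\<in>I\<^sub>V. \<forall>j\<in>I\<^sub>V. i \<noteq> j \<and> (i, j) \<in> R \<longrightarrow>
               int (sdim X i) \<in> {n - 1, n} \<and> sdim X j < sdim X i \<or>
               int (sdim X i) \<le> n - 2 \<and> int (sdim X j) \<le> n - 2))))"

text \<open>\<open>X\<close> is an s-manifold of dimension \<open>n\<close>. The dimension is an integer, and is nonnegative unless
  \<open>X\<close> is empty; the empty s-manifold has every integer as a dimension. This is the convention under
  which an empty fibre product has the expected dimension even if that is negative.\<close>

definition s_manifold :: "int \<Rightarrow> ('a, 'i) smfd \<Rightarrow> bool" where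
  "s_manifold n X \<longleftrightarrow>
     (0 \<le> n \<or> topspace (stop X) = {}) \<and>
     locally_compact_space (stop X) \<and> Hausdorff_space (stop X) \<and> second_countable (stop X) \<and>
     countable (sidx X) \<and>
     (\<forall>i\<in>sidx X. stratum X i \<noteq> {} \<and>
        (\<exists>A B. openin (stop X) A \<and> closedin (stop X) B \<and> stratum X i = A \<inter> B)) \<and>
     disjoint_family_on (stratum X) (sidx X) \<and>
     (\<Union>i\<in>sidx X. stratum X i) = topspace (stop X) \<and>
     (\<forall>i\<in>sidx X. smooth_manifold (stratum_mfd X i) \<and> int (sdim X i) \<le> n) \<and>
     sm_locally_embedded X \<and>
     sm_frontier_condition n X"

definition s_smooth :: "('a, 'i) smfd \<Rightarrow> ('b, 'j) smfd \<Rightarrow> ('a \<Rightarrow> 'b) \<Rightarrow> bool" where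
  "s_smooth X Y f \<longleftrightarrow>
     continuous_map (stop X) (stop Y) f \<and>
     (\<forall>i\<in>sidx X. (\<exists>!j. j \<in> sidx Y \<and> f ` stratum X i \<subseteq> stratum Y j) \<and>
        (\<forall>j\<in>sidx Y. f ` stratum X i \<subseteq> stratum Y j \<longrightarrow>
           smooth_map (stratum_mfd X i) (stratum_mfd Y j) f))"

definition stratum_at :: "('a, 'i) smfd \<Rightarrow> 'a \<Rightarrow> 'i" where
  "stratum_at X x = (THE i. i \<in> sidx X \<and> x \<in> stratum X i)"

definition dim_at :: "('a, 'i) smfd \<Rightarrow> 'a \<Rightarrow> int" where
  "dim_at X x = int (sdim X (stratum_at X x))"

definition s_tangent_space :: "('a, 'i) smfd \<Rightarrow> 'a \<Rightarrow> ('a chart \<Rightarrow> nat \<Rightarrow> real) set" where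
  "s_tangent_space X x = tangent_space (stratum_mfd X (stratum_at X x)) x"

definition s_tangent_map :: "('a, 'i) smfd \<Rightarrow> ('b, 'j) smfd \<Rightarrow> ('a \<Rightarrow> 'b) \<Rightarrow> 'a \<Rightarrow>
    ('a chart \<Rightarrow> nat \<Rightarrow> real) \<Rightarrow> ('b chart \<Rightarrow> nat \<Rightarrow> real)" where
  "s_tangent_map X Y f x =
     tangent_map (stratum_mfd X (stratum_at X x)) (stratum_mfd Y (stratum_at Y (f x))) f x"

definition s_transverse :: "int \<Rightarrow> int \<Rightarrow> int \<Rightarrow>
    ('a, 'i) smfd \<Rightarrow> ('b, 'j) smfd \<Rightarrow> ('c, 'k) smfd \<Rightarrow> ('a \<Rightarrow> 'c) \<Rightarrow> ('b \<Rightarrow> 'c) \<Rightarrow> bool" where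
  "s_transverse l m n X Y Z g h \<longleftrightarrow>
     (\<forall>x\<in>topspace (stop X). \<forall>y\<in>topspace (stop Y). \<forall>z. g x = z \<and> h y = z \<longrightarrow>
        (\<lambda>(u, v) c i. s_tangent_map X Z g x u c i + s_tangent_map Y Z h y v c i) `
            (s_tangent_space X x \<times> s_tangent_space Y y) = s_tangent_space Z z \<and>
        ((dim_at X x, dim_at Y y, dim_at Z z) = (l, m, n) \<or>
         (dim_at X x, dim_at Y y, dim_at Z z) = (l - 1, m, n) \<or>
         (dim_at X x, dim_at Y y, dim_at Z z) = (l, m - 1, n) \<or>
         (dim_at X x, dim_at Y y, dim_at Z z) = (l - 1, m - 1, n - 1) \<or>
         dim_at X x + dim_at Y y - dim_at Z z \<le> l + m - n - 2))"

definition s_fibre_product :: "('a, 'i) smfd \<Rightarrow> ('b, 'j) smfd \<Rightarrow> ('c, 'k) smfd \<Rightarrow>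
    ('a \<Rightarrow> 'c) \<Rightarrow> ('b \<Rightarrow> 'c) \<Rightarrow> ('a \<times> 'b, 'i \<times> 'j \<times> 'k) smfd" where
  "s_fibre_product X Y Z g h =
     (let W = {(x, y). x \<in> topspace (stop X) \<and> y \<in> topspace (stop Y) \<and> g x = h y};
          St = (\<lambda>(i, j, k). {(x, y) \<in> W. x \<in> stratum X i \<and> y \<in> stratum Y j});
          F = (\<lambda>(i, j, k). fibre_product_mfd (stratum_mfd X i) (stratum_mfd Y j) (stratum_mfd Z k) g h)
      in \<lparr>stop = subtopology (prod_topology (stop X) (stop Y)) W,
          sidx = {(i, j, k). i \<in> sidx X \<and> j \<in> sidx Y \<and> k \<in> sidx Z \<and>
                    g ` stratum X i \<subseteq> stratum Z k \<and> h ` stratum Y j \<subseteq> stratum Z k \<and>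
                    St (i, j, k) \<noteq> {}},
          stratum = St,
          sdim = (\<lambda>ijk. mdim (F ijk)),
          satlas = (\<lambda>ijk. atlas (F ijk))\<rparr>)"


section \<open>Cartesian squares in the category of s-manifolds\<close>

text \<open>Morphisms \<open>X \<rightarrow> Y\<close> are smooth maps, identified if they agree on the points of \<open>X\<close>. As a formula
  cannot quantify over types, the type of the test objects \<open>T\<close> is a parameter; leaving it an
  arbitrary type variable in a theorem yields the universal property for all \<open>T\<close>.\<close>

definition SMan_cartesian :: "('t, 'q) smfd itself \<Rightarrow>
    ('w, 'h) smfd \<Rightarrow> ('a, 'i) smfd \<Rightarrow> ('b, 'j) smfd \<Rightarrow> ('c, 'k) smfd \<Rightarrow>
    ('w \<Rightarrow> 'a) \<Rightarrow> ('w \<Rightarrow> 'b) \<Rightarrow> ('a \<Rightarrow> 'c) \<Rightarrow> ('b \<Rightarrow> 'c) \<Rightarrow> bool" where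
  "SMan_cartesian _ W X Y Z e f g h \<longleftrightarrow>
     (\<exists>d. s_manifold d W) \<and> (\<exists>l. s_manifold l X) \<and> (\<exists>m. s_manifold m Y) \<and> (\<exists>n. s_manifold n Z) \<and>
     s_smooth W X e \<and> s_smooth W Y f \<and> s_smooth X Z g \<and> s_smooth Y Z h \<and>
     (\<forall>w\<in>topspace (stop W). g (e w) = h (f w)) \<and>
     (\<forall>(T :: ('t, 'q) smfd) a b.
        (\<exists>q. s_manifold q T) \<and> s_smooth T X a \<and> s_smooth T Y b \<and>
        (\<forall>t\<in>topspace (stop T). g (a t) = h (b t)) \<longrightarrow>
        (\<exists>u. s_smooth T W u \<and>
             (\<forall>t\<in>topspace (stop T). e (u t) = a t \<and> f (u t) = b t) \<and>
             (\<forall>u'. s_smooth T W u' \<and>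
                   (\<forall>t\<in>topspace (stop T). e (u' t) = a t \<and> f (u' t) = b t) \<longrightarrow>
                   (\<forall>t\<in>topspace (stop T). u' t = u t))))"

end

theory Submission
  imports Defs
begin

text \<open>
  Near a point of a stratum of the fibre product, the equation \<open>g x = h y\<close> reads
  \<open>F\<^sub>0 = \<dots> = F\<^bsub>k-1\<^esub> = 0\<close> in coordinates on the product of two strata, and transversality
  provides tangent vectors \<open>v\<^sub>r\<close> with \<open>dF\<^sub>s(v\<^sub>r) = \<delta>\<^bsub>rs\<^esub>\<close>. Exchanging one coordinate after the other for
  an \<open>F\<^sub>r\<close> leads to a slice chart. Each exchange only needs the implicit function theorem in one
  variable, that is, the intermediate value theorem, so no inverse function theorem and no linear
  algebra in varying dimension is involved. Smoothness of the projections, the universal property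
  and the local embeddings are then inherited from the ambient product.

  On the strata \<open>W\<^bsup>ijk\<^esup>\<close> near a point one takes the product of the orders on the indices \<open>i\<close> and \<open>j\<close>; the
  index \<open>k\<close> is determined by either of them. The frontier condition then becomes a case distinction on
  the dimensions of the strata, by the five alternatives in the definition of transversality.
\<close>

section \<open>Calculus of \<open>C\<^sup>k\<close> functions\<close>

text \<open>The dimension of a stratum is a value, not a type, and smoothness is expressed by
  partial derivatives alone. Hence even the chain rule starts from the one-variable mean value
  theorem, applied along staircases of axis-parallel segments inside small cubes; the same device
  differentiates an implicitly defined coordinate. The vectors dual to the equations arise as
  follows: a tangent vector of Z with unit coordinates in a chart is written as Tg u + Th v, and (u,
  -v) is taken because the equations are the coordinates of g minus those of h. Exchanged
  coordinates are collected at the end, since a slice is where the last coordinates vanish. The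
  delicate point of the frontier condition is that the dimension of a stratum of W subtracts that of
  a stratum of Z. If only one of the indices i, j changes, k stays and cancels. If both change, k
  may change too, and it is the alternative (l-1, m-1, n-1), where Z drops by one as well, that
  still leaves a strict drop in dimension.\<close>

abbreviation R_pow :: "nat \<Rightarrow> (nat \<Rightarrow> real) set" where
  "R_pow n \<equiv> {x. \<forall>i\<ge>n. x i = 0}"

section \<open>The topology of \<open>R_pow n\<close> through cubes\<close>

lemma Euclidean_space_eq_top_of_set: "Euclidean_space n = top_of_set (R_pow n)"
  by (simp add: Euclidean_space_def euclidean_product_topology)

lemma openin_Euclidean_space_subset: "openin (Euclidean_space n) V \<Longrightarrow> V \<subseteq> R_pow n"
  using openin_subset topspace_Euclidean_space by blast

text \<open>The open ball of the maximum norm on \<open>R_pow n\<close>. These balls form a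
  neighbourhood basis there, and moving one coordinate to a value between those of two points of a
  cube does not leave it, which is what mean value arguments along the axes require.\<close>

definition cube :: "nat \<Rightarrow> (nat \<Rightarrow> real) \<Rightarrow> real \<Rightarrow> (nat \<Rightarrow> real) set" where
  "cube n p e = {q \<in> R_pow n. \<forall>i<n. \<bar>q i - p i\<bar> < e}"

lemma openin_cube: "openin (Euclidean_space n) (cube n p e)"
proof -
  have "open (\<Pi>\<^sub>E i\<in>UNIV. if i < n then {p i - e<..<p i + e} else UNIV)"
    by (rule open_PiE) (auto intro: finite_subset[of _ "{..<n}"])
  moreover have "cube n p e = R_pow n \<inter> (\<Pi>\<^sub>E i\<in>UNIV. if i < n then {p i - e<..<p i + e} else UNIV)"
    unfolding cube_def PiE_def Pi_def by (auto simp: abs_less_iff)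
  ultimately show ?thesis
    unfolding Euclidean_space_eq_top_of_set openin_open by blast
qed

lemma cube_center: "p \<in> R_pow n \<Longrightarrow> e > 0 \<Longrightarrow> p \<in> cube n p e"
  by (simp add: cube_def)

lemma cube_mono: "d \<le> e \<Longrightarrow> cube n p d \<subseteq> cube n p e"
  by (force simp: cube_def)

text \<open>A basic open set of the product topology restricts the coordinates separately, and only
  the first \<open>n\<close> are free in \<open>R_pow n\<close>. So one radius, the least of
  finitely many, serves all of them.\<close>

lemma cube_subset_openin:
  assumes "openin (Euclidean_space n) V" "p \<in> V"
  obtains e where "e > 0" "cube n p e \<subseteq> V"
proof -
  have "openin (subtopology (powertop_real UNIV) (R_pow n)) V"
    using assms(1) by (simp add: Euclidean_space_def)
  then obtain T where T: "openin (powertop_real UNIV) T" "V = T \<inter> R_pow n"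
    by (auto simp: openin_subtopology)
  then obtain U where U: "finite {i. U i \<noteq> UNIV}" "\<And>i. open (U i)"
    "p \<in> Pi\<^sub>E UNIV U" "Pi\<^sub>E UNIV U \<subseteq> T"
    using assms(2) unfolding openin_product_topology_alt by auto
  have "\<exists>e>0. \<forall>y. \<bar>y - p i\<bar> < e \<longrightarrow> y \<in> U i" for i
    using U(2)[of i] U(3) unfolding open_dist by (force simp: dist_real_def)
  then obtain \<epsilon> where \<epsilon>: "\<And>i. \<epsilon> i > 0" "\<And>i y. \<bar>y - p i\<bar> < \<epsilon> i \<Longrightarrow> y \<in> U i"
    by metis
  \<comment> \<open>The 1 keeps the minimum meaningful for \<open>n = 0\<close>, where there are no
    radii.\<close>
  define e where "e = Min (insert 1 (\<epsilon> ` {..<n}))"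
  have e: "e > 0" "\<And>i. i < n \<Longrightarrow> e \<le> \<epsilon> i"
    unfolding e_def using \<epsilon>(1) by auto
  have "cube n p e \<subseteq> V"
  proof
    fix q assume q: "q \<in> cube n p e"
    have "q i \<in> U i" for i
    proof (cases "i < n")
      case True
      then show ?thesis using q e \<epsilon> by (force simp: cube_def)
    next
      case False
      then have "q i = p i"
        using q assms(2) T by (auto simp: cube_def)
      then show ?thesis using U(3) by auto
    qed
    then show "q \<in> V"
      using U(4) T q by (auto simp: cube_def)
  qed
  with e that show ?thesis by blast
qed

lemma continuous_map_R_pow_iff:
  assumes "V \<subseteq> R_pow n"
  shows "continuous_map (subtopology (Euclidean_space n) V) euclideanreal f \<longleftrightarrow> continuous_on V f"
proof -
  have "subtopology (Euclidean_space n) V = top_of_set V"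
    using assms by (simp add: Euclidean_space_eq_top_of_set subtopology_subtopology Int_absorb1)
  then show ?thesis by simp
qed

text \<open>Since cubes form a neighbourhood basis, continuity takes the epsilon-delta form in which
  all later estimates are made.\<close>

lemma continuous_on_cube:
  assumes "V \<subseteq> R_pow n"
  shows "continuous_on V (f :: (nat \<Rightarrow> real) \<Rightarrow> real) \<longleftrightarrow>
    (\<forall>p\<in>V. \<forall>e>0. \<exists>d>0. \<forall>q\<in>V \<inter> cube n p d. \<bar>f q - f p\<bar> < e)"
proof safe
  fix p and e :: real
  assume f: "continuous_on V f" "p \<in> V" "e > 0"
  have "openin (top_of_set V) (V \<inter> f -` {f p - e<..<f p + e})"
    using f(1) by (intro continuous_openin_preimage_gen) auto
  then obtain T where T: "open T" "V \<inter> f -` {f p - e<..<f p + e} = V \<inter> T"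
    by (auto simp: openin_open)
  have "openin (Euclidean_space n) (R_pow n \<inter> T)" "p \<in> R_pow n \<inter> T"
    using T f assms unfolding Euclidean_space_eq_top_of_set by auto
  then obtain d where d: "d > 0" "cube n p d \<subseteq> R_pow n \<inter> T"
    using cube_subset_openin by blast
  have "\<bar>f q - f p\<bar> < e" if "q \<in> V \<inter> cube n p d" for q
  proof -
    have "q \<in> V \<inter> f -` {f p - e<..<f p + e}" using that d T by blast
    then show ?thesis by (auto simp: abs_less_iff)
  qed
  with d show "\<exists>d>0. \<forall>q\<in>V \<inter> cube n p d. \<bar>f q - f p\<bar> < e" by blast
next
  assume *: "\<forall>p\<in>V. \<forall>e>0. \<exists>d>0. \<forall>q\<in>V \<inter> cube n p d. \<bar>f q - f p\<bar> < e"
  show "continuous_on V f"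
    unfolding continuous_on_topological
  proof safe
    fix p B assume p: "p \<in> V" "open B" "f p \<in> B"
    then obtain e where e: "e > 0" "\<And>y. \<bar>y - f p\<bar> < e \<Longrightarrow> y \<in> B"
      unfolding open_dist by (auto simp: dist_real_def)
    with * p obtain d where d: "d > 0" "\<forall>q\<in>V \<inter> cube n p d. \<bar>f q - f p\<bar> < e" by blast
    obtain T where T: "open T" "cube n p d = R_pow n \<inter> T"
      using openin_cube[of n p d] unfolding Euclidean_space_eq_top_of_set by (auto simp: openin_open)
    have "p \<in> T" using cube_center[of p n d] d p assms T by blast
    moreover have "\<forall>q\<in>V. q \<in> T \<longrightarrow> f q \<in> B" using T d e assms by blast
    ultimately show "\<exists>A. open A \<and> p \<in> A \<and> (\<forall>y\<in>V. y \<in> A \<longrightarrow> f y \<in> B)" using T by blast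
  qed
qed

section \<open>Functions of class \<open>C^k\<close> and their closure properties\<close>

lemma fun_upd_in_cube:
  assumes "p \<in> R_pow n" "\<bar>t - p j\<bar> < e" "j < n"
  shows "p(j := t) \<in> cube n p e"
  using assms by (auto simp: cube_def)

lemma eventually_fun_upd_in:
  assumes V: "openin (Euclidean_space n) V" "p \<in> V" "j < n"
  shows "\<forall>\<^sub>F t in nhds (p j). p(j := t) \<in> V"
proof -
  obtain e where e: "e > 0" "cube n p e \<subseteq> V" using cube_subset_openin V by blast
  have "\<forall>\<^sub>F t in nhds (p j). dist t (p j) < e"
    using e by (metis eventually_nhds_metric)
  then show ?thesis
  proof eventually_elim
    case (elim t)
    have "p \<in> R_pow n" using V openin_Euclidean_space_subset by blast
    with elim show ?case
      using fun_upd_in_cube[of p n t j e] V e by (auto simp: dist_real_def)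
  qed
qed

text \<open>A partial derivative sees only values at \<open>p(j := t)\<close> for \<open>t\<close>
  near \<open>p j\<close>, and these points stay in the open set \<open>V\<close>. This matters
  because representing functions built with \<open>inv_into\<close> take arbitrary values off their
  domains.\<close>

lemma partial_deriv_cong:
  assumes V: "openin (Euclidean_space n) V" "p \<in> V" "j < n" and eq: "\<And>q. q \<in> V \<Longrightarrow> f q = g q"
  shows "partial_deriv j f p = partial_deriv j g p"
    and "(\<lambda>t. f (p(j := t))) field_differentiable at (p j) \<longleftrightarrow>
         (\<lambda>t. g (p(j := t))) field_differentiable at (p j)"
proof -
  have ev: "\<forall>\<^sub>F t in nhds (p j). f (p(j := t)) = g (p(j := t))"
    using eventually_fun_upd_in[OF V] by eventually_elim (simp add: eq)
  show "partial_deriv j f p = partial_deriv j g p"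
    unfolding partial_deriv_def by (rule deriv_cong_ev[OF ev]) simp
  show "(\<lambda>t. f (p(j := t))) field_differentiable at (p j) \<longleftrightarrow>
         (\<lambda>t. g (p(j := t))) field_differentiable at (p j)"
    unfolding field_differentiable_def using DERIV_cong_ev[OF refl ev] by auto
qed

lemma Ck_on_cong:
  assumes "openin (Euclidean_space n) V" "Ck_on k n V f" "\<And>q. q \<in> V \<Longrightarrow> f q = g q"
  shows "Ck_on k n V g"
  using assms(2,3)
proof (induction k arbitrary: f g)
  case 0
  have "V \<subseteq> R_pow n" using assms(1) by (rule openin_Euclidean_space_subset)
  with 0 show ?case by (simp add: continuous_map_R_pow_iff cong: continuous_on_cong)
next
  case (Suc k)
  have V: "V \<subseteq> R_pow n" using assms(1) by (rule openin_Euclidean_space_subset)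
  have "Ck_on k n V (partial_deriv j g)" if "j < n" for j
  proof (rule Suc.IH)
    show "Ck_on k n V (partial_deriv j f)" using Suc.prems that by simp
    show "partial_deriv j f q = partial_deriv j g q" if "q \<in> V" for q
      using partial_deriv_cong(1)[OF assms(1) \<open>q \<in> V\<close> \<open>j < n\<close> Suc.prems(2)] .
  qed
  moreover have "(\<lambda>t. g (p(j := t))) field_differentiable at (p j)" if "j < n" "p \<in> V" for j p
    using partial_deriv_cong(2)[OF assms(1) \<open>p \<in> V\<close> \<open>j < n\<close>, of f g] Suc.prems that by simp
  moreover have "continuous_on V g"
    using Suc.prems V continuous_on_cong[OF refl, of V f g] by (auto simp: continuous_map_R_pow_iff)
  ultimately show ?case
    using V by (simp add: continuous_map_R_pow_iff)
qed

lemma Ck_on_continuous_on: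
  assumes "V \<subseteq> R_pow n" "Ck_on k n V f"
  shows "continuous_on V f"
  using assms by (cases k) (simp_all add: continuous_map_R_pow_iff)

lemma Ck_on_SucD: "Ck_on (Suc k) n V f \<Longrightarrow> Ck_on k n V f"
  by (induction k arbitrary: f) auto

text \<open>Lets a differentiation rule exhibit a formula \<open>D\<close> for the derivative and
  check its regularity, instead of handling the term \<open>partial_deriv j f\<close>.\<close>

lemma Ck_on_SucI:
  assumes V: "openin (Euclidean_space n) V" and f: "continuous_on V f"
    and D: "\<And>j p. j < n \<Longrightarrow> p \<in> V \<Longrightarrow> ((\<lambda>t. f (p(j := t))) has_field_derivative D j p) (at (p j))"
    and Ck: "\<And>j. j < n \<Longrightarrow> Ck_on k n V (D j)"
  shows "Ck_on (Suc k) n V f"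
proof -
  have "partial_deriv j f p = D j p" if "j < n" "p \<in> V" for j p
    unfolding partial_deriv_def using D[OF that] by (rule DERIV_imp_deriv)
  then have "Ck_on k n V (partial_deriv j f)" if "j < n" for j
    using that by (intro Ck_on_cong[OF V Ck[OF that]]) auto
  then show ?thesis
    using D f V by (auto simp: continuous_map_R_pow_iff openin_Euclidean_space_subset field_differentiable_def)
qed

lemma Ck_on_has_partial:
  assumes "Ck_on (Suc k) n V f" "p \<in> V" "j < n"
  shows "((\<lambda>t. f (p(j := t))) has_field_derivative partial_deriv j f p) (at (p j))"
  using assms by (auto simp: partial_deriv_def field_differentiable_derivI)

lemma Ck_on_mono: "Ck_on k n V f \<Longrightarrow> U \<subseteq> V \<Longrightarrow> Ck_on k n U f"
proof (induction k arbitrary: f)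
  case 0
  then show ?case by (auto intro: continuous_map_from_subtopology_mono)
next
  case (Suc k)
  then show ?case by (auto intro: continuous_map_from_subtopology_mono)
qed

text \<open>The slice is literally a subset of \<open>R_pow n\<close>, so for \<open>j < d\<close>
  the partial derivatives on it are the same terms; only the two subspace topologies have to be
  identified.\<close>

lemma Ck_on_slice:
  assumes "d \<le> n"
  shows "Ck_on k n V f \<Longrightarrow> Ck_on k d (V \<inter> R_pow d) f"
proof (induction k arbitrary: f)
  have *: "subtopology (Euclidean_space d) (V \<inter> R_pow d) = subtopology (Euclidean_space n) (V \<inter> R_pow d)"
    using assms unfolding Euclidean_space_eq_top_of_set subtopology_subtopology
    by (intro arg_cong[of _ _ "subtopology _"]) auto
  {
    case 0
    with * show ?case by (auto intro: continuous_map_from_subtopology_mono)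
  next
    case (Suc k)
    with * assms show ?case by (auto intro: continuous_map_from_subtopology_mono)
  }
qed

text \<open>At each order continuity and differentiability are conditions near a point. The
  induction is over all \<open>f\<close>, because the next order concerns its partial
  derivatives.\<close>

lemma Ck_on_local:
  assumes "openin (Euclidean_space n) V"
    "\<And>p. p \<in> V \<Longrightarrow> \<exists>U. openin (Euclidean_space n) U \<and> p \<in> U \<and> Ck_on k n U f"
  shows "Ck_on k n V f"
  using assms(2)
proof (induction k arbitrary: f)
  case 0
  have V: "V \<subseteq> R_pow n" using assms(1) by (rule openin_Euclidean_space_subset)
  have "continuous_on V f"
    unfolding continuous_on_cube[OF V]
  proof (intro ballI allI impI)
    fix p and e :: real assume p: "p \<in> V" and e: "e > 0"
    from 0[OF p] obtain U where U: "openin (Euclidean_space n) U" "p \<in> U" "Ck_on 0 n U f" by blast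
    have Un: "U \<subseteq> R_pow n"
      by (rule openin_Euclidean_space_subset[OF U(1)])
    then have "continuous_on U f"
      using U(3) by (rule Ck_on_continuous_on)
    then obtain d where d: "d > 0" "\<forall>q\<in>U \<inter> cube n p d. \<bar>f q - f p\<bar> < e"
      using U(2) e unfolding continuous_on_cube[OF Un] by blast
    obtain d' where d': "d' > 0" "cube n p d' \<subseteq> U" using cube_subset_openin U by blast
    have "cube n p (min d d') \<subseteq> U \<inter> cube n p d"
      using d' cube_mono[of "min d d'" d n p] cube_mono[of "min d d'" d' n p] by auto
    with d d' show "\<exists>d>0. \<forall>q\<in>V \<inter> cube n p d. \<bar>f q - f p\<bar> < e"
      by (intro exI[of _ "min d d'"]) auto
  qed
  with V show ?case by (simp add: continuous_map_R_pow_iff)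
next
  case (Suc k)
  note V = openin_Euclidean_space_subset[OF assms(1)]
  have "Ck_on k n V f"
  proof (rule Suc.IH)
    fix p assume "p \<in> V"
    from Suc.prems[OF this] show "\<exists>U. openin (Euclidean_space n) U \<and> p \<in> U \<and> Ck_on k n U f"
      using Ck_on_SucD[of k n _ f] by blast
  qed
  then have "Ck_on 0 n V f"
    using Ck_on_continuous_on[OF V, of k f] V by (simp add: continuous_map_R_pow_iff)
  moreover have "(\<lambda>t. f (p(j := t))) field_differentiable at (p j)" if "j < n" "p \<in> V" for j p
    using Suc.prems[OF that(2)] that(1) by auto
  moreover have "Ck_on k n V (partial_deriv j f)" if "j < n" for j
  proof (rule Suc.IH)
    fix p assume "p \<in> V"
    from Suc.prems[OF this] obtain U where "openin (Euclidean_space n) U" "p \<in> U" "Ck_on (Suc k) n U f"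
      by blast
    with that show "\<exists>U. openin (Euclidean_space n) U \<and> p \<in> U \<and> Ck_on k n U (partial_deriv j f)"
      by auto
  qed
  ultimately show ?case by simp
qed

lemma Ck_on_const: "Ck_on k n V (\<lambda>p. c)"
proof (induction k arbitrary: c)
  case (Suc k)
  have "partial_deriv j (\<lambda>p. c) = (\<lambda>p. 0)" for j by (simp add: partial_deriv_def fun_eq_iff)
  with Suc show ?case by simp
qed simp

lemma Ck_on_coord:
  assumes "openin (Euclidean_space n) V"
  shows "Ck_on k n V (\<lambda>p. p i)"
proof -
  have c: "continuous_on V (\<lambda>p. p i)"
    by (rule continuous_on_subset[OF continuous_on_product_coordinates]) simp
  show ?thesis
  proof (cases k)
    case 0
    then show ?thesis using c assms by (simp add: continuous_map_R_pow_iff openin_Euclidean_space_subset)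
  next
    case (Suc k')
    have "(\<lambda>t. (p(j := t)) i) = (if i = j then (\<lambda>t. t) else (\<lambda>t. p i))"
      for j and p :: "nat \<Rightarrow> real"
      by (auto simp: fun_eq_iff)
    then have D: "((\<lambda>t. (p(j := t)) i) has_field_derivative (if i = j then 1 else 0)) (at (p j))"
      for j and p :: "nat \<Rightarrow> real"
      by (cases "i = j") (simp_all only: if_True if_False simp_thms DERIV_ident DERIV_const)
    show ?thesis
      unfolding Suc by (rule Ck_on_SucI[OF assms c D Ck_on_const])
  qed
qed

lemma Ck_on_add:
  assumes V: "openin (Euclidean_space n) V"
  shows "Ck_on k n V f \<Longrightarrow> Ck_on k n V g \<Longrightarrow> Ck_on k n V (\<lambda>p. f p + g p)"
proof (induction k arbitrary: f g)
  case 0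
  then show ?case by (auto intro: continuous_map_add)
next
  case (Suc k)
  note c = Ck_on_continuous_on[OF openin_Euclidean_space_subset[OF V]]
  show ?case
    by (rule Ck_on_SucI[OF V, where D = "\<lambda>j p. partial_deriv j f p + partial_deriv j g p"])
      (use Suc.prems in \<open>auto intro!: continuous_on_add c[OF Suc.prems(1)] c[OF Suc.prems(2)] Suc.IH
        DERIV_add Ck_on_has_partial[OF Suc.prems(1)] Ck_on_has_partial[OF Suc.prems(2)]
        simp del: fun_upd_apply\<close>)
qed

lemma Ck_on_mult:
  assumes V: "openin (Euclidean_space n) V"
  shows "Ck_on k n V f \<Longrightarrow> Ck_on k n V g \<Longrightarrow> Ck_on k n V (\<lambda>p. f p * g p)"
proof (induction k arbitrary: f g)
  case 0
  then show ?case by (auto intro: continuous_map_real_mult)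
next
  case (Suc k)
  note c = Ck_on_continuous_on[OF openin_Euclidean_space_subset[OF V]]
  have D: "((\<lambda>t. f (p(j := t)) * g (p(j := t))) has_field_derivative
      partial_deriv j f p * g p + partial_deriv j g p * f p) (at (p j))" if "j < n" "p \<in> V" for j p
    using DERIV_mult[OF Ck_on_has_partial[OF Suc.prems(1) that(2,1)] Ck_on_has_partial[OF Suc.prems(2) that(2,1)]]
    by (simp del: fun_upd_apply)
  show ?case
  proof (rule Ck_on_SucI[OF V _ D])
    show "continuous_on V (\<lambda>p. f p * g p)"
      by (intro continuous_on_mult c[OF Suc.prems(1)] c[OF Suc.prems(2)])
    show "Ck_on k n V (\<lambda>p. partial_deriv j f p * g p + partial_deriv j g p * f p)" if "j < n" for j
      using Suc.prems that
      by (intro Ck_on_add[OF V] Suc.IH Ck_on_SucD[OF Suc.prems(1)] Ck_on_SucD[OF Suc.prems(2)]) auto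
  qed
qed

lemma Ck_on_diff:
  assumes V: "openin (Euclidean_space n) V" and "Ck_on k n V f" "Ck_on k n V g"
  shows "Ck_on k n V (\<lambda>p. f p - g p)"
  using Ck_on_add[OF V assms(2) Ck_on_mult[OF V Ck_on_const[of _ _ _ "-1"] assms(3)]] by simp

lemma Ck_on_sum:
  assumes V: "openin (Euclidean_space n) V"
  shows "(\<And>i. i \<in> I \<Longrightarrow> Ck_on k n V (f i)) \<Longrightarrow> Ck_on k n V (\<lambda>p. \<Sum>i\<in>I. f i p)"
  by (induction I rule: infinite_finite_induct) (auto simp: Ck_on_const intro!: Ck_on_add[OF V])

lemma Ck_on_inverse:
  assumes V: "openin (Euclidean_space n) V" and nz: "\<And>p. p \<in> V \<Longrightarrow> f p \<noteq> 0"
  shows "Ck_on k n V f \<Longrightarrow> Ck_on k n V (\<lambda>p. inverse (f p))"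
proof (induction k)
  case 0
  then show ?case using nz V
    by (auto simp: continuous_map_R_pow_iff openin_Euclidean_space_subset intro!: continuous_on_inverse)
next
  case (Suc k)
  have IH: "Ck_on k n V (\<lambda>p. inverse (f p))"
    using Suc Ck_on_SucD by blast
  have c: "continuous_on V (\<lambda>p. inverse (f p))"
    using Ck_on_continuous_on[OF openin_Euclidean_space_subset[OF V] Suc.prems] nz
    by (auto intro!: continuous_on_inverse)
  \<comment> \<open>The derivative is written as a product with \<open>inverse (f p)\<close> twice
    as a factor, so that its regularity follows from the induction hypothesis.\<close>
  have D: "((\<lambda>t. inverse (f (p(j := t)))) has_field_derivative
      (- 1) * (inverse (f p) * partial_deriv j f p * inverse (f p))) (at (p j))" if "j < n" "p \<in> V" for j p
    using DERIV_inverse'[OF Ck_on_has_partial[OF Suc.prems that(2,1)]] nz[OF that(2)]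
    by (simp del: fun_upd_apply)
  show ?case
    by (rule Ck_on_SucI[OF V c D]; (intro Ck_on_mult[OF V] Ck_on_const IH)?) (use Suc.prems in auto)
qed

lemma openin_cubeI:
  assumes "V \<subseteq> R_pow n" "\<And>p. p \<in> V \<Longrightarrow> \<exists>e>0. cube n p e \<subseteq> V"
  shows "openin (Euclidean_space n) V"
proof (subst openin_subopen, intro ballI)
  fix p assume "p \<in> V"
  with assms obtain e where "e > 0" "cube n p e \<subseteq> V" by blast
  with \<open>p \<in> V\<close> assms(1) show "\<exists>T. openin (Euclidean_space n) T \<and> p \<in> T \<and> T \<subseteq> V"
    using openin_cube[of n p e] cube_center[of p n e] by blast
qed

lemma Ck_on_partial: "Ck_on (Suc k) n V f \<Longrightarrow> j < n \<Longrightarrow> Ck_on k n V (partial_deriv j f)"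
  by simp

lemma Ck_on_le:
  assumes "j \<le> k" "Ck_on k n V f"
  shows "Ck_on j n V f"
  using assms by (induction k rule: dec_induct) (blast dest: Ck_on_SucD)+

section \<open>Mean value theorem and chain rule\<close>

lemma mvt_coordinate:
  assumes f: "Ck_on (Suc 0) n V f" and "j < n"
    and seg: "\<And>t. min a b \<le> t \<Longrightarrow> t \<le> max a b \<Longrightarrow> p(j := t) \<in> V"
  obtains t where "min a b \<le> t" "t \<le> max a b"
    "f (p(j := b)) - f (p(j := a)) = partial_deriv j f (p(j := t)) * (b - a)"
proof -
  have D: "((\<lambda>s. f (p(j := s))) has_field_derivative partial_deriv j f (p(j := t))) (at t)"
    if "min a b \<le> t" "t \<le> max a b" for t
    using Ck_on_has_partial[OF f seg[OF that] \<open>j < n\<close>] by simp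
  consider "a < b" | "b < a" | "a = b" by linarith
  then show ?thesis
  proof cases
    case 1
    have "\<exists>z>a. z < b \<and> f (p(j := b)) - f (p(j := a)) = (b - a) * partial_deriv j f (p(j := z))"
      by (rule MVT2[OF 1]) (use D 1 in \<open>simp del: fun_upd_apply\<close>)
    then obtain z where "a < z" "z < b"
      "f (p(j := b)) - f (p(j := a)) = (b - a) * partial_deriv j f (p(j := z))" by blast
    with that[of z] show ?thesis by (simp add: mult.commute)
  next
    case 2
    have "\<exists>z>b. z < a \<and> f (p(j := a)) - f (p(j := b)) = (a - b) * partial_deriv j f (p(j := z))"
      by (rule MVT2[OF 2]) (use D 2 in \<open>simp del: fun_upd_apply\<close>)
    then obtain z where "b < z" "z < a"
      "f (p(j := a)) - f (p(j := b)) = (a - b) * partial_deriv j f (p(j := z))" by blast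
    with that[of z] show ?thesis by (simp add: algebra_simps)
  next
    case 3
    with that[of a] show ?thesis by simp
  qed
qed

text \<open>Passing from \<open>x\<close> to \<open>y\<close> one coordinate at a time gives a
  separate intermediate point \<open>\<zeta> i\<close> for each summand. The bound by
  \<open>\<bar>y l - x l\<bar>\<close> forces all of them to \<open>x\<close> as \<open>y\<close>
  tends to \<open>x\<close>, and continuity of the partial derivatives then does the work of a total
  derivative.\<close>

lemma mvt_cube:
  assumes f: "Ck_on (Suc 0) n V f" and V: "cube n x e \<subseteq> V"
    and x: "x \<in> R_pow n" and y: "y \<in> cube n x e"
  obtains \<zeta> where "\<And>i. i < n \<Longrightarrow> \<zeta> i \<in> cube n x e"
    "\<And>i l. i < n \<Longrightarrow> \<bar>\<zeta> i l - x l\<bar> \<le> \<bar>y l - x l\<bar>"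
    "f y - f x = (\<Sum>i<n. partial_deriv i f (\<zeta> i) * (y i - x i))"
proof -
  \<comment> \<open>The corners of the staircase: \<open>h i\<close> has its coordinates below
    \<open>i\<close> already moved to \<open>y\<close>, so consecutive corners differ in coordinate
    \<open>i\<close> only.\<close>
  define h where "h i = (\<lambda>l. if l < i then y l else x l)" for i
  have h0: "h 0 = x" by (simp add: h_def)
  have hn: "h n = y"
    unfolding h_def using x y by (auto simp: cube_def fun_eq_iff)
  have hS: "h (Suc i) = (h i)(i := y i)" "h i = (h i)(i := x i)" for i
    by (auto simp: h_def fun_eq_iff)
  have step: "\<exists>z. z \<in> cube n x e \<and> (\<forall>l. \<bar>z l - x l\<bar> \<le> \<bar>y l - x l\<bar>) \<and>
      f (h (Suc i)) - f (h i) = partial_deriv i f z * (y i - x i)" if "i < n" for i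
  proof -
    have b: "\<bar>((h i)(i := t)) l - x l\<bar> \<le> \<bar>y l - x l\<bar>"
      if "min (x i) (y i) \<le> t" "t \<le> max (x i) (y i)" for t l
      using that by (auto simp: h_def)
    have c: "(h i)(i := t) \<in> cube n x e" if "min (x i) (y i) \<le> t" "t \<le> max (x i) (y i)" for t
    proof -
      have "\<bar>((h i)(i := t)) l - x l\<bar> < e" if "l < n" for l
        using b[OF \<open>min (x i) (y i) \<le> t\<close> \<open>t \<le> max (x i) (y i)\<close>, of l] y that
        by (auto simp: cube_def simp del: fun_upd_apply intro: le_less_trans)
      moreover have "(h i)(i := t) \<in> R_pow n"
        using x y \<open>i < n\<close> by (auto simp: cube_def h_def)
      ultimately show ?thesis by (simp add: cube_def del: fun_upd_apply)
    qed
    obtain t where t: "min (x i) (y i) \<le> t" "t \<le> max (x i) (y i)"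
      "f ((h i)(i := y i)) - f ((h i)(i := x i)) = partial_deriv i f ((h i)(i := t)) * (y i - x i)"
      using mvt_coordinate[OF f \<open>i < n\<close>, of "x i" "y i" "h i"] c V by blast
    show ?thesis
      using b[OF t(1,2)] c[OF t(1,2)] t(3) hS by metis
  qed
  then obtain \<zeta> where \<zeta>: "\<And>i. i < n \<Longrightarrow> \<zeta> i \<in> cube n x e"
    "\<And>i l. i < n \<Longrightarrow> \<bar>\<zeta> i l - x l\<bar> \<le> \<bar>y l - x l\<bar>"
    "\<And>i. i < n \<Longrightarrow> f (h (Suc i)) - f (h i) = partial_deriv i f (\<zeta> i) * (y i - x i)"
    by metis
  have "f y - f x = (\<Sum>i<n. f (h (Suc i)) - f (h i))"
    using sum_lessThan_telescope[of "\<lambda>i. f (h i)" n] by (simp only: h0 hn)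
  also have "\<dots> = (\<Sum>i<n. partial_deriv i f (\<zeta> i) * (y i - x i))"
    using \<zeta>(3) by simp
  finally show ?thesis using that \<zeta>(1,2) by blast
qed

lemma Ck_on_partial_continuous:
  assumes "openin (Euclidean_space n) V" "Ck_on (Suc k) n V f" "p \<in> V" "j < n" "\<epsilon> > 0"
  obtains d where "d > 0" "cube n p d \<subseteq> V" "\<And>q. q \<in> cube n p d \<Longrightarrow> \<bar>partial_deriv j f q - partial_deriv j f p\<bar> < \<epsilon>"
proof -
  note V = openin_Euclidean_space_subset[OF assms(1)]
  have "continuous_on V (partial_deriv j f)"
    using Ck_on_continuous_on[OF V Ck_on_partial[OF assms(2,4)]] .
  then obtain d where d: "d > 0" "\<forall>q\<in>V \<inter> cube n p d. \<bar>partial_deriv j f q - partial_deriv j f p\<bar> < \<epsilon>"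
    using assms(3,5) unfolding continuous_on_cube[OF V] by blast
  obtain d' where d': "d' > 0" "cube n p d' \<subseteq> V" using cube_subset_openin assms by blast
  have "cube n p (min d d') \<subseteq> V \<inter> cube n p d"
    using d' cube_mono[of "min d d'" d n p] cube_mono[of "min d d'" d' n p] by auto
  with d d' that[of "min d d'"] show ?thesis by auto
qed

text \<open>The points \<open>\<zeta> t\<close> will be mean value points, obtained by choice, of
  which one knows only that they end up in every cube around \<open>x\<close>; for a continuous
  \<open>g\<close> this is enough.\<close>

lemma tendsto_cube_compose:
  assumes V: "V \<subseteq> R_pow n" and g: "continuous_on V (g :: (nat \<Rightarrow> real) \<Rightarrow> real)" and "x \<in> V"
    and ev: "\<And>d. d > 0 \<Longrightarrow> \<forall>\<^sub>F t in F. \<zeta> t \<in> V \<inter> cube n x d"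
  shows "((\<lambda>t. g (\<zeta> t)) \<longlongrightarrow> g x) F"
proof (rule tendstoI)
  fix \<epsilon> :: real assume "\<epsilon> > 0"
  then obtain d where d: "d > 0" "\<forall>q\<in>V \<inter> cube n x d. \<bar>g q - g x\<bar> < \<epsilon>"
    using g \<open>x \<in> V\<close> unfolding continuous_on_cube[OF V] by blast
  from ev[OF d(1)] show "\<forall>\<^sub>F t in F. dist (g (\<zeta> t)) (g x) < \<epsilon>"
    by eventually_elim (use d in \<open>auto simp: dist_real_def\<close>)
qed

lemma eventually_in_cube:
  assumes "\<And>i. i < n \<Longrightarrow> ((\<lambda>t. \<gamma> t i) \<longlongrightarrow> x i) F" "\<forall>\<^sub>F t in F. \<gamma> t \<in> R_pow n" "d > 0"
  shows "\<forall>\<^sub>F t in F. \<gamma> t \<in> cube n x d"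
proof -
  have "\<forall>\<^sub>F t in F. \<forall>i\<in>{..<n}. dist (\<gamma> t i) (x i) < d"
    by (rule eventually_ball_finite) (auto intro!: tendstoD[OF assms(1)] assms(3))
  with assms(2) show ?thesis
    by eventually_elim (auto simp: cube_def dist_real_def)
qed

text \<open>Dividing the staircase formula by \<open>t - s\<close> leaves the difference quotients
  of the coordinates of \<open>\<gamma>\<close>, multiplied by partial derivatives of
  \<open>f\<close> at points squeezed towards \<open>\<gamma> s\<close>.\<close>

lemma DERIV_along_curve:
  assumes V: "openin (Euclidean_space n) V" and f: "Ck_on (Suc 0) n V f" and x: "\<gamma> s \<in> V"
    and ev: "\<forall>\<^sub>F t in nhds s. \<gamma> t \<in> R_pow n"
    and D: "\<And>i. i < n \<Longrightarrow> ((\<lambda>t. \<gamma> t i) has_field_derivative c i) (at s)"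
  shows "((\<lambda>t. f (\<gamma> t)) has_field_derivative (\<Sum>i<n. partial_deriv i f (\<gamma> s) * c i)) (at s)"
proof -
  note VR = openin_Euclidean_space_subset[OF V]
  obtain e where e: "e > 0" "cube n (\<gamma> s) e \<subseteq> V" using cube_subset_openin V x by blast
  have lim: "((\<lambda>t. \<gamma> t i) \<longlongrightarrow> \<gamma> s i) (at s)" if "i < n" for i
    using DERIV_isCont[OF D[OF that]] by (simp add: isCont_def)
  have ev': "\<forall>\<^sub>F t in at s. \<gamma> t \<in> R_pow n"
    using ev by (auto simp: eventually_at_filter elim: eventually_mono)
  have cube: "\<forall>\<^sub>F t in at s. \<gamma> t \<in> cube n (\<gamma> s) d" if "d > 0" for d
    using eventually_in_cube[OF lim ev' that] .
  \<comment> \<open>Packaged as one predicate, so that the intermediate points can be chosen for all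
    \<open>t\<close> at once.\<close>
  define Q where "Q t z \<longleftrightarrow> (\<forall>i<n. z i \<in> cube n (\<gamma> s) e \<and>
      (\<forall>l. \<bar>z i l - \<gamma> s l\<bar> \<le> \<bar>\<gamma> t l - \<gamma> s l\<bar>)) \<and>
      f (\<gamma> t) - f (\<gamma> s) = (\<Sum>i<n. partial_deriv i f (z i) * (\<gamma> t i - \<gamma> s i))" for t z
  have "\<exists>z. Q t z" if "\<gamma> t \<in> cube n (\<gamma> s) e" for t
  proof -
    have "\<gamma> s \<in> R_pow n" using x VR by blast
    from mvt_cube[OF f e(2) this that] obtain z where "\<And>i. i < n \<Longrightarrow> z i \<in> cube n (\<gamma> s) e"
      "\<And>i l. i < n \<Longrightarrow> \<bar>z i l - \<gamma> s l\<bar> \<le> \<bar>\<gamma> t l - \<gamma> s l\<bar>"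
      "f (\<gamma> t) - f (\<gamma> s) = (\<Sum>i<n. partial_deriv i f (z i) * (\<gamma> t i - \<gamma> s i))"
      by blast
    then show ?thesis unfolding Q_def by blast
  qed
  then obtain \<zeta> where "\<And>t. \<gamma> t \<in> cube n (\<gamma> s) e \<Longrightarrow> Q t (\<zeta> t)"
    by metis
  note \<zeta> = this[unfolded Q_def]
  have lim\<zeta>: "((\<lambda>t. partial_deriv i f (\<zeta> t i)) \<longlongrightarrow> partial_deriv i f (\<gamma> s)) (at s)" if "i < n" for i
  proof (rule tendsto_cube_compose[OF VR _ x])
    show "continuous_on V (partial_deriv i f)"
      using Ck_on_continuous_on[OF VR Ck_on_partial[OF f that]] .
    fix d :: real assume "d > 0"
    from cube[OF this] cube[OF e(1)] show "\<forall>\<^sub>F t in at s. \<zeta> t i \<in> V \<inter> cube n (\<gamma> s) d"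
    proof eventually_elim
      case (elim t)
      with \<zeta>[of t] that have z: "\<zeta> t i \<in> cube n (\<gamma> s) e" "\<And>l. \<bar>\<zeta> t i l - \<gamma> s l\<bar> \<le> \<bar>\<gamma> t l - \<gamma> s l\<bar>"
        by auto
      have "\<bar>\<zeta> t i l - \<gamma> s l\<bar> < d" if "l < n" for l
        using z(2)[of l] elim(1) that by (auto simp: cube_def intro: le_less_trans)
      with z(1) e(2) show ?case by (auto simp: cube_def)
    qed
  qed
  have "((\<lambda>t. \<Sum>i<n. partial_deriv i f (\<zeta> t i) * ((\<gamma> t i - \<gamma> s i) / (t - s)))
      \<longlongrightarrow> (\<Sum>i<n. partial_deriv i f (\<gamma> s) * c i)) (at s)"
    using D by (intro tendsto_sum tendsto_mult lim\<zeta>) (auto simp: has_field_derivative_iff)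
  moreover have "\<forall>\<^sub>F t in at s. (\<Sum>i<n. partial_deriv i f (\<zeta> t i) * ((\<gamma> t i - \<gamma> s i) / (t - s))) =
      (f (\<gamma> t) - f (\<gamma> s)) / (t - s)"
    using cube[OF e(1)]
  proof eventually_elim
    case (elim t)
    with \<zeta>[of t] show ?case by (simp add: sum_divide_distrib)
  qed
  ultimately show ?thesis
    unfolding has_field_derivative_iff by (rule Lim_transform_eventually)
qed

text \<open>From \<open>m\<close> on the coordinates of \<open>G\<close> are constantly 0, because
  \<open>G\<close> maps into a subset of \<open>R_pow m\<close>.\<close>

lemma continuous_on_compose_coords:
  assumes "continuous_on U (f :: (nat \<Rightarrow> real) \<Rightarrow> real)" "U \<subseteq> R_pow m" "G ` V \<subseteq> U"
    "\<And>i. i < m \<Longrightarrow> continuous_on V (\<lambda>p. G p i)"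
  shows "continuous_on V (\<lambda>p. f (G p))"
proof -
  have "continuous_on V (\<lambda>p. G p i)" for i
  proof (cases "i < m")
    case False
    then have "G p i = 0" if "p \<in> V" for p using assms(2,3) that by force
    then show ?thesis using continuous_on_const[of V 0] by (simp cong: continuous_on_cong)
  qed (rule assms(4))
  then have "continuous_on V G"
    by (intro continuous_on_coordinatewise_then_product)
  then show ?thesis
    using continuous_on_compose2[OF assms(1)] assms(3) by blast
qed

lemma DERIV_partial_compose:
  assumes V: "openin (Euclidean_space n) V" and U: "openin (Euclidean_space m) U"
    and G: "G ` V \<subseteq> U" "\<And>i. i < m \<Longrightarrow> Ck_on (Suc 0) n V (\<lambda>p. G p i)"
    and f: "Ck_on (Suc 0) m U f" and "p \<in> V" "j < n"
  shows "((\<lambda>t. f (G (p(j := t)))) has_field_derivative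
    (\<Sum>i<m. partial_deriv i f (G p) * partial_deriv j (\<lambda>p. G p i) p)) (at (p j))"
proof -
  have ev: "\<forall>\<^sub>F t in nhds (p j). G (p(j := t)) \<in> R_pow m"
    using eventually_fun_upd_in[OF V \<open>p \<in> V\<close> \<open>j < n\<close>]
    by eventually_elim (use G(1) openin_Euclidean_space_subset[OF U] in blast)
  have "G p \<in> U" using G(1) \<open>p \<in> V\<close> by auto
  note D = DERIV_along_curve[OF U f, where \<gamma> = "\<lambda>t. G (p(j := t))" and s = "p j"
      and c = "\<lambda>i. partial_deriv j (\<lambda>p. G p i) p", unfolded fun_upd_triv, OF this ev]
  show ?thesis
  proof (rule D)
    fix i assume "i < m"
    from Ck_on_has_partial[OF G(2)[OF this] \<open>p \<in> V\<close> \<open>j < n\<close>]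
    show "((\<lambda>t. G (p(j := t)) i) has_field_derivative partial_deriv j (\<lambda>p. G p i) p) (at (p j))" .
  qed
qed

text \<open>By the chain rule a partial derivative of the composite is a sum of products of
  \<open>partial_deriv i f (G p)\<close>, again a composite with \<open>G\<close>, and partial
  derivatives of \<open>G\<close>. Hence the induction on \<open>k\<close> is over all
  \<open>f\<close> with \<open>G\<close> fixed.\<close>

lemma Ck_on_compose:
  assumes V: "openin (Euclidean_space n) V" and U: "openin (Euclidean_space m) U" and G: "G ` V \<subseteq> U"
  shows "(\<And>i. i < m \<Longrightarrow> Ck_on k n V (\<lambda>p. G p i)) \<Longrightarrow> Ck_on k m U f \<Longrightarrow> Ck_on k n V (\<lambda>p. f (G p))"
proof (induction k arbitrary: f)
  case 0
  note VR = openin_Euclidean_space_subset[OF V] and UR = openin_Euclidean_space_subset[OF U]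
  have "continuous_on V (\<lambda>p. f (G p))"
    by (rule continuous_on_compose_coords[OF Ck_on_continuous_on[OF UR 0(2)] UR G
          Ck_on_continuous_on[OF VR 0(1)]])
  then show ?case using VR by (simp add: continuous_map_R_pow_iff)
next
  case (Suc k)
  note VR = openin_Euclidean_space_subset[OF V] and UR = openin_Euclidean_space_subset[OF U]
  have c: "continuous_on V (\<lambda>p. f (G p))"
    by (rule continuous_on_compose_coords[OF Ck_on_continuous_on[OF UR Suc.prems(2)] UR G
          Ck_on_continuous_on[OF VR Suc.prems(1)]])
  show ?case
  proof (rule Ck_on_SucI[OF V c])
    fix j p assume j: "j < n" "p \<in> V"
    have *: "Ck_on (Suc 0) n V (\<lambda>p. G p i)" if "i < m" for i
      by (rule Ck_on_le[OF _ Suc.prems(1)[OF that]]) simp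
    have "Ck_on (Suc 0) m U f"
      by (rule Ck_on_le[OF _ Suc.prems(2)]) simp
    from DERIV_partial_compose[OF V U G * this j(2,1)]
    show "((\<lambda>t. f (G (p(j := t)))) has_field_derivative
        (\<Sum>i<m. partial_deriv i f (G p) * partial_deriv j (\<lambda>p. G p i) p)) (at (p j))" .
  next
    fix j assume "j < n"
    show "Ck_on k n V (\<lambda>p. \<Sum>i<m. partial_deriv i f (G p) * partial_deriv j (\<lambda>p. G p i) p)"
    proof (intro Ck_on_sum[OF V] Ck_on_mult[OF V])
      fix i assume i: "i \<in> {..<m}"
      show "Ck_on k n V (\<lambda>p. partial_deriv i f (G p))"
        by (rule Suc.IH[OF Ck_on_SucD[OF Suc.prems(1)] Ck_on_partial[OF Suc.prems(2)]]) (use i in auto)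
      show "Ck_on k n V (partial_deriv j (\<lambda>p. G p i))"
        by (rule Ck_on_partial[OF Suc.prems(1) \<open>j < n\<close>]) (use i in auto)
    qed
  qed
qed

section \<open>Exchanging a coordinate for a function\<close>

definition replace_coord :: "nat \<Rightarrow> ((nat \<Rightarrow> real) \<Rightarrow> real) \<Rightarrow> (nat \<Rightarrow> real) \<Rightarrow> (nat \<Rightarrow> real)" where
  "replace_coord j f x = x(j := f x)"

lemma replace_coord_apply: "replace_coord j f x i = (if i = j then f x else x i)"
  by (simp add: replace_coord_def)

lemma cube_fun_upd:
  assumes "x \<in> cube n p e" "y \<in> cube n p e" "min (x j) (y j) \<le> t" "t \<le> max (x j) (y j)" "j < n"
  shows "x(j := t) \<in> cube n p e"
proof -
  have "\<bar>x j - p j\<bar> < e" "\<bar>y j - p j\<bar> < e" using assms by (auto simp: cube_def)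
  then have "\<bar>t - p j\<bar> < e" using assms(3,4) by linarith
  with assms(1,5) show ?thesis by (auto simp: cube_def)
qed

text \<open>The one-variable implicit function theorem, in the form that exchanging the \<open>j\<close>-th coordinate
  for \<open>f\<close> is a local diffeomorphism. Existence of the inverse is the intermediate value theorem on
  lines parallel to the \<open>j\<close>-th axis.\<close>

context
  fixes n j :: nat and B :: "(nat \<Rightarrow> real) set" and f :: "(nat \<Rightarrow> real) \<Rightarrow> real" and p :: "nat \<Rightarrow> real" and e :: real
  assumes e: "e > 0" and f: "\<And>k. Ck_on k n (cube n p e) f" and jn: "j < n" and p: "p \<in> R_pow n"
    and nz: "\<And>q. q \<in> cube n p e \<Longrightarrow> \<bar>partial_deriv j f q - partial_deriv j f p\<bar> < \<bar>partial_deriv j f p\<bar>"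
begin

private abbreviation (input) "C \<equiv> cube n p e"
private abbreviation (input) "\<Phi> \<equiv> replace_coord j f"
private abbreviation (input) "\<Psi> \<equiv> inv_into C \<Phi>"

private lemma C_sub: "C \<subseteq> R_pow n" by (auto simp: cube_def)

text \<open>\<open>nz\<close> confines the derivative to the open interval between 0 and twice its
  value at \<open>p\<close>. Besides being nonzero it thus keeps its sign, which fixes the direction
  of monotonicity in \<open>solve\<close>.\<close>

private lemma nonzero: "q \<in> C \<Longrightarrow> partial_deriv j f q \<noteq> 0"
  using nz by force

private lemma slope:
  assumes "x \<in> C" "y \<in> C" "\<And>l. l \<noteq> j \<Longrightarrow> x l = y l"
  obtains t where "min (x j) (y j) \<le> t" "t \<le> max (x j) (y j)" "x(j := t) \<in> C"
    "f y - f x = partial_deriv j f (x(j := t)) * (y j - x j)"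
proof -
  have y: "x(j := y j) = y" using assms(3) by (auto simp: fun_eq_iff)
  obtain t where t: "min (x j) (y j) \<le> t" "t \<le> max (x j) (y j)"
    "f (x(j := y j)) - f (x(j := x j)) = partial_deriv j f (x(j := t)) * (y j - x j)"
    using mvt_coordinate[OF f[of "Suc 0"] jn, of "x j" "y j" x] cube_fun_upd[OF assms(1,2) _ _ jn] by blast
  show ?thesis
    using that[OF t(1,2) cube_fun_upd[OF assms(1,2) t(1,2) jn]] t(3) unfolding y by simp
qed

text \<open>Two points with the same image lie on a line parallel to the \<open>j\<close>-th axis,
  and along such a line \<open>f\<close> has nonvanishing slope.\<close>

lemma inj_on_replace_coordinate: "inj_on \<Phi> C"
proof (rule inj_onI)
  fix x y assume xy: "x \<in> C" "y \<in> C" "\<Phi> x = \<Phi> y"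
  have eq: "x l = y l" if "l \<noteq> j" for l using fun_cong[OF xy(3), of l] that by (simp add: replace_coord_apply)
  have "f x = f y" using fun_cong[OF xy(3), of j] by (simp add: replace_coord_apply)
  obtain t where "x(j := t) \<in> C" "f y - f x = partial_deriv j f (x(j := t)) * (y j - x j)"
    using slope[OF xy(1,2) eq] by blast
  with \<open>f x = f y\<close> nonzero have "x j = y j" by simp
  with eq show "x = y" by (metis ext)
qed

private lemma f_continuous: "continuous_on C f"
  using Ck_on_continuous_on[OF C_sub f[of 0]] .

text \<open>On the line through \<open>x\<close> parallel to the \<open>j\<close>-th axis,
  \<open>f\<close> is strictly below \<open>f x\<close> on one side and strictly above it on the
  other. This persists on nearby parallel lines, where the intermediate value theorem finds the
  preimage of \<open>q\<close>. Existence of preimages makes the image open; the control of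
  \<open>y j\<close> makes the inverse continuous.\<close>

private lemma solve:
  assumes x: "x \<in> C" and \<epsilon>: "\<epsilon> > 0"
  obtains \<delta> where "\<delta> > 0"
    "\<And>q. q \<in> cube n (\<Phi> x) \<delta> \<Longrightarrow> \<exists>y\<in>C. \<Phi> y = q \<and> \<bar>y j - x j\<bar> < \<epsilon>"
proof -
  have xR: "x \<in> R_pow n" using x C_sub by blast
  obtain \<eta>' where \<eta>': "\<eta>' > 0" "cube n x \<eta>' \<subseteq> C"
    using cube_subset_openin[OF openin_cube x] by blast
  \<comment> \<open>Half of the smaller bound, so that the closed interval of radius
    \<open>\<eta>\<close> around \<open>x j\<close> fits strictly inside both.\<close>
  define \<eta> where "\<eta> = min \<eta>' \<epsilon> / 2"
  have \<eta>: "\<eta> > 0" "\<eta> < \<epsilon>" "\<eta> < \<eta>'" using \<eta>' \<epsilon> by (auto simp: \<eta>_def)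
  have near: "q(j := t) \<in> C" if "\<And>l. l < n \<Longrightarrow> l \<noteq> j \<Longrightarrow> \<bar>q l - x l\<bar> < \<eta>" "q \<in> R_pow n" "\<bar>t - x j\<bar> \<le> \<eta>" for q t
  proof -
    have "q(j := t) \<in> cube n x \<eta>'" using that \<eta> jn by (fastforce simp: cube_def)
    then show ?thesis using \<eta>'(2) by blast
  qed
  define t1 t2 where "t1 = x j - \<eta>" and "t2 = x j + \<eta>"
  have C12: "x(j := t1) \<in> C" "x(j := t2) \<in> C"
    using near[OF _ xR, of t1] near[OF _ xR, of t2] \<eta>(1) by (auto simp: t1_def t2_def)
  obtain s1 where s1: "x(j := s1) \<in> C" "f x - f (x(j := t1)) = partial_deriv j f (x(j := s1)) * \<eta>"
    using slope[OF C12(1) x] by (auto simp: t1_def)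
  obtain s2 where s2: "x(j := s2) \<in> C" "f (x(j := t2)) - f x = partial_deriv j f (x(j := s2)) * \<eta>"
    using slope[OF x C12(2)] by (auto simp: t2_def)
  \<comment> \<open>The gaps between \<open>f x\<close> and the values of \<open>f\<close> at the
    two ends of the interval.\<close>
  define u1 u2 where "u1 = \<bar>f x - f (x(j := t1))\<bar>" and "u2 = \<bar>f (x(j := t2)) - f x\<bar>"
  have u: "u1 > 0" "u2 > 0"
    using s1 s2 nonzero \<eta>(1) by (auto simp: u1_def u2_def)
  \<comment> \<open>The sign of the derivative at \<open>p\<close> decides which end is the lower
    one; it selects the increasing or the decreasing version of the intermediate value theorem
    below.\<close>
  have mono: "f (x(j := t1)) = f x - u1 \<and> f (x(j := t2)) = f x + u2 \<or>
              f (x(j := t1)) = f x + u1 \<and> f (x(j := t2)) = f x - u2"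
  proof (cases "partial_deriv j f p > 0")
    case True
    then have "partial_deriv j f (x(j := s1)) > 0" "partial_deriv j f (x(j := s2)) > 0"
      using nz[OF s1(1)] nz[OF s2(1)] by linarith+
    then have "f x - f (x(j := t1)) > 0" "f (x(j := t2)) - f x > 0"
      using s1(2) s2(2) \<eta>(1) by simp_all
    then show ?thesis by (auto simp: u1_def u2_def)
  next
    case False
    then have "partial_deriv j f (x(j := s1)) < 0" "partial_deriv j f (x(j := s2)) < 0"
      using nz[OF s1(1)] nz[OF s2(1)] by linarith+
    then have "f x - f (x(j := t1)) < 0" "f (x(j := t2)) - f x < 0"
      using s1(2) s2(2) \<eta>(1) by (simp_all add: mult_neg_pos)
    then show ?thesis by (auto simp: u1_def u2_def)
  qed
  obtain d1 where d1: "d1 > 0" "\<forall>q\<in>C \<inter> cube n (x(j := t1)) d1. \<bar>f q - f (x(j := t1))\<bar> < u1 / 2"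
    using f_continuous C12(1) half_gt_zero[OF u(1)] unfolding continuous_on_cube[OF C_sub] by blast
  obtain d2 where d2: "d2 > 0" "\<forall>q\<in>C \<inter> cube n (x(j := t2)) d2. \<bar>f q - f (x(j := t2))\<bar> < u2 / 2"
    using f_continuous C12(2) half_gt_zero[OF u(2)] unfolding continuous_on_cube[OF C_sub] by blast
  \<comment> \<open>\<open>d1\<close> and \<open>d2\<close> keep \<open>f\<close> at the ends within
    half a gap of its values on the central line, \<open>\<eta>\<close> keeps the segment inside the
    cube, and half a gap bounds the distance of the target \<open>q j\<close> from
    \<open>f x\<close>. Together they place the target between the values at the ends.\<close>
  define \<delta> where "\<delta> = min (min d1 d2) (min \<eta> (min (u1 / 2) (u2 / 2)))"
  have \<delta>: "\<delta> > 0" "\<delta> \<le> d1" "\<delta> \<le> d2" "\<delta> \<le> \<eta>" "\<delta> \<le> u1 / 2" "\<delta> \<le> u2 / 2"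
    using d1(1) d2(1) \<eta>(1) u by (auto simp: \<delta>_def)
  have "\<exists>y\<in>C. \<Phi> y = q \<and> \<bar>y j - x j\<bar> < \<epsilon>" if q: "q \<in> cube n (\<Phi> x) \<delta>" for q
  proof -
    have qR: "q \<in> R_pow n" and ql: "\<And>l. l < n \<Longrightarrow> l \<noteq> j \<Longrightarrow> \<bar>q l - x l\<bar> < \<delta>" and qj: "\<bar>q j - f x\<bar> < \<delta>"
      using q jn unfolding cube_def by (auto simp: replace_coord_apply split: if_splits)
    have ql': "\<And>l. l < n \<Longrightarrow> l \<noteq> j \<Longrightarrow> \<bar>q l - x l\<bar> < \<eta>" using ql \<delta>(4) by fastforce
    have inC: "q(j := t) \<in> C" if "t1 \<le> t" "t \<le> t2" for t
      using near[OF ql' qR] that by (auto simp: t1_def t2_def)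
    have le: "t1 \<le> t2" using \<eta>(1) by (simp add: t1_def t2_def)
    have c: "q(j := t) \<in> cube n (x(j := t)) d" if "\<delta> \<le> d" for t d
      using ql qR jn that \<delta>(1) unfolding cube_def by fastforce
    have f1: "\<bar>f (q(j := t1)) - f (x(j := t1))\<bar> < u1 / 2"
      using d1(2) inC[OF order_refl le] c[OF \<delta>(2)] by blast
    have f2: "\<bar>f (q(j := t2)) - f (x(j := t2))\<bar> < u2 / 2"
      using d2(2) inC[OF le order_refl] c[OF \<delta>(3)] by blast
    have cont: "continuous_on {t1..t2} (\<lambda>t. f (q(j := t)))"
    proof (rule continuous_at_imp_continuous_on, intro ballI)
      fix t assume "t \<in> {t1..t2}"
      then have "q(j := t) \<in> C" using inC by auto
      from Ck_on_has_partial[OF f this jn] show "isCont (\<lambda>t. f (q(j := t))) t"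
        using DERIV_isCont by (simp only: fun_upd_upd fun_upd_same) blast
    qed
    have "\<exists>t. t1 \<le> t \<and> t \<le> t2 \<and> f (q(j := t)) = q j"
      using mono
    proof
      assume m: "f (x(j := t1)) = f x - u1 \<and> f (x(j := t2)) = f x + u2"
      have "f (q(j := t1)) \<le> q j" "q j \<le> f (q(j := t2))"
        using m f1 f2 qj \<delta>(5,6) by linarith+
      then show ?thesis using IVT'[OF _ _ le cont] by blast
    next
      assume m: "f (x(j := t1)) = f x + u1 \<and> f (x(j := t2)) = f x - u2"
      have "f (q(j := t2)) \<le> q j" "q j \<le> f (q(j := t1))"
        using m f1 f2 qj \<delta>(5,6) by linarith+
      then show ?thesis using IVT2'[OF _ _ le cont] by blast
    qed
    then obtain t where t: "t1 \<le> t" "t \<le> t2" "f (q(j := t)) = q j" by blast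
    have "\<Phi> (q(j := t)) = q" using t(3) by (simp add: replace_coord_def)
    moreover have "\<bar>(q(j := t)) j - x j\<bar> < \<epsilon>" using t(1,2) \<eta>(2) by (auto simp: t1_def t2_def)
    ultimately show ?thesis using inC[OF t(1,2)] by blast
  qed
  with \<delta>(1) that show ?thesis by blast
qed

lemma openin_replace_coordinate: "openin (Euclidean_space n) (\<Phi> ` C)"
proof (rule openin_cubeI)
  show "\<Phi> ` C \<subseteq> R_pow n" using C_sub jn by (auto simp: replace_coord_apply)
  fix q assume "q \<in> \<Phi> ` C"
  then obtain x where x: "x \<in> C" "q = \<Phi> x" by blast
  obtain \<delta> where "\<delta> > 0" "\<And>q. q \<in> cube n (\<Phi> x) \<delta> \<Longrightarrow> \<exists>y\<in>C. \<Phi> y = q \<and> \<bar>y j - x j\<bar> < 1"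
    using solve[OF x(1) zero_less_one] by blast
  then show "\<exists>d>0. cube n q d \<subseteq> \<Phi> ` C" unfolding x(2) by blast
qed

private lemma \<Psi>_in: "q \<in> \<Phi> ` C \<Longrightarrow> \<Psi> q \<in> C" "q \<in> \<Phi> ` C \<Longrightarrow> \<Phi> (\<Psi> q) = q"
  by (erule inv_into_into, erule f_inv_into_f)

private lemma \<Psi>_eq: "q \<in> \<Phi> ` C \<Longrightarrow> l \<noteq> j \<Longrightarrow> \<Psi> q l = q l" "q \<in> \<Phi> ` C \<Longrightarrow> f (\<Psi> q) = q j"
  using \<Psi>_in(2)[of q] replace_coord_apply[of j f "\<Psi> q"] by simp_all

private lemma \<psi>_near:
  assumes "q \<in> \<Phi> ` C" "\<epsilon> > 0"
  obtains \<delta> where "\<delta> > 0" "cube n q \<delta> \<subseteq> \<Phi> ` C" "\<And>q'. q' \<in> cube n q \<delta> \<Longrightarrow> \<bar>\<Psi> q' j - \<Psi> q j\<bar> < \<epsilon>"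
proof -
  obtain \<delta> where \<delta>: "\<delta> > 0" "\<And>q'. q' \<in> cube n (\<Phi> (\<Psi> q)) \<delta> \<Longrightarrow> \<exists>y\<in>C. \<Phi> y = q' \<and> \<bar>y j - \<Psi> q j\<bar> < \<epsilon>"
    using solve[OF \<Psi>_in(1)[OF assms(1)] assms(2)] by blast
  note \<delta>' = \<delta>(2)[unfolded \<Psi>_in(2)[OF assms(1)]]
  show ?thesis
  proof (rule that[OF \<delta>(1)])
    show "cube n q \<delta> \<subseteq> \<Phi> ` C" using \<delta>' by blast
    fix q' assume "q' \<in> cube n q \<delta>"
    then obtain y where y: "y \<in> C" "\<Phi> y = q'" "\<bar>y j - \<Psi> q j\<bar> < \<epsilon>" using \<delta>' by blast
    have "\<Psi> (\<Phi> y) = y" by (rule inv_into_f_f[OF inj_on_replace_coordinate y(1)])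
    with y(2) have "\<Psi> q' = y" by simp
    with y(3) show "\<bar>\<Psi> q' j - \<Psi> q j\<bar> < \<epsilon>" by simp
  qed
qed

private lemma \<psi>_continuous: "continuous_on (\<Phi> ` C) (\<lambda>q. \<Psi> q j)"
  unfolding continuous_on_cube[OF openin_Euclidean_space_subset[OF openin_replace_coordinate]]
proof (intro ballI allI impI)
  fix q and \<epsilon> :: real assume q: "q \<in> \<Phi> ` C" "\<epsilon> > 0"
  obtain \<delta> where "\<delta> > 0" "\<And>q'. q' \<in> cube n q \<delta> \<Longrightarrow> \<bar>\<Psi> q' j - \<Psi> q j\<bar> < \<epsilon>"
    using \<psi>_near[OF q] by metis
  then show "\<exists>d>0. \<forall>q'\<in>\<Phi> ` C \<inter> cube n q d. \<bar>\<Psi> q' j - \<Psi> q j\<bar> < \<epsilon>" by blast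
qed

text \<open>Implicit differentiation by the mean value theorem: the new solution and the comparison
  point \<open>x' t\<close> lie on one line parallel to the \<open>j\<close>-th axis, so the change
  of the solution times a slope of \<open>f\<close> equals \<open>(q(i := t)) j - f (x' t)\<close>.
  Divide by \<open>t - q i\<close> and let the slope tend to its value at the old solution. Only
  continuity of the inverse is presupposed.\<close>

private lemma \<psi>_DERIV:
  assumes q: "q \<in> \<Phi> ` C" and i: "i < n"
  shows "((\<lambda>t. \<Psi> (q(i := t)) j) has_field_derivative
     (if i = j then 1 else - 1 * partial_deriv i f (\<Psi> q)) * inverse (partial_deriv j f (\<Psi> q))) (at (q i))"
proof -
  define x where "x = \<Psi> q"
  have x: "x \<in> C" "\<Phi> x = q" unfolding x_def using \<Psi>_in[OF q] by auto
  have xR: "x \<in> R_pow n" using x C_sub by blast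
  have xl: "x l = q l" if "l \<noteq> j" for l using x(2) that by (auto simp: replace_coord_apply)
  \<comment> \<open>The old solution moved in direction \<open>i\<close> with its
    \<open>j\<close>-th coordinate kept. For \<open>i = j\<close> only the prescribed value of
    \<open>f\<close> moves, so the point stays put.\<close>
  define x' where "x' t = (if i = j then x else x(i := t))" for t
  have x'R: "x' t \<in> R_pow n" for t using xR i by (auto simp: x'_def)
  have xi: "x = x(i := x i)" by simp
  have x'C: "\<forall>\<^sub>F t in nhds (q i). x' t \<in> C"
  proof (cases "i = j")
    case False
    have "\<forall>\<^sub>F t in nhds (x i). x(i := t) \<in> C" by (rule eventually_fun_upd_in[OF openin_cube x(1) i])
    with False xl show ?thesis by (simp add: x'_def)
  qed (simp add: x'_def x)
  have WC: "\<forall>\<^sub>F t in nhds (q i). q(i := t) \<in> \<Phi> ` C"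
    by (rule eventually_fun_upd_in[OF openin_replace_coordinate q i])
  have good: "\<exists>s. x' t \<in> C \<and> q(i := t) \<in> \<Phi> ` C \<longrightarrow>
      (x' t)(j := s) \<in> C \<and> \<bar>s - x j\<bar> \<le> \<bar>\<Psi> (q(i := t)) j - x j\<bar> \<and>
      (q(i := t)) j - f (x' t) = partial_deriv j f ((x' t)(j := s)) * (\<Psi> (q(i := t)) j - x j)" for t
  proof (cases "x' t \<in> C \<and> q(i := t) \<in> \<Phi> ` C")
    case True
    have *: "x' t l = \<Psi> (q(i := t)) l" if "l \<noteq> j" for l
      using \<Psi>_eq(1)[of "q(i := t)" l] True that xl by (auto simp: x'_def)
    have x'j: "x' t j = x j" by (auto simp: x'_def)
    obtain s where s: "min (x' t j) (\<Psi> (q(i := t)) j) \<le> s" "s \<le> max (x' t j) (\<Psi> (q(i := t)) j)"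
      "(x' t)(j := s) \<in> C"
      "f (\<Psi> (q(i := t))) - f (x' t) = partial_deriv j f ((x' t)(j := s)) * (\<Psi> (q(i := t)) j - x' t j)"
      using slope[of "x' t" "\<Psi> (q(i := t))"] True \<Psi>_in(1)[of "q(i := t)"] * by blast
    have "f (\<Psi> (q(i := t))) = (q(i := t)) j" using \<Psi>_eq(2) True by blast
    with s x'j show ?thesis by (intro exI[of _ s]) auto
  next
    case False
    then show ?thesis by blast
  qed
  define Q where "Q t s \<longleftrightarrow> (x' t)(j := s) \<in> C \<and> \<bar>s - x j\<bar> \<le> \<bar>\<Psi> (q(i := t)) j - x j\<bar> \<and>
      (q(i := t)) j - f (x' t) = partial_deriv j f ((x' t)(j := s)) * (\<Psi> (q(i := t)) j - x j)" for t s
  have "\<exists>s. x' t \<in> C \<and> q(i := t) \<in> \<Phi> ` C \<longrightarrow> Q t s" for t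
    using good[of t] unfolding Q_def .
  then obtain s where "\<And>t. x' t \<in> C \<and> q(i := t) \<in> \<Phi> ` C \<longrightarrow> Q t (s t)" by metis
  note s = this[unfolded Q_def]
  have ev: "\<forall>\<^sub>F t in at (q i). x' t \<in> C \<and> q(i := t) \<in> \<Phi> ` C"
    using eventually_conj[OF x'C WC] by (auto simp: eventually_at_filter elim: eventually_mono)
  have lim_id: "((\<lambda>t. t) \<longlongrightarrow> q i) (at (q i))" by simp
  have \<psi>lim: "((\<lambda>t. \<Psi> (q(i := t)) j) \<longlongrightarrow> x j) (at (q i))"
    unfolding x_def
  proof (rule tendsto_cube_compose[OF openin_Euclidean_space_subset[OF openin_replace_coordinate] \<psi>_continuous q])
    fix d :: real assume d: "d > 0"
    have "\<forall>\<^sub>F t in at (q i). dist t (q i) < d" using d by (simp add: lim_id tendstoD)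
    with ev show "\<forall>\<^sub>F t in at (q i). q(i := t) \<in> \<Phi> ` C \<inter> cube n q d"
    proof eventually_elim
      case (elim t)
      have "q(i := t) \<in> cube n q d"
        using fun_upd_in_cube[of q n t i d] q openin_Euclidean_space_subset[OF openin_replace_coordinate] elim i
        by (auto simp: dist_real_def)
      with elim show ?case by blast
    qed
  qed
  \<comment> \<open>The intermediate value \<open>s t\<close> is no farther from \<open>x j\<close>
    than the new solution, which converges by continuity of the inverse.\<close>
  have \<xi>lim: "((\<lambda>t. partial_deriv j f ((x' t)(j := s t))) \<longlongrightarrow> partial_deriv j f x) (at (q i))"
  proof (rule tendsto_cube_compose[OF C_sub Ck_on_continuous_on[OF C_sub Ck_on_partial[OF f jn]] x(1)])
    fix d :: real assume d: "d > 0"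
    have "\<forall>\<^sub>F t in at (q i). dist t (q i) < d" using d by (simp add: lim_id tendstoD)
    moreover have "\<forall>\<^sub>F t in at (q i). dist (\<Psi> (q(i := t)) j) (x j) < d" using d \<psi>lim by (simp add: tendstoD)
    ultimately show "\<forall>\<^sub>F t in at (q i). (x' t)(j := s t) \<in> C \<inter> cube n x d"
      using ev
    proof eventually_elim
      case (elim t)
      with s[of t] have st: "(x' t)(j := s t) \<in> C" "\<bar>s t - x j\<bar> < d" by (auto simp: dist_real_def)
      have "\<bar>((x' t)(j := s t)) l - x l\<bar> < d" for l
        using st(2) elim(1) xl d by (auto simp: x'_def dist_real_def)
      with st(1) C_sub have "(x' t)(j := s t) \<in> cube n x d" unfolding cube_def by blast
      with st(1) show ?case by blast
    qed
  qed
  \<comment> \<open>Here \<open>f x = q j\<close>. For \<open>i = j\<close> the numerator is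
    therefore \<open>t - q j\<close> and the quotient is 1; otherwise \<open>x i = q i\<close>, and
    it is minus the difference quotient of \<open>f\<close> in direction \<open>i\<close>.\<close>
  have num: "((\<lambda>t. ((q(i := t)) j - f (x' t)) / (t - q i)) \<longlongrightarrow>
      (if i = j then 1 else - 1 * partial_deriv i f x)) (at (q i))"
  proof (cases "i = j")
    case True
    have "f x = q j" using x(2) by (auto simp: replace_coord_apply)
    have "\<forall>\<^sub>F t in at (q i). 1 = ((q(i := t)) j - f (x' t)) / (t - q i)"
      unfolding eventually_at_filter
      by (rule always_eventually) (use True \<open>f x = q j\<close> in \<open>auto simp: x'_def\<close>)
    then have "((\<lambda>t. ((q(i := t)) j - f (x' t)) / (t - q i)) \<longlongrightarrow> 1) (at (q i))"
      by (rule Lim_transform_eventually[OF tendsto_const])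
    with True show ?thesis by simp
  next
    case False
    have "f x = q j" using x(2) by (auto simp: replace_coord_apply)
    have "((\<lambda>t. (f (x(i := t)) - f x) / (t - x i)) \<longlongrightarrow> partial_deriv i f x) (at (x i))"
      using Ck_on_has_partial[OF f x(1) i] unfolding has_field_derivative_iff fun_upd_triv .
    then have "((\<lambda>t. - ((f (x(i := t)) - f x) / (t - q i))) \<longlongrightarrow> - partial_deriv i f x) (at (q i))"
      unfolding xl[OF False] by (rule tendsto_minus)
    moreover have "- ((f (x(i := t)) - f x) / (t - q i)) = ((q(i := t)) j - f (x' t)) / (t - q i)" for t
      using False \<open>f x = q j\<close> by (simp add: x'_def divide_simps del: fun_upd_apply) (simp add: fun_upd_other)?
    ultimately show ?thesis using False by simp
  qed
  have "((\<lambda>t. ((q(i := t)) j - f (x' t)) / (t - q i) * inverse (partial_deriv j f ((x' t)(j := s t))))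
     \<longlongrightarrow> (if i = j then 1 else - 1 * partial_deriv i f x) * inverse (partial_deriv j f x)) (at (q i))"
    by (intro tendsto_mult num tendsto_inverse \<xi>lim nonzero x)
  moreover have "\<forall>\<^sub>F t in at (q i). ((q(i := t)) j - f (x' t)) / (t - q i) * inverse (partial_deriv j f ((x' t)(j := s t)))
      = (\<Psi> (q(i := t)) j - x j) / (t - q i)"
    using ev
  proof eventually_elim
    case (elim t)
    with s[of t] have *: "(x' t)(j := s t) \<in> C"
      "(q(i := t)) j - f (x' t) = partial_deriv j f ((x' t)(j := s t)) * (\<Psi> (q(i := t)) j - x j)" by auto
    have "a * y / d * inverse a = y / d" if "a \<noteq> 0" for a y d :: real
      using that by (simp add: field_simps)
    from this[OF nonzero[OF *(1)]] show ?case unfolding *(2) .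
  qed
  ultimately have "((\<lambda>t. (\<Psi> (q(i := t)) j - x j) / (t - q i)) \<longlongrightarrow>
      (if i = j then 1 else - 1 * partial_deriv i f x) * inverse (partial_deriv j f x)) (at (q i))"
    by (rule Lim_transform_eventually)
  then show ?thesis
    unfolding has_field_derivative_iff fun_upd_triv x_def .
qed

text \<open>Apart from the \<open>j\<close>-th one, the coordinates of the inverse are those of its
  argument.\<close>

private lemma \<Psi>_Ck: "Ck_on k n (\<Phi> ` C) (\<lambda>q. \<Psi> q j) \<Longrightarrow> Ck_on k n (\<Phi> ` C) (\<lambda>q. \<Psi> q l)"
proof (cases "l = j")
  case False
  have "q l = \<Psi> q l" if "q \<in> \<Phi> ` C" for q using \<Psi>_eq(1)[OF that False] by simp
  then show ?thesis
    by (rule Ck_on_cong[OF openin_replace_coordinate Ck_on_coord[OF openin_replace_coordinate]])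
qed simp

text \<open>Bootstrapping: the formula for the derivative of the inverse contains only the inverse
  itself, inside partial derivatives of \<open>f\<close>. So class \<open>C^k\<close> of the inverse
  yields the next class.\<close>

lemma Ck_on_replace_coordinate_inverse: "Ck_on k n (\<Phi> ` C) (\<lambda>q. \<Psi> q l)"
proof (rule \<Psi>_Ck, induction k)
  case 0
  then show ?case
    using \<psi>_continuous continuous_map_R_pow_iff[OF openin_Euclidean_space_subset[OF openin_replace_coordinate]]
    by simp
next
  case (Suc k)
  note W = openin_replace_coordinate
  have comp: "Ck_on k n (\<Phi> ` C) (\<lambda>q. partial_deriv i f (\<Psi> q))" if "i < n" for i
    by (rule Ck_on_compose[OF W openin_cube _ \<Psi>_Ck[OF Suc] Ck_on_partial[OF f that]])
       (use \<Psi>_in(1) in blast)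
  show ?case
  proof (rule Ck_on_SucI[OF W \<psi>_continuous \<psi>_DERIV])
    fix i assume "i < n"
    have "Ck_on k n (\<Phi> ` C) (\<lambda>q. if i = j then 1 else - 1 * partial_deriv i f (\<Psi> q))"
    proof (cases "i = j")
      case True
      then show ?thesis by (simp add: Ck_on_const)
    next
      case False
      then show ?thesis using Ck_on_mult[OF W Ck_on_const comp[OF \<open>i < n\<close>], of "-1"] by simp
    qed
    moreover have "Ck_on k n (\<Phi> ` C) (\<lambda>q. inverse (partial_deriv j f (\<Psi> q)))"
      by (rule Ck_on_inverse[OF W _ comp[OF jn]]) (use nonzero \<Psi>_in(1) in blast)
    ultimately show "Ck_on k n (\<Phi> ` C)
        (\<lambda>q. (if i = j then 1 else - 1 * partial_deriv i f (\<Psi> q)) * inverse (partial_deriv j f (\<Psi> q)))"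
      by (rule Ck_on_mult[OF W])
  qed
qed

end

text \<open>Continuity of the derivative, with its own absolute value at \<open>p\<close> as
  tolerance, provides a cube on which it cannot reach 0.\<close>

lemma replace_coordinate_local_diffeo:
  assumes V: "openin (Euclidean_space n) V" and f: "\<And>k. Ck_on k n V f" and p: "p \<in> V" and j: "j < n"
    and nz: "partial_deriv j f p \<noteq> 0"
  obtains B where "openin (Euclidean_space n) B" "p \<in> B" "B \<subseteq> V" "inj_on (replace_coord j f) B"
    "openin (Euclidean_space n) ((replace_coord j f) ` B)"
    "\<And>k l. Ck_on k n ((replace_coord j f) ` B) (\<lambda>q. inv_into B (replace_coord j f) q l)"
proof -
  have pR: "p \<in> R_pow n" using p openin_Euclidean_space_subset[OF V] by blast
  obtain e where e: "e > 0" "cube n p e \<subseteq> V"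
    "\<And>q. q \<in> cube n p e \<Longrightarrow> \<bar>partial_deriv j f q - partial_deriv j f p\<bar> < \<bar>partial_deriv j f p\<bar>"
    using Ck_on_partial_continuous[OF V f p j, of "\<bar>partial_deriv j f p\<bar>"] nz by auto
  have f': "Ck_on k n (cube n p e) f" for k by (rule Ck_on_mono[OF f e(2)])
  show ?thesis
    by (rule that[OF openin_cube cube_center[OF pR e(1)] e(2)
          inj_on_replace_coordinate[OF e(1) f' j pR e(3)]
          openin_replace_coordinate[OF e(1) f' j pR e(3)]
          Ck_on_replace_coordinate_inverse[OF e(1) f' j pR e(3)]])
qed

section \<open>Charts and smooth functions\<close>

abbreviation chart_inv :: "'a chart \<Rightarrow> (nat \<Rightarrow> real) \<Rightarrow> 'a" where
  "chart_inv c \<equiv> inv_into (fst c) (snd c)"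

lemma is_chart_openin: "is_chart M c \<Longrightarrow> openin (mtop M) (fst c)"
  by (simp add: is_chart_def)

lemma is_chart_subset: "is_chart M c \<Longrightarrow> fst c \<subseteq> topspace (mtop M)"
  by (simp add: is_chart_def openin_subset)

lemma is_chart_homeomorphic_map:
  assumes "is_chart M c"
  shows "homeomorphic_map (subtopology (mtop M) (fst c))
    (subtopology (Euclidean_space (mdim M)) (snd c ` fst c)) (snd c)"
proof -
  have "topspace (subtopology (mtop M) (fst c)) = fst c"
    using is_chart_subset[OF assms] by auto
  then show ?thesis using assms by (auto simp: is_chart_def embedding_map_def)
qed

lemma is_chart_inj: 
  assumes "is_chart M c"
  shows "inj_on (snd c) (fst c)"
proof -
  have "topspace (subtopology (mtop M) (fst c)) = fst c"
    using is_chart_subset[OF assms] by auto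
  then show ?thesis
    using is_chart_homeomorphic_map[OF assms] by (simp add: homeomorphic_map_def)
qed

lemma is_chart_continuous:
  assumes "is_chart M c"
  shows "continuous_map (subtopology (mtop M) (fst c)) (Euclidean_space (mdim M)) (snd c)"
  using homeomorphic_imp_continuous_map[OF is_chart_homeomorphic_map[OF assms]]
  by (simp add: continuous_map_in_subtopology)

lemma is_chart_open_image:
  assumes c: "is_chart M c" and A: "openin (mtop M) A" "A \<subseteq> fst c"
  shows "openin (Euclidean_space (mdim M)) (snd c ` A)"
proof -
  have "openin (subtopology (mtop M) (fst c)) A"
    using A c by (simp add: openin_open_subtopology is_chart_openin)
  then have "openin (subtopology (Euclidean_space (mdim M)) (snd c ` fst c)) (snd c ` A)"
    using homeomorphic_imp_open_map[OF is_chart_homeomorphic_map[OF c]] by (simp add: open_map_def)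
  moreover have "openin (Euclidean_space (mdim M)) (snd c ` fst c)"
    using c by (simp add: is_chart_def)
  ultimately show ?thesis by (simp add: openin_open_subtopology)
qed

lemma is_chart_open_preimage:
  assumes c: "is_chart M c" and W: "openin (Euclidean_space (mdim M)) W"
  shows "openin (mtop M) {x \<in> fst c. snd c x \<in> W}"
proof -
  have "openin (subtopology (mtop M) (fst c)) {x \<in> topspace (subtopology (mtop M) (fst c)). snd c x \<in> W}"
    by (rule openin_continuous_map_preimage[OF is_chart_continuous[OF c] W])
  moreover have "{x \<in> topspace (subtopology (mtop M) (fst c)). snd c x \<in> W} = {x \<in> fst c. snd c x \<in> W}"
    using is_chart_subset[OF c] by auto
  ultimately show ?thesis
    using is_chart_openin[OF c] by (simp add: openin_open_subtopology)
qed

lemma is_chartI: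
  assumes U: "openin (mtop M) U" and inj: "inj_on \<phi> U"
    and cont: "continuous_map (subtopology (mtop M) U) (Euclidean_space (mdim M)) \<phi>"
    and op: "\<And>A. openin (mtop M) A \<Longrightarrow> A \<subseteq> U \<Longrightarrow> openin (Euclidean_space (mdim M)) (\<phi> ` A)"
  shows "is_chart M (U, \<phi>)"
proof -
  have top: "topspace (subtopology (mtop M) U) = U"
    using openin_subset[OF U] by auto
  have "open_map (subtopology (mtop M) U) (Euclidean_space (mdim M)) \<phi>"
    using op U by (simp add: open_map_def openin_open_subtopology)
  with inj cont top have "embedding_map (subtopology (mtop M) U) (Euclidean_space (mdim M)) \<phi>"
    by (intro injective_open_imp_embedding_map) auto
  with U op[OF U] show ?thesis by (simp add: is_chart_def)
qed

text \<open>Smoothness of a scalar function read in one fixed chart. Of the manifold only the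
  dimension enters, so the same predicate serves a chart and its restriction to a slice of smaller
  dimension.\<close>

definition chart_smooth :: "nat \<Rightarrow> 'a chart \<Rightarrow> 'a set \<Rightarrow> ('a \<Rightarrow> real) \<Rightarrow> bool" where
  "chart_smooth n c A F \<longleftrightarrow> (\<forall>k. Ck_on k n (snd c ` A) (F \<circ> chart_inv c))"

lemma chart_smoothD: "chart_smooth n c A F \<Longrightarrow> Ck_on k n (snd c ` A) (F \<circ> chart_inv c)"
  by (simp add: chart_smooth_def)

lemma chart_smooth_mono: "chart_smooth n c A F \<Longrightarrow> B \<subseteq> A \<Longrightarrow> chart_smooth n c B F"
  unfolding chart_smooth_def using Ck_on_mono image_mono by metis

lemma chart_smooth_cong:
  assumes c: "is_chart M c" and A: "openin (mtop M) A" "A \<subseteq> fst c"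
    and F: "chart_smooth (mdim M) c A F" and eq: "\<And>x. x \<in> A \<Longrightarrow> F x = G x"
  shows "chart_smooth (mdim M) c A G"
  unfolding chart_smooth_def
proof (intro allI, rule Ck_on_cong[OF is_chart_open_image[OF c A] chart_smoothD[OF F]])
  fix q assume "q \<in> snd c ` A"
  then obtain x where x: "x \<in> A" "q = snd c x" by blast
  then have "chart_inv c q = x"
    using A(2) is_chart_inj[OF c] by (auto intro: inv_into_f_f)
  with x eq show "(F \<circ> chart_inv c) q = (G \<circ> chart_inv c) q" by simp
qed

text \<open>The inverse of a chart is a choice inside its domain, so restricting the domain changes
  the representing function as a term; by injectivity the two agree on the image of
  \<open>A\<close>.\<close>

lemma chart_smooth_restrict:
  assumes c: "is_chart M (U, \<phi>)" and A: "openin (mtop M) A" "A \<subseteq> U'" "U' \<subseteq> U"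
  shows "chart_smooth (mdim M) (U', \<phi>) A F \<longleftrightarrow> chart_smooth (mdim M) (U, \<phi>) A F"
proof -
  have op: "openin (Euclidean_space (mdim M)) (\<phi> ` A)"
    using is_chart_open_image[OF c A(1)] A(2,3) by simp
  have inj: "inj_on \<phi> U" using is_chart_inj[OF c] by simp
  have eq: "inv_into U' \<phi> q = inv_into U \<phi> q" if q: "q \<in> \<phi> ` A" for q
  proof -
    obtain x where x: "x \<in> A" "q = \<phi> x" using q by blast
    then have "x \<in> U'" "x \<in> U" using A(2,3) by blast+
    with x show ?thesis
      using inv_into_f_f[OF inj, of x] inv_into_f_f[OF inj_on_subset[OF inj A(3)], of x] by auto
  qed
  have "Ck_on k (mdim M) (\<phi> ` A) (F \<circ> inv_into U' \<phi>) \<longleftrightarrow> Ck_on k (mdim M) (\<phi> ` A) (F \<circ> inv_into U \<phi>)" for k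
    using Ck_on_cong[OF op, of k "F \<circ> inv_into U' \<phi>" "F \<circ> inv_into U \<phi>"]
      Ck_on_cong[OF op, of k "F \<circ> inv_into U \<phi>" "F \<circ> inv_into U' \<phi>"] eq
    by (metis comp_apply)
  then show ?thesis
    by (simp add: chart_smooth_def)
qed

lemma chart_smooth_local:
  assumes c: "is_chart M c" and A: "openin (mtop M) A" "A \<subseteq> fst c"
    and loc: "\<And>x. x \<in> A \<Longrightarrow> \<exists>B. openin (mtop M) B \<and> x \<in> B \<and> B \<subseteq> fst c \<and> chart_smooth (mdim M) c B F"
  shows "chart_smooth (mdim M) c A F"
  unfolding chart_smooth_def
proof (intro allI, rule Ck_on_local[OF is_chart_open_image[OF c A]])
  fix k p assume "p \<in> snd c ` A"
  then obtain x where x: "x \<in> A" "p = snd c x" by blast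
  obtain B where B: "openin (mtop M) B" "x \<in> B" "B \<subseteq> fst c" "chart_smooth (mdim M) c B F"
    using loc[OF x(1)] by blast
  show "\<exists>U. openin (Euclidean_space (mdim M)) U \<and> p \<in> U \<and> Ck_on k (mdim M) U (F \<circ> chart_inv c)"
    using is_chart_open_image[OF c B(1,3)] chart_smoothD[OF B(4)] B(2) x(2) by blast
qed

lemma chart_smooth_const: "chart_smooth n c A (\<lambda>x. a)"
  unfolding chart_smooth_def o_def using Ck_on_const by blast

lemma chart_smooth_diff:
  assumes c: "is_chart M c" and A: "openin (mtop M) A" "A \<subseteq> fst c"
    and "chart_smooth (mdim M) c A F" "chart_smooth (mdim M) c A G"
  shows "chart_smooth (mdim M) c A (\<lambda>x. F x - G x)"
  unfolding chart_smooth_def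
proof
  fix k
  show "Ck_on k (mdim M) (snd c ` A) ((\<lambda>x. F x - G x) \<circ> chart_inv c)"
    using Ck_on_diff[OF is_chart_open_image[OF c A] chart_smoothD[OF assms(4)] chart_smoothD[OF assms(5)]]
    by (simp add: o_def)
qed

lemma chart_smooth_coord:
  assumes c: "is_chart M c" and A: "openin (mtop M) A" "A \<subseteq> fst c"
  shows "chart_smooth (mdim M) c A (\<lambda>x. snd c x i)"
  unfolding chart_smooth_def
proof (intro allI, rule Ck_on_cong[OF is_chart_open_image[OF c A] Ck_on_coord[OF is_chart_open_image[OF c A]]])
  fix q assume "q \<in> snd c ` A"
  then show "q i = ((\<lambda>x. snd c x i) \<circ> chart_inv c) q"
    using A(2) by (simp add: f_inv_into_f[of q "snd c" "fst c"] image_iff subset_iff) (metis f_inv_into_f image_eqI)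
qed

lemma chart_inv_apply: "is_chart M c \<Longrightarrow> x \<in> fst c \<Longrightarrow> chart_inv c (snd c x) = x"
  by (rule inv_into_f_f[OF is_chart_inj])

lemma chart_expression:
  assumes c: "is_chart M c" and c': "is_chart N c'"
    and A: "openin (mtop M) A" "A \<subseteq> fst c" and B: "openin (mtop N) B" "B \<subseteq> fst c'" and f: "f ` A \<subseteq> B"
  shows "(\<lambda>p. snd c' (f (chart_inv c p))) ` snd c ` A \<subseteq> snd c' ` B"
    and "q \<in> snd c ` A \<Longrightarrow> (F \<circ> chart_inv c') (snd c' (f (chart_inv c q))) = ((\<lambda>x. F (f x)) \<circ> chart_inv c) q"
proof -
  have inv: "chart_inv c (snd c x) = x" if "x \<in> A" for x
    using chart_inv_apply[OF c] A(2) that by blast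
  show "(\<lambda>p. snd c' (f (chart_inv c p))) ` snd c ` A \<subseteq> snd c' ` B"
    using inv f by auto
  assume "q \<in> snd c ` A"
  then obtain x where x: "x \<in> A" "q = snd c x" by blast
  then have "f x \<in> fst c'" using f B by blast
  then show "(F \<circ> chart_inv c') (snd c' (f (chart_inv c q))) = ((\<lambda>x. F (f x)) \<circ> chart_inv c) q"
    using x inv[OF x(1)] chart_inv_apply[OF c'] by simp
qed

lemma chart_smooth_compose:
  assumes c: "is_chart M c" and c': "is_chart N c'"
    and A: "openin (mtop M) A" "A \<subseteq> fst c" and B: "openin (mtop N) B" "B \<subseteq> fst c'" and f: "f ` A \<subseteq> B"
    and coord: "\<And>i. chart_smooth (mdim M) c A (\<lambda>x. snd c' (f x) i)"
    and F: "chart_smooth (mdim N) c' B F"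
  shows "chart_smooth (mdim M) c A (\<lambda>x. F (f x))"
  unfolding chart_smooth_def
proof
  fix k
  note cf = chart_expression[OF c c' A B f]
  have G: "Ck_on k (mdim M) (snd c ` A) (\<lambda>p. snd c' (f (chart_inv c p)) i)" for i
    using chart_smoothD[OF coord[of i], of k] by (simp add: o_def)
  have "Ck_on k (mdim M) (snd c ` A) (\<lambda>p. (F \<circ> chart_inv c') (snd c' (f (chart_inv c p))))"
    by (rule Ck_on_compose[OF is_chart_open_image[OF c A] is_chart_open_image[OF c' B] cf(1) G chart_smoothD[OF F]])
  then show "Ck_on k (mdim M) (snd c ` A) ((\<lambda>x. F (f x)) \<circ> chart_inv c)"
    by (rule Ck_on_cong[OF is_chart_open_image[OF c A]]) (rule cf(2))
qed

text \<open>The differential of \<open>F\<close> at \<open>x\<close> in the chart \<open>c\<close>,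
  applied to a coordinate vector. It reads only the first \<open>n\<close> entries of
  \<open>w\<close>, and for a coordinate of a map it is the corresponding entry of
  \<open>jac\<close>.\<close>

definition cdiff :: "nat \<Rightarrow> 'a chart \<Rightarrow> ('a \<Rightarrow> real) \<Rightarrow> 'a \<Rightarrow> (nat \<Rightarrow> real) \<Rightarrow> real" where
  "cdiff n c F x w = (\<Sum>j<n. partial_deriv j (F \<circ> chart_inv c) (snd c x) * w j)"

lemma jac_eq_cdiff: "jac n (coord_rep c c' f) (snd c x) w i = cdiff n c (\<lambda>x. snd c' (f x) i) x w"
  by (simp add: jac_def coord_rep_def cdiff_def o_def)

lemma cdiff_cong:
  assumes c: "is_chart M c" and A: "openin (mtop M) A" "A \<subseteq> fst c" and x: "x \<in> A"
    and eq: "\<And>x. x \<in> A \<Longrightarrow> F x = G x"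
  shows "cdiff (mdim M) c F x w = cdiff (mdim M) c G x w"
  unfolding cdiff_def
proof (rule sum.cong[OF refl])
  fix j assume "j \<in> {..<mdim M}"
  have "(F \<circ> chart_inv c) q = (G \<circ> chart_inv c) q" if "q \<in> snd c ` A" for q
    using that A(2) eq chart_inv_apply[OF c] by auto
  then have "partial_deriv j (F \<circ> chart_inv c) (snd c x) = partial_deriv j (G \<circ> chart_inv c) (snd c x)"
    using \<open>j \<in> {..<mdim M}\<close> x by (intro partial_deriv_cong(1)[OF is_chart_open_image[OF c A]]) auto
  then show "partial_deriv j (F \<circ> chart_inv c) (snd c x) * w j = partial_deriv j (G \<circ> chart_inv c) (snd c x) * w j"
    by simp
qed

lemma cdiff_restrict:
  assumes c: "is_chart M (U, \<phi>)" and A: "openin (mtop M) A" "A \<subseteq> U'" "U' \<subseteq> U" and x: "x \<in> A"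
  shows "cdiff (mdim M) (U', \<phi>) F x w = cdiff (mdim M) (U, \<phi>) F x w"
  unfolding cdiff_def
proof (rule sum.cong[OF refl])
  fix j assume "j \<in> {..<mdim M}"
  have op: "openin (Euclidean_space (mdim M)) (\<phi> ` A)"
    using is_chart_open_image[OF c A(1)] A(2,3) by simp
  have inj: "inj_on \<phi> U" using is_chart_inj[OF c] by simp
  have "(F \<circ> inv_into U' \<phi>) q = (F \<circ> inv_into U \<phi>) q" if q: "q \<in> \<phi> ` A" for q
  proof -
    obtain x where x: "x \<in> A" "q = \<phi> x" using q by blast
    then have "x \<in> U'" "x \<in> U" using A(2,3) by blast+
    with x show ?thesis
      using inv_into_f_f[OF inj, of x] inv_into_f_f[OF inj_on_subset[OF inj A(3)], of x] by auto
  qed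
  then have "partial_deriv j (F \<circ> inv_into U' \<phi>) (\<phi> x) = partial_deriv j (F \<circ> inv_into U \<phi>) (\<phi> x)"
    using \<open>j \<in> {..<mdim M}\<close> x by (intro partial_deriv_cong(1)[OF op]) auto
  then show "partial_deriv j (F \<circ> chart_inv (U', \<phi>)) (snd (U', \<phi>) x) * w j =
      partial_deriv j (F \<circ> chart_inv (U, \<phi>)) (snd (U, \<phi>) x) * w j"
    by simp
qed

lemma cdiff_coord:
  assumes c: "is_chart M c" and x: "x \<in> fst c" and "i < mdim M"
  shows "cdiff (mdim M) c (\<lambda>x. snd c x i) x w = w i"
proof -
  have op: "openin (Euclidean_space (mdim M)) (snd c ` fst c)"
    using c by (simp add: is_chart_def)
  have pd: "partial_deriv j ((\<lambda>x. snd c x i) \<circ> chart_inv c) (snd c x) = (if i = j then 1 else 0)"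
    if "j < mdim M" for j
  proof -
    have "partial_deriv j ((\<lambda>x. snd c x i) \<circ> chart_inv c) (snd c x) = partial_deriv j (\<lambda>q. q i) (snd c x)"
      using x that by (intro partial_deriv_cong(1)[OF op]) (auto simp: f_inv_into_f)
    also have "\<dots> = (if i = j then 1 else 0)"
      by (cases "i = j") (simp_all add: partial_deriv_def)
    finally show ?thesis .
  qed
  have "cdiff (mdim M) c (\<lambda>x. snd c x i) x w = (\<Sum>j<mdim M. (if i = j then w j else 0))"
    unfolding cdiff_def by (rule sum.cong[OF refl]) (simp add: pd)
  with \<open>i < mdim M\<close> show ?thesis by simp
qed

lemma cdiff_zero_coord:
  assumes "\<And>j. j < n \<Longrightarrow> w j = 0"
  shows "cdiff n c F x w = 0"
  using assms by (simp add: cdiff_def)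

lemma cdiff_minus_arg: "cdiff n c F x (\<lambda>i. u i - v i) = cdiff n c F x u - cdiff n c F x v"
  by (simp add: cdiff_def algebra_simps sum_subtractf)

text \<open>In coordinates, the chain rule for partial derivatives followed by an exchange of the
  two summations.\<close>

lemma cdiff_chain:
  assumes c: "is_chart M c" and c': "is_chart N c'"
    and A: "openin (mtop M) A" "A \<subseteq> fst c" and B: "openin (mtop N) B" "B \<subseteq> fst c'" and f: "f ` A \<subseteq> B"
    and coord: "\<And>i. chart_smooth (mdim M) c A (\<lambda>x. snd c' (f x) i)"
    and F: "chart_smooth (mdim N) c' B F" and x: "x \<in> A"
  shows "cdiff (mdim M) c (\<lambda>x. F (f x)) x w =
    cdiff (mdim N) c' F (f x) (\<lambda>i. cdiff (mdim M) c (\<lambda>x. snd c' (f x) i) x w)"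
proof -
  note cf = chart_expression[OF c c' A B f]
  define G where "G p = snd c' (f (chart_inv c p))" for p
  define p where "p = snd c x"
  have p: "p \<in> snd c ` A" using x by (simp add: p_def)
  have Gp: "G p = snd c' (f x)"
    using chart_inv_apply[OF c] A(2) x by (auto simp: G_def p_def)
  have G: "Ck_on k (mdim M) (snd c ` A) (\<lambda>p. G p i)" for k i
    using chart_smoothD[OF coord[of i], of k] by (simp add: o_def G_def)
  have pd: "partial_deriv j ((\<lambda>x. F (f x)) \<circ> chart_inv c) p =
      (\<Sum>i<mdim N. partial_deriv i (F \<circ> chart_inv c') (G p) * partial_deriv j (\<lambda>p. G p i) p)"
    if "j < mdim M" for j
  proof -
    have "partial_deriv j ((\<lambda>x. F (f x)) \<circ> chart_inv c) p = partial_deriv j (\<lambda>p. (F \<circ> chart_inv c') (G p)) p"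
      unfolding G_def by (rule partial_deriv_cong(1)[OF is_chart_open_image[OF c A] p that]) (rule cf(2)[symmetric])
    also have "\<dots> = (\<Sum>i<mdim N. partial_deriv i (F \<circ> chart_inv c') (G p) * partial_deriv j (\<lambda>p. G p i) p)"
      unfolding partial_deriv_def[of j "\<lambda>p. (F \<circ> chart_inv c') (G p)"]
      by (rule DERIV_imp_deriv, rule DERIV_partial_compose[OF is_chart_open_image[OF c A]
            is_chart_open_image[OF c' B] _ G chart_smoothD[OF F] p that])
        (use cf(1) in \<open>simp add: G_def\<close>)
    finally show ?thesis .
  qed
  have "cdiff (mdim M) c (\<lambda>x. F (f x)) x w =
      (\<Sum>j<mdim M. (\<Sum>i<mdim N. partial_deriv i (F \<circ> chart_inv c') (G p) * partial_deriv j (\<lambda>p. G p i) p) * w j)"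
    unfolding cdiff_def p_def[symmetric] by (rule sum.cong[OF refl]) (simp add: pd)
  also have "\<dots> = (\<Sum>i<mdim N. partial_deriv i (F \<circ> chart_inv c') (G p) * (\<Sum>j<mdim M. partial_deriv j (\<lambda>p. G p i) p * w j))"
    unfolding sum_distrib_left sum_distrib_right by (subst sum.swap) (simp add: mult.assoc)
  also have "\<dots> = cdiff (mdim N) c' F (f x) (\<lambda>i. cdiff (mdim M) c (\<lambda>x. snd c' (f x) i) x w)"
    unfolding cdiff_def Gp p_def[symmetric] by (simp add: G_def o_def)
  finally show ?thesis .
qed

lemma cdiff_diff:
  assumes c: "is_chart M c" and A: "openin (mtop M) A" "A \<subseteq> fst c" and x: "x \<in> A"
    and F: "chart_smooth (mdim M) c A F" and G: "chart_smooth (mdim M) c A G"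
  shows "cdiff (mdim M) c (\<lambda>x. F x - G x) x w = cdiff (mdim M) c F x w - cdiff (mdim M) c G x w"
proof -
  have "partial_deriv j ((\<lambda>x. F x - G x) \<circ> chart_inv c) (snd c x) =
      partial_deriv j (F \<circ> chart_inv c) (snd c x) - partial_deriv j (G \<circ> chart_inv c) (snd c x)"
    if "j < mdim M" for j
  proof -
    have p: "snd c x \<in> snd c ` A" using x by blast
    have "((\<lambda>t. (F \<circ> chart_inv c) ((snd c x)(j := t)) - (G \<circ> chart_inv c) ((snd c x)(j := t))) has_field_derivative
      partial_deriv j (F \<circ> chart_inv c) (snd c x) - partial_deriv j (G \<circ> chart_inv c) (snd c x)) (at (snd c x j))"
      by (rule DERIV_diff[OF Ck_on_has_partial[OF chart_smoothD[OF F] p that] Ck_on_has_partial[OF chart_smoothD[OF G] p that]])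
    from DERIV_imp_deriv[OF this] show ?thesis
      unfolding partial_deriv_def by (simp add: o_def del: fun_upd_apply)
  qed
  then have "cdiff (mdim M) c (\<lambda>x. F x - G x) x w = (\<Sum>j<mdim M. (partial_deriv j (F \<circ> chart_inv c) (snd c x)
      - partial_deriv j (G \<circ> chart_inv c) (snd c x)) * w j)"
    unfolding cdiff_def by (intro sum.cong[OF refl]) simp
  then show ?thesis unfolding cdiff_def by (simp add: algebra_simps sum_subtractf)
qed

section \<open>Change of charts and the maximal atlas\<close>

lemma smooth_transition_iff:
  "smooth_transition M c c' \<longleftrightarrow> (\<forall>i. chart_smooth (mdim M) c (fst c \<inter> fst c') (\<lambda>x. snd c' x i))"
  by (simp add: smooth_transition_def smooth_vec_on_def chart_smooth_def coord_rep_def o_def)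

lemma chart_smooth_change:
  assumes c: "is_chart M c" and c': "is_chart M c'" and tr: "smooth_transition M c' c"
    and A: "openin (mtop M) A" "A \<subseteq> fst c" "A \<subseteq> fst c'" and F: "chart_smooth (mdim M) c A F"
  shows "chart_smooth (mdim M) c' A F"
proof -
  have "chart_smooth (mdim M) c' A (\<lambda>x. snd c x i)" for i
    using tr A(2,3) unfolding smooth_transition_iff
    by (intro chart_smooth_mono[of "mdim M" c' "fst c' \<inter> fst c" _ A]) auto
  from chart_smooth_compose[OF c' c A(1,3) A(1,2), of "\<lambda>x. x", OF _ this F] show ?thesis by simp
qed

lemma max_atlas_is_chart: "c \<in> max_atlas M \<Longrightarrow> is_chart M c"
  by (simp add: max_atlas_def)

lemma atlas_subset_max_atlas: "smooth_manifold M \<Longrightarrow> atlas M \<subseteq> max_atlas M"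
  by (auto simp: max_atlas_def smooth_manifold_def)

lemma atlas_cover:
  assumes "smooth_manifold M" "x \<in> topspace (mtop M)"
  obtains c where "c \<in> atlas M" "x \<in> fst c" "c \<in> max_atlas M"
  using assms atlas_subset_max_atlas[OF assms(1)] unfolding smooth_manifold_def by blast

text \<open>Membership in \<open>max_atlas\<close> speaks of compatibility with atlas charts only.
  Near each point an atlas chart \<open>c0\<close> is interposed, and smoothness is local.\<close>

lemma max_atlas_transition:
  assumes M: "smooth_manifold M" and c: "c \<in> max_atlas M" and c': "c' \<in> max_atlas M"
  shows "smooth_transition M c c'"
  unfolding smooth_transition_iff
proof
  fix i
  note ch = max_atlas_is_chart[OF c] max_atlas_is_chart[OF c']
  note op = is_chart_openin[OF ch(1)] is_chart_openin[OF ch(2)]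
  show "chart_smooth (mdim M) c (fst c \<inter> fst c') (\<lambda>x. snd c' x i)"
  proof (rule chart_smooth_local[OF ch(1) openin_Int[OF op] Int_lower1])
    fix x assume x: "x \<in> fst c \<inter> fst c'"
    then have "x \<in> topspace (mtop M)" using is_chart_subset[OF ch(1)] by blast
    then obtain c0 where c0: "c0 \<in> atlas M" "x \<in> fst c0" "c0 \<in> max_atlas M" by (rule atlas_cover[OF M])
    note ch0 = max_atlas_is_chart[OF c0(3)]
    define B where "B = fst c \<inter> fst c' \<inter> fst c0"
    have B: "openin (mtop M) B" "B \<subseteq> fst c" "B \<subseteq> fst c0" "B \<subseteq> fst c'"
      using openin_Int[OF openin_Int[OF op] is_chart_openin[OF ch0]] by (auto simp: B_def)
    have "smooth_transition M c0 c'" using c' c0(1) by (simp add: max_atlas_def)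
    then have "chart_smooth (mdim M) c0 B (\<lambda>x. snd c' x i)"
      using B by (intro chart_smooth_mono[of "mdim M" c0 "fst c0 \<inter> fst c'" _ B]) (auto simp: smooth_transition_iff)
    moreover have "smooth_transition M c c0" using c c0(1) by (simp add: max_atlas_def)
    ultimately have "chart_smooth (mdim M) c B (\<lambda>x. snd c' x i)"
      using B by (intro chart_smooth_change[OF ch0 ch(1)])
    with B x c0(2) show "\<exists>B. openin (mtop M) B \<and> x \<in> B \<and> B \<subseteq> fst c \<and> chart_smooth (mdim M) c B (\<lambda>x. snd c' x i)"
      by (intro exI[of _ B]) (auto simp: B_def)
  qed
qed

text \<open>Compatibility with one larger chart of the maximal atlas, in both directions, carries
  over to all atlas charts by composing transitions.\<close>

lemma max_atlasI:
  assumes M: "smooth_manifold M" and c: "c \<in> max_atlas M" and c': "is_chart M c'" and sub: "fst c' \<subseteq> fst c"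
    and 1: "\<And>i. chart_smooth (mdim M) c' (fst c') (\<lambda>x. snd c x i)"
    and 2: "\<And>i. chart_smooth (mdim M) c (fst c') (\<lambda>x. snd c' x i)"
  shows "c' \<in> max_atlas M"
proof -
  note ch = max_atlas_is_chart[OF c]
  have tr: "smooth_transition M c' c"
    unfolding smooth_transition_iff using 1 sub by (simp add: Int_absorb2)
  have "smooth_transition M c' c0 \<and> smooth_transition M c0 c'" if c0: "c0 \<in> atlas M" for c0
  proof
    have c0m: "c0 \<in> max_atlas M" using c0 atlas_subset_max_atlas[OF M] by blast
    note ch0 = max_atlas_is_chart[OF c0m]
    define B where "B = fst c' \<inter> fst c0"
    have B: "openin (mtop M) B" "B \<subseteq> fst c" "B \<subseteq> fst c0" "B \<subseteq> fst c'"
      using openin_Int[OF is_chart_openin[OF c'] is_chart_openin[OF ch0]] sub by (auto simp: B_def)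
    show "smooth_transition M c' c0"
      unfolding smooth_transition_iff B_def[symmetric]
    proof
      fix i
      have "chart_smooth (mdim M) c B (\<lambda>x. snd c0 x i)"
        using max_atlas_transition[OF M c c0m] B(2,3) unfolding smooth_transition_iff
        by (intro chart_smooth_mono[of "mdim M" c "fst c \<inter> fst c0" _ B]) auto
      then show "chart_smooth (mdim M) c' B (\<lambda>x. snd c0 x i)"
        by (rule chart_smooth_change[OF ch c' tr B(1,2,4)])
    qed
    have "chart_smooth (mdim M) c0 B (\<lambda>x. snd c' x i)" for i
      by (rule chart_smooth_change[OF ch ch0 max_atlas_transition[OF M c0m c] B(1,2,3)
            chart_smooth_mono[OF 2 B(4)]])
    then show "smooth_transition M c0 c'"
      unfolding smooth_transition_iff B_def by (simp add: Int_commute)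
  qed
  with c' show ?thesis by (simp add: max_atlas_def)
qed

lemma continuous_map_Euclidean_space_componentwise:
  "continuous_map X (Euclidean_space n) G \<longleftrightarrow>
    (\<forall>i. continuous_map X euclideanreal (\<lambda>x. G x i)) \<and> (\<forall>x\<in>topspace X. G x \<in> R_pow n)"
  unfolding Euclidean_space_def continuous_map_in_subtopology continuous_map_componentwise_UNIV
  by auto

lemma smooth_imp_continuous_map:
  assumes "\<And>i. Ck_on 0 m V (\<lambda>p. G p i)" "G ` V \<subseteq> R_pow n"
  shows "continuous_map (subtopology (Euclidean_space m) V) (Euclidean_space n) G"
  unfolding continuous_map_Euclidean_space_componentwise using assms by (auto simp: image_subset_iff)

text \<open>A chart may be followed by any diffeomorphism \<open>\<Theta>\<close> between open sets.
  Shrinking a chart, interchanging two coordinates and replacing a coordinate by a function are the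
  instances needed; each brings its own reason for smoothness of the inverse.\<close>

lemma max_atlas_compose:
  assumes M: "smooth_manifold M" and c: "c \<in> max_atlas M"
    and V: "openin (Euclidean_space (mdim M)) V" "V \<subseteq> snd c ` fst c" and inj: "inj_on \<Theta> V"
    and \<Theta>V: "openin (Euclidean_space (mdim M)) (\<Theta> ` V)"
    and \<Theta>: "\<And>k i. Ck_on k (mdim M) V (\<lambda>p. \<Theta> p i)"
    and \<Theta>': "\<And>k i. Ck_on k (mdim M) (\<Theta> ` V) (\<lambda>q. inv_into V \<Theta> q i)"
  shows "({x \<in> fst c. snd c x \<in> V}, \<lambda>x. \<Theta> (snd c x)) \<in> max_atlas M"
proof -
  let ?E = "Euclidean_space (mdim M)"
  define U where "U = {x \<in> fst c. snd c x \<in> V}"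
  define \<phi> where "\<phi> x = \<Theta> (snd c x)" for x
  note ch = max_atlas_is_chart[OF c]
  note cinj = is_chart_inj[OF ch]
  have U: "openin (mtop M) U" "U \<subseteq> fst c"
    using is_chart_open_preimage[OF ch V(1)] by (auto simp: U_def)
  have cU: "snd c ` U = V" using V(2) by (auto simp: U_def)
  have \<phi>A: "\<phi> ` A = \<Theta> ` (snd c ` A)" for A by (auto simp: \<phi>_def)
  have \<phi>U: "\<phi> ` U = \<Theta> ` V" by (simp add: \<phi>A cU)
  have inj\<phi>: "inj_on \<phi> U"
    unfolding \<phi>_def using comp_inj_on[OF inj_on_subset[OF cinj U(2)], of \<Theta>] inj cU by (simp add: o_def)
  have ch': "is_chart M (U, \<phi>)"
  proof (rule is_chartI[OF U(1) inj\<phi>])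
    have "continuous_map (subtopology (mtop M) U) (subtopology ?E V) (snd c)"
      using continuous_map_from_subtopology_mono[OF is_chart_continuous[OF ch] U(2)] cU
      by (auto simp: continuous_map_in_subtopology)
    moreover have "continuous_map (subtopology ?E V) ?E \<Theta>"
      by (rule smooth_imp_continuous_map[OF \<Theta> openin_Euclidean_space_subset[OF \<Theta>V]])
    ultimately show "continuous_map (subtopology (mtop M) U) ?E \<phi>"
      unfolding \<phi>_def using continuous_map_compose[of _ _ "snd c" _ \<Theta>] by (simp add: o_def)
  next
    fix A assume A: "openin (mtop M) A" "A \<subseteq> U"
    have W: "openin ?E (snd c ` A)" using is_chart_open_image[OF ch A(1)] A(2) U(2) by blast
    have WV: "snd c ` A \<subseteq> V" using A(2) cU by blast
    \<comment> \<open>Images under \<open>\<Theta>\<close> are preimages under its continuous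
      inverse, which gives openness of \<open>\<phi>\<close>.\<close>
    have "continuous_map (subtopology ?E (\<Theta> ` V)) ?E (inv_into V \<Theta>)"
      by (rule smooth_imp_continuous_map[OF \<Theta>'])
        (use openin_Euclidean_space_subset[OF V(1)] in \<open>auto simp: inv_into_f_f[OF inj]\<close>)
    from openin_continuous_map_preimage[OF this W]
    have "openin (subtopology ?E (\<Theta> ` V)) {q \<in> topspace (subtopology ?E (\<Theta> ` V)). inv_into V \<Theta> q \<in> snd c ` A}" .
    moreover have "{q \<in> topspace (subtopology ?E (\<Theta> ` V)). inv_into V \<Theta> q \<in> snd c ` A} = \<phi> ` A"
    proof -
      have t: "topspace (subtopology ?E (\<Theta> ` V)) = \<Theta> ` V"
        using openin_subset[OF \<Theta>V] by auto
      show ?thesis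
        unfolding t \<phi>A
      proof (intro equalityI subsetI)
        fix q assume "q \<in> {q \<in> \<Theta> ` V. inv_into V \<Theta> q \<in> snd c ` A}"
        then have "q = \<Theta> (inv_into V \<Theta> q)" "inv_into V \<Theta> q \<in> snd c ` A" by (auto simp: f_inv_into_f)
        then show "q \<in> \<Theta> ` snd c ` A" by (rule image_eqI)
      next
        fix q assume "q \<in> \<Theta> ` snd c ` A"
        then obtain p where p: "p \<in> snd c ` A" "q = \<Theta> p" by blast
        then have "p \<in> V" using WV by blast
        with p inv_into_f_f[OF inj this] show "q \<in> {q \<in> \<Theta> ` V. inv_into V \<Theta> q \<in> snd c ` A}" by simp
      qed
    qed
    ultimately show "openin ?E (\<phi> ` A)"
      using \<Theta>V by (simp add: openin_open_subtopology)
  qed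
  have "(U, \<phi>) \<in> max_atlas M"
  proof (rule max_atlasI[OF M c ch'])
    show "fst (U, \<phi>) \<subseteq> fst c" using U(2) by simp
  next
    fix i
    have "Ck_on k (mdim M) (\<phi> ` U) ((\<lambda>x. snd c x i) \<circ> inv_into U \<phi>)" for k
      unfolding \<phi>U
    proof (rule Ck_on_cong[OF \<Theta>V \<Theta>'[of k i]])
      fix q assume "q \<in> \<Theta> ` V"
      then obtain x where x: "x \<in> U" "q = \<phi> x" unfolding \<phi>U[symmetric] by blast
      have "snd c x \<in> V" using x(1) by (simp add: U_def)
      then have "inv_into V \<Theta> q = snd c x" using x(2) inv_into_f_f[OF inj] by (simp add: \<phi>_def)
      moreover have "inv_into U \<phi> q = x" using x inv_into_f_f[OF inj\<phi>] by simp
      ultimately show "inv_into V \<Theta> q i = ((\<lambda>x. snd c x i) \<circ> inv_into U \<phi>) q" by simp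
    qed
    then show "chart_smooth (mdim M) (U, \<phi>) (fst (U, \<phi>)) (\<lambda>x. snd c x i)"
      by (simp add: chart_smooth_def)
  next
    fix i
    have "Ck_on k (mdim M) (snd c ` U) ((\<lambda>x. \<phi> x i) \<circ> chart_inv c)" for k
      unfolding cU
    proof (rule Ck_on_cong[OF V(1) \<Theta>[of k i]])
      fix q assume "q \<in> V"
      then have "snd c (chart_inv c q) = q" using V(2) f_inv_into_f[of q "snd c" "fst c"] by blast
      then show "\<Theta> q i = ((\<lambda>x. \<phi> x i) \<circ> chart_inv c) q" by (simp add: \<phi>_def)
    qed
    then show "chart_smooth (mdim M) c (fst (U, \<phi>)) (\<lambda>x. snd (U, \<phi>) x i)"
      by (simp add: chart_smooth_def)
  qed
  then show ?thesis by (simp add: U_def \<phi>_def[abs_def])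
qed

section \<open>Smooth scalar functions and smooth maps\<close>

definition smooth_fun :: "'a mfd \<Rightarrow> 'a set \<Rightarrow> ('a \<Rightarrow> real) \<Rightarrow> bool" where
  "smooth_fun M A F \<longleftrightarrow> (\<forall>c\<in>max_atlas M. chart_smooth (mdim M) c (fst c \<inter> A) F)"

lemma smooth_funD: "smooth_fun M A F \<Longrightarrow> c \<in> max_atlas M \<Longrightarrow> chart_smooth (mdim M) c (fst c \<inter> A) F"
  by (simp add: smooth_fun_def)

lemma smooth_fun_chart_smooth:
  "smooth_fun M A F \<Longrightarrow> c \<in> max_atlas M \<Longrightarrow> B \<subseteq> fst c \<Longrightarrow> B \<subseteq> A \<Longrightarrow> chart_smooth (mdim M) c B F"
  using chart_smooth_mono[OF smooth_funD, of M A F c B] by simp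

lemma smooth_fun_mono: "smooth_fun M A F \<Longrightarrow> B \<subseteq> A \<Longrightarrow> smooth_fun M B F"
  by (auto simp: smooth_fun_def intro: chart_smooth_mono)

text \<open>\<open>smooth_fun\<close> speaks of all charts of the maximal atlas, which makes it
  convenient to apply in slice charts; to establish it, one chart around each point is enough, by
  change of charts.\<close>

lemma smooth_funI:
  assumes M: "smooth_manifold M" and A: "openin (mtop M) A"
    and loc: "\<And>x. x \<in> A \<Longrightarrow> \<exists>c\<in>max_atlas M. \<exists>B. openin (mtop M) B \<and> x \<in> B \<and> B \<subseteq> fst c \<and> chart_smooth (mdim M) c B F"
  shows "smooth_fun M A F"
  unfolding smooth_fun_def
proof
  fix c assume c: "c \<in> max_atlas M"
  note ch = max_atlas_is_chart[OF c]
  show "chart_smooth (mdim M) c (fst c \<inter> A) F"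
  proof (rule chart_smooth_local[OF ch openin_Int[OF is_chart_openin[OF ch] A] Int_lower1])
    fix x assume x: "x \<in> fst c \<inter> A"
    then obtain c' B where c': "c' \<in> max_atlas M"
      and B: "openin (mtop M) B" "x \<in> B" "B \<subseteq> fst c'" "chart_smooth (mdim M) c' B F"
      using loc[of x] by blast
    have B': "openin (mtop M) (B \<inter> fst c)" using B(1) is_chart_openin[OF ch] by (rule openin_Int)
    have "chart_smooth (mdim M) c (B \<inter> fst c) F"
      by (rule chart_smooth_change[OF max_atlas_is_chart[OF c'] ch max_atlas_transition[OF M c c'] B' _ _
            chart_smooth_mono[OF B(4)]]) (use B(3) in auto)
    with B' B(2) x show "\<exists>B. openin (mtop M) B \<and> x \<in> B \<and> B \<subseteq> fst c \<and> chart_smooth (mdim M) c B F"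
      by blast
  qed
qed

lemma smooth_fun_diff:
  assumes A: "openin (mtop M) A" and F: "smooth_fun M A F" and G: "smooth_fun M A G"
  shows "smooth_fun M A (\<lambda>x. F x - G x)"
  unfolding smooth_fun_def
proof
  fix c assume c: "c \<in> max_atlas M"
  note ch = max_atlas_is_chart[OF c]
  show "chart_smooth (mdim M) c (fst c \<inter> A) (\<lambda>x. F x - G x)"
    by (rule chart_smooth_diff[OF ch openin_Int[OF is_chart_openin[OF ch] A] Int_lower1
          smooth_funD[OF F c] smooth_funD[OF G c]])
qed

lemma smooth_fun_coord:
  assumes M: "smooth_manifold M" and c: "c \<in> max_atlas M"
  shows "smooth_fun M (fst c) (\<lambda>x. snd c x i)"
  using max_atlas_transition[OF M _ c] by (simp add: smooth_fun_def smooth_transition_iff)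

text \<open>Reduces maps to scalar functions, without reference to charts of the source. The
  preimages are cut with the space because \<open>f\<close> is a total function.\<close>

lemma smooth_map_iff:
  assumes M: "smooth_manifold M" and N: "smooth_manifold N"
  shows "smooth_map M N f \<longleftrightarrow> continuous_map (mtop M) (mtop N) f \<and>
    (\<forall>c'\<in>atlas N. \<forall>i. smooth_fun M (topspace (mtop M) \<inter> f -` fst c') (\<lambda>x. snd c' (f x) i))"
proof (cases "continuous_map (mtop M) (mtop N) f")
  case True
  have op: "openin (mtop M) (topspace (mtop M) \<inter> f -` fst c')" if "c' \<in> atlas N" for c'
  proof -
    have "is_chart N c'" using that N by (simp add: smooth_manifold_def)
    from openin_continuous_map_preimage[OF True is_chart_openin[OF this]]
    show ?thesis by (simp add: vimage_def Collect_conj_eq[symmetric] Int_def)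
  qed
  have 1: "smooth_vec_on (mdim M) (snd c ` (fst c \<inter> f -` fst c')) (coord_rep c c' f) \<longleftrightarrow>
      (\<forall>i. chart_smooth (mdim M) c (fst c \<inter> f -` fst c') (\<lambda>x. snd c' (f x) i))" for c c'
    by (simp add: smooth_vec_on_def chart_smooth_def coord_rep_def o_def)
  have sub: "fst c \<inter> (topspace (mtop M) \<inter> B) = fst c \<inter> B" if "c \<in> max_atlas M" for c B
    using is_chart_subset[OF max_atlas_is_chart[OF that]] by blast
  have "(\<forall>c\<in>atlas M. \<forall>c'\<in>atlas N. \<forall>i. chart_smooth (mdim M) c (fst c \<inter> f -` fst c') (\<lambda>x. snd c' (f x) i)) \<longleftrightarrow>
    (\<forall>c'\<in>atlas N. \<forall>i. smooth_fun M (topspace (mtop M) \<inter> f -` fst c') (\<lambda>x. snd c' (f x) i))" (is "?L \<longleftrightarrow> ?R")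
  proof
    assume L: ?L
    show ?R
    proof (intro ballI allI, rule smooth_funI[OF M op])
      fix c' i x assume c': "c' \<in> atlas N" and x: "x \<in> topspace (mtop M) \<inter> f -` fst c'"
      then have "x \<in> topspace (mtop M)" by blast
      then obtain c where c: "c \<in> atlas M" "x \<in> fst c" "c \<in> max_atlas M" by (rule atlas_cover[OF M])
      have "openin (mtop M) (fst c \<inter> f -` fst c')"
        using openin_Int[OF is_chart_openin[OF max_atlas_is_chart[OF c(3)]] op[OF c']] sub[OF c(3)] by simp
      then show "\<exists>c\<in>max_atlas M. \<exists>B. openin (mtop M) B \<and> x \<in> B \<and> B \<subseteq> fst c \<and>
          chart_smooth (mdim M) c B (\<lambda>x. snd c' (f x) i)"
        using L c c' x by (intro bexI[of _ c] exI[of _ "fst c \<inter> f -` fst c'"]) auto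
    qed
  next
    assume R: ?R
    show ?L
    proof (intro ballI allI)
      fix c c' i assume c: "c \<in> atlas M" and c': "c' \<in> atlas N"
      then have c: "c \<in> max_atlas M" using atlas_subset_max_atlas[OF M] by blast
      from R c' have "smooth_fun M (topspace (mtop M) \<inter> f -` fst c') (\<lambda>x. snd c' (f x) i)" by blast
      from smooth_funD[OF this c] show "chart_smooth (mdim M) c (fst c \<inter> f -` fst c') (\<lambda>x. snd c' (f x) i)"
        unfolding sub[OF c] .
    qed
  qed
  with True 1 show ?thesis by (simp add: smooth_map_def)
qed (simp add: smooth_map_def)

text \<open>Passes from coordinates of atlas charts, in which \<open>smooth_map\<close> is stated,
  to arbitrary smooth functions on the target, in particular to coordinates of slice charts.\<close>

lemma smooth_map_pullback:
  assumes M: "smooth_manifold M" and N: "smooth_manifold N" and f: "smooth_map M N f"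
    and B: "openin (mtop N) B" and F: "smooth_fun N B F"
  shows "smooth_fun M (topspace (mtop M) \<inter> f -` B) (\<lambda>x. F (f x))"
proof -
  have cont: "continuous_map (mtop M) (mtop N) f" using f by (simp add: smooth_map_def)
  have pre: "openin (mtop M) (topspace (mtop M) \<inter> f -` B)" if "openin (mtop N) B" for B
    using openin_continuous_map_preimage[OF cont that] by (simp add: vimage_def Int_def)
  show ?thesis
  proof (rule smooth_funI[OF M pre[OF B]])
    fix x assume x: "x \<in> topspace (mtop M) \<inter> f -` B"
    then have xM: "x \<in> topspace (mtop M)" and "f x \<in> topspace (mtop N)"
      using openin_subset[OF B] by auto
    from atlas_cover[OF N this(2)] obtain c' where c': "c' \<in> atlas N" "f x \<in> fst c'" "c' \<in> max_atlas N" .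
    from atlas_cover[OF M xM] obtain c where c: "c \<in> atlas M" "x \<in> fst c" "c \<in> max_atlas M" .
    note ch = max_atlas_is_chart[OF c(3)] and ch' = max_atlas_is_chart[OF c'(3)]
    define B' where "B' = B \<inter> fst c'"
    have B': "openin (mtop N) B'" "B' \<subseteq> fst c'" "B' \<subseteq> B"
      using openin_Int[OF B is_chart_openin[OF ch']] by (auto simp: B'_def)
    define A where "A = fst c \<inter> (topspace (mtop M) \<inter> f -` B')"
    have A: "openin (mtop M) A" "A \<subseteq> fst c" "f ` A \<subseteq> B'"
      using openin_Int[OF is_chart_openin[OF ch] pre[OF B'(1)]] by (auto simp: A_def)
    have "smooth_fun M (topspace (mtop M) \<inter> f -` fst c') (\<lambda>x. snd c' (f x) i)" for i
      using f c'(1) unfolding smooth_map_iff[OF M N] by blast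
    then have co: "chart_smooth (mdim M) c A (\<lambda>x. snd c' (f x) i)" for i
      by (rule smooth_fun_chart_smooth[OF _ c(3)]) (use B'(2) in \<open>auto simp: A_def\<close>)
    have "chart_smooth (mdim M) c A (\<lambda>x. F (f x))"
      by (rule chart_smooth_compose[OF ch ch' A(1,2) B'(1,2) A(3) co
            smooth_fun_chart_smooth[OF F c'(3) B'(2,3)]])
    with A c x c' show "\<exists>c\<in>max_atlas M. \<exists>B. openin (mtop M) B \<and> x \<in> B \<and> B \<subseteq> fst c \<and>
        chart_smooth (mdim M) c B (\<lambda>x. F (f x))"
      by (intro bexI[of _ c] exI[of _ A]) (auto simp: A_def B'_def)
  qed
qed

lemma smooth_map_compose:
  assumes M: "smooth_manifold M" and N: "smooth_manifold N" and P: "smooth_manifold P"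
    and f: "smooth_map M N f" and g: "smooth_map N P g"
  shows "smooth_map M P (\<lambda>x. g (f x))"
  unfolding smooth_map_iff[OF M P]
proof (intro conjI ballI allI)
  have cont: "continuous_map (mtop M) (mtop N) f" "continuous_map (mtop N) (mtop P) g"
    using f g by (simp_all add: smooth_map_def)
  then show "continuous_map (mtop M) (mtop P) (\<lambda>x. g (f x))"
    using continuous_map_compose[of _ _ f _ g] by (simp add: o_def)
  fix c i assume c: "c \<in> atlas P"
  then have ch: "is_chart P c" using P by (simp add: smooth_manifold_def)
  have op: "openin (mtop N) (topspace (mtop N) \<inter> g -` fst c)"
    using openin_continuous_map_preimage[OF cont(2) is_chart_openin[OF ch]] by (simp add: vimage_def Int_def)
  have "smooth_fun N (topspace (mtop N) \<inter> g -` fst c) (\<lambda>x. snd c (g x) i)"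
    using g c unfolding smooth_map_iff[OF N P] by blast
  from smooth_map_pullback[OF M N f op this]
  show "smooth_fun M (topspace (mtop M) \<inter> (\<lambda>x. g (f x)) -` fst c) (\<lambda>x. snd c (g (f x)) i)"
    by (rule smooth_fun_mono) (use continuous_map_image_subset_topspace[OF cont(1)] in auto)
qed

section \<open>Products\<close>

lemma second_countable_prod_topology:
  assumes "second_countable X" "second_countable Y"
  shows "second_countable (prod_topology X Y)"
proof -
  obtain A where A: "countable A" "\<forall>V\<in>A. openin X V"
    "\<forall>U x. openin X U \<and> x \<in> U \<longrightarrow> (\<exists>V\<in>A. x \<in> V \<and> V \<subseteq> U)"
    using assms(1) unfolding second_countable_def by (elim exE conjE)
  obtain B where B: "countable B" "\<forall>V\<in>B. openin Y V"
    "\<forall>U x. openin Y U \<and> x \<in> U \<longrightarrow> (\<exists>V\<in>B. x \<in> V \<and> V \<subseteq> U)"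
    using assms(2) unfolding second_countable_def by (elim exE conjE)
  show ?thesis
    unfolding second_countable_def
  proof (intro exI[of _ "(\<lambda>(U, V). U \<times> V) ` (A \<times> B)"] conjI allI impI ballI)
    show "countable ((\<lambda>(U, V). U \<times> V) ` (A \<times> B))" using A(1) B(1) by blast
    show "openin (prod_topology X Y) V" if "V \<in> (\<lambda>(U, V). U \<times> V) ` (A \<times> B)" for V
      using that A(2) B(2) by (auto simp: openin_prod_Times_iff)
    fix W z assume W: "openin (prod_topology X Y) W \<and> z \<in> W"
    obtain x y where z: "z = (x, y)" by (cases z)
    obtain U V where U: "openin X U" "x \<in> U" and V: "openin Y V" "y \<in> V" and UV: "U \<times> V \<subseteq> W"
      using W unfolding z openin_prod_topology_alt by blast
    obtain U' where U': "U' \<in> A" "x \<in> U'" "U' \<subseteq> U" using A(3) U by meson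
    obtain V' where V': "V' \<in> B" "y \<in> V'" "V' \<subseteq> V" using B(3) V by meson
    show "\<exists>V\<in>(\<lambda>(U, V). U \<times> V) ` (A \<times> B). z \<in> V \<and> V \<subseteq> W"
      using U' V' UV by (intro bexI[of _ "U' \<times> V'"]) (auto simp: z)
  qed
qed

text \<open>With \<open>shift\<close> and \<open>join\<close> this identifies
  \<open>R_pow (m + n)\<close> with a product. \<open>trunc\<close> has to clear the entries from
  \<open>m\<close> on to land in \<open>R_pow m\<close>; for \<open>shift\<close> the vanishing from
  \<open>n\<close> on is inherited.\<close>

definition trunc :: "nat \<Rightarrow> (nat \<Rightarrow> real) \<Rightarrow> (nat \<Rightarrow> real)" where
  "trunc m q = (\<lambda>i. if i < m then q i else 0)"

definition shift :: "nat \<Rightarrow> (nat \<Rightarrow> real) \<Rightarrow> (nat \<Rightarrow> real)" where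
  "shift m q = (\<lambda>i. q (i + m))"

definition join :: "nat \<Rightarrow> (nat \<Rightarrow> real) \<Rightarrow> (nat \<Rightarrow> real) \<Rightarrow> (nat \<Rightarrow> real)" where
  "join m p q = (\<lambda>i. if i < m then p i else q (i - m))"

lemma trunc_join: "p \<in> R_pow m \<Longrightarrow> trunc m (join m p q) = p"
  by (auto simp: trunc_def join_def fun_eq_iff)

lemma shift_join: "shift m (join m p q) = q"
  by (auto simp: shift_def join_def fun_eq_iff)

lemma join_trunc_shift: "join m (trunc m q) (shift m q) = q"
  by (auto simp: trunc_def join_def shift_def fun_eq_iff)

lemma prod_chart_eq: "prod_chart m c c' = (fst c \<times> fst c', \<lambda>z. join m (snd c (fst z)) (snd c' (snd z)))"
  by (auto simp: prod_chart_def join_def fun_eq_iff)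

lemma continuous_map_coordinate:
  "continuous_map X (Euclidean_space n) f \<Longrightarrow> continuous_map X euclideanreal (\<lambda>x. f x i)"
  by (simp add: continuous_map_Euclidean_space_componentwise)

lemma continuous_map_trunc: "continuous_map (Euclidean_space (m + n)) (Euclidean_space m) (trunc m)"
  unfolding continuous_map_Euclidean_space_componentwise
proof (intro conjI allI)
  fix i
  show "continuous_map (Euclidean_space (m + n)) euclideanreal (\<lambda>x. trunc m x i)"
    using continuous_map_coordinate[OF continuous_map_id, of "m + n" i]
    by (cases "i < m") (simp_all add: trunc_def id_def)
qed (simp add: trunc_def)

lemma continuous_map_shift: "continuous_map (Euclidean_space (m + n)) (Euclidean_space n) (shift m)"
  unfolding continuous_map_Euclidean_space_componentwise
proof (intro conjI allI)
  fix i
  show "continuous_map (Euclidean_space (m + n)) euclideanreal (\<lambda>x. shift m x i)"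
    using continuous_map_coordinate[OF continuous_map_id, of "m + n" "i + m"]
    by (simp add: shift_def id_def)
qed (auto simp: shift_def topspace_Euclidean_space)

lemma continuous_map_join:
  assumes "continuous_map X (Euclidean_space m) f" "continuous_map X (Euclidean_space n) g"
  shows "continuous_map X (Euclidean_space (m + n)) (\<lambda>x. join m (f x) (g x))"
  unfolding continuous_map_Euclidean_space_componentwise
proof (intro conjI allI)
  fix i
  show "continuous_map X euclideanreal (\<lambda>x. join m (f x) (g x) i)"
    using continuous_map_coordinate[OF assms(1), of i] continuous_map_coordinate[OF assms(2), of "i - m"]
    by (cases "i < m") (simp_all add: join_def)
next
  show "\<forall>x\<in>topspace X. join m (f x) (g x) \<in> R_pow (m + n)"
    using assms by (auto simp: continuous_map_Euclidean_space_componentwise join_def)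
qed

text \<open>The inverse is assembled from those of \<open>f\<close> and \<open>g\<close> after
  splitting a vector by \<open>trunc\<close> and \<open>shift\<close>. Both product charts and the
  local embeddings of the fibre product rest on this.\<close>

lemma embedding_map_join:
  assumes f: "embedding_map X (Euclidean_space m) f" and g: "embedding_map Y (Euclidean_space n) g"
  shows "embedding_map (prod_topology X Y) (Euclidean_space (m + n)) (\<lambda>z. join m (f (fst z)) (g (snd z)))"
proof -
  let ?j = "\<lambda>z. join m (f (fst z)) (g (snd z))"
  obtain f' where f': "homeomorphic_maps X (subtopology (Euclidean_space m) (f ` topspace X)) f f'"
    using f unfolding embedding_map_def homeomorphic_map_maps by blast
  obtain g' where g': "homeomorphic_maps Y (subtopology (Euclidean_space n) (g ` topspace Y)) g g'"
    using g unfolding embedding_map_def homeomorphic_map_maps by blast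
  have cf: "continuous_map X (Euclidean_space m) f" "continuous_map Y (Euclidean_space n) g"
    using f' g' by (auto simp: homeomorphic_maps_def continuous_map_in_subtopology)
  have fR: "f x \<in> R_pow m" if "x \<in> topspace X" for x
    using cf(1) that by (auto simp: continuous_map_Euclidean_space_componentwise)
  let ?T = "subtopology (Euclidean_space (m + n)) (?j ` topspace (prod_topology X Y))"
  have 1: "continuous_map ?T (subtopology (Euclidean_space m) (f ` topspace X)) (trunc m)"
    by (auto simp: continuous_map_in_subtopology continuous_map_from_subtopology[OF continuous_map_trunc]
        trunc_join[OF fR])
  have 2: "continuous_map ?T (subtopology (Euclidean_space n) (g ` topspace Y)) (shift m)"
    by (auto simp: continuous_map_in_subtopology continuous_map_from_subtopology[OF continuous_map_shift]
        shift_join)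
  have "homeomorphic_maps (prod_topology X Y) ?T ?j (\<lambda>q. (f' (trunc m q), g' (shift m q)))"
    unfolding homeomorphic_maps_def
  proof (intro conjI ballI)
    have "continuous_map (prod_topology X Y) (Euclidean_space (m + n)) ?j"
      using continuous_map_compose[OF continuous_map_fst cf(1)] continuous_map_compose[OF continuous_map_snd cf(2)]
      by (intro continuous_map_join) (simp_all add: o_def)
    then show "continuous_map (prod_topology X Y) ?T ?j" by (auto simp: continuous_map_in_subtopology)
    have "continuous_map ?T X (\<lambda>q. f' (trunc m q))" "continuous_map ?T Y (\<lambda>q. g' (shift m q))"
      using continuous_map_compose[OF 1, of X f'] continuous_map_compose[OF 2, of Y g'] f' g'
      by (simp_all add: homeomorphic_maps_def o_def)
    then show "continuous_map ?T (prod_topology X Y) (\<lambda>q. (f' (trunc m q), g' (shift m q)))"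
      by (rule continuous_map_pairedI)
  next
    fix z assume "z \<in> topspace (prod_topology X Y)"
    then show "(f' (trunc m (?j z)), g' (shift m (?j z))) = z"
      using f' g' by (auto simp: homeomorphic_maps_def trunc_join[OF fR] shift_join)
  next
    fix q assume "q \<in> topspace ?T"
    then obtain z where "z \<in> topspace (prod_topology X Y)" "q = ?j z" by auto
    then show "?j (f' (trunc m q), g' (shift m q)) = q"
      using f' g' by (auto simp: homeomorphic_maps_def trunc_join[OF fR] shift_join)
  qed
  then show ?thesis
    unfolding embedding_map_def homeomorphic_map_maps by blast
qed

lemma is_chart_R_pow: "is_chart M c \<Longrightarrow> x \<in> fst c \<Longrightarrow> snd c x \<in> R_pow (mdim M)"
  using openin_Euclidean_space_subset[of "mdim M" "snd c ` fst c"] by (auto simp: is_chart_def)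

lemma prod_chart_image:
  assumes c: "is_chart M c" and A: "A \<subseteq> fst c"
  shows "snd (prod_chart (mdim M) c c') ` (A \<times> B) = {q. trunc (mdim M) q \<in> snd c ` A \<and> shift (mdim M) q \<in> snd c' ` B}"
proof (intro equalityI subsetI)
  fix q assume "q \<in> snd (prod_chart (mdim M) c c') ` (A \<times> B)"
  then obtain x y where xy: "x \<in> A" "y \<in> B" "q = join (mdim M) (snd c x) (snd c' y)"
    by (auto simp: prod_chart_eq)
  moreover have "snd c x \<in> R_pow (mdim M)" using is_chart_R_pow[OF c] xy(1) A by blast
  ultimately show "q \<in> {q. trunc (mdim M) q \<in> snd c ` A \<and> shift (mdim M) q \<in> snd c' ` B}"
    by (simp add: trunc_join shift_join)
next
  fix q assume "q \<in> {q. trunc (mdim M) q \<in> snd c ` A \<and> shift (mdim M) q \<in> snd c' ` B}"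
  then obtain x y where "x \<in> A" "y \<in> B" "trunc (mdim M) q = snd c x" "shift (mdim M) q = snd c' y"
    by blast
  then show "q \<in> snd (prod_chart (mdim M) c c') ` (A \<times> B)"
    using join_trunc_shift[of "mdim M" q]
    by (auto simp: prod_chart_eq intro!: image_eqI[of _ _ "(x, y)"])
qed

lemma openin_trunc_shift:
  assumes "openin (Euclidean_space m) V" "openin (Euclidean_space n) W"
  shows "openin (Euclidean_space (m + n)) {q. trunc m q \<in> V \<and> shift m q \<in> W}"
proof -
  have "openin (Euclidean_space (m + n)) ({q \<in> topspace (Euclidean_space (m + n)). trunc m q \<in> V} \<inter>
      {q \<in> topspace (Euclidean_space (m + n)). shift m q \<in> W})"
    by (intro openin_Int openin_continuous_map_preimage[OF continuous_map_trunc assms(1)]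
        openin_continuous_map_preimage[OF continuous_map_shift assms(2)])
  \<comment> \<open>Vanishing of \<open>shift m q\<close> from \<open>n\<close> on is vanishing of
    \<open>q\<close> from \<open>m + n\<close> on, so the second condition already places
    \<open>q\<close> in the space.\<close>
  moreover have "q \<in> topspace (Euclidean_space (m + n))" if "shift m q \<in> W" for q
  proof -
    have "shift m q \<in> R_pow n" using that assms(2) openin_Euclidean_space_subset by blast
    then show ?thesis
      by (auto simp: topspace_Euclidean_space shift_def) (metis add_diff_inverse_nat add.commute
          add_le_imp_le_diff le_add1 le_trans not_less)
  qed
  then have "{q \<in> topspace (Euclidean_space (m + n)). trunc m q \<in> V} \<inter>
      {q \<in> topspace (Euclidean_space (m + n)). shift m q \<in> W} = {q. trunc m q \<in> V \<and> shift m q \<in> W}" by blast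
  ultimately show ?thesis by simp
qed

lemma is_chart_prod:
  assumes c: "is_chart M c" and c': "is_chart N c'"
  shows "is_chart (prod_mfd M N) (prod_chart (mdim M) c c')"
proof -
  note ops = is_chart_openin[OF c] is_chart_openin[OF c']
  have "openin (Euclidean_space (mdim M + mdim N)) (snd (prod_chart (mdim M) c c') ` (fst c \<times> fst c'))"
    unfolding prod_chart_image[OF c order_refl]
    using c c' by (intro openin_trunc_shift) (auto simp: is_chart_def)
  moreover have "embedding_map (subtopology (prod_topology (mtop M) (mtop N)) (fst c \<times> fst c'))
      (Euclidean_space (mdim M + mdim N)) (snd (prod_chart (mdim M) c c'))"
    using embedding_map_join[of "subtopology (mtop M) (fst c)" "mdim M" "snd c"
        "subtopology (mtop N) (fst c')" "mdim N" "snd c'"] c c'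
    by (simp add: prod_chart_eq is_chart_def flip: subtopology_Times)
  ultimately show ?thesis
    using ops by (simp add: is_chart_def prod_mfd_def prod_chart_eq openin_prod_Times_iff)
qed

lemma prod_mfd_simps [simp]:
  "mtop (prod_mfd M N) = prod_topology (mtop M) (mtop N)" "mdim (prod_mfd M N) = mdim M + mdim N"
  "atlas (prod_mfd M N) = {prod_chart (mdim M) c c' | c c'. c \<in> atlas M \<and> c' \<in> atlas N}"
  by (simp_all add: prod_mfd_def)

lemma chart_smooth_prod_coord:
  assumes c: "is_chart M c" and c': "is_chart N c'" and A: "openin (mtop (prod_mfd M N)) A" "A \<subseteq> fst c \<times> fst c'"
  shows "chart_smooth (mdim (prod_mfd M N)) (prod_chart (mdim M) c c') A (\<lambda>z. snd c (fst z) i)"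
    and "chart_smooth (mdim (prod_mfd M N)) (prod_chart (mdim M) c c') A (\<lambda>z. snd c' (snd z) i)"
proof -
  let ?C = "prod_chart (mdim M) c c'"
  note ch = is_chart_prod[OF c c']
  have A': "A \<subseteq> fst ?C" using A(2) by (simp add: prod_chart_eq)
  note co = chart_smooth_coord[OF ch A(1) A'] chart_smooth_const[of "mdim (prod_mfd M N)" ?C A 0]
  show "chart_smooth (mdim (prod_mfd M N)) ?C A (\<lambda>z. snd c (fst z) i)"
  proof (cases "i < mdim M")
    case True
    show ?thesis
      by (rule chart_smooth_cong[OF ch A(1) A' co(1)[of i]]) (simp add: True prod_chart_eq join_def)
  next
    \<comment> \<open>From \<open>mdim M\<close> on the coordinates of the first factor are 0,
      whereas the entries of the joined vector belong to the second factor.\<close>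
    case False
    have "0 = snd c (fst z) i" if "z \<in> A" for z
      using is_chart_R_pow[OF c, of "fst z"] that A(2) False by auto
    then show ?thesis by (rule chart_smooth_cong[OF ch A(1) A' co(2)])
  qed
  show "chart_smooth (mdim (prod_mfd M N)) ?C A (\<lambda>z. snd c' (snd z) i)"
    by (rule chart_smooth_cong[OF ch A(1) A' co(1)[of "i + mdim M"]]) (simp add: prod_chart_eq join_def)
qed

lemma chart_smooth_fst:
  assumes c: "is_chart M c" and c': "is_chart N c'" and A: "openin (mtop M) A" "A \<subseteq> fst c"
    and F: "chart_smooth (mdim M) c A F"
  shows "chart_smooth (mdim (prod_mfd M N)) (prod_chart (mdim M) c c') (A \<times> fst c') (\<lambda>z. F (fst z))"
proof -
  have op: "openin (mtop (prod_mfd M N)) (A \<times> fst c')" "A \<times> fst c' \<subseteq> fst c \<times> fst c'"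
    using A is_chart_openin[OF c'] by (auto simp: openin_prod_Times_iff)
  show ?thesis
    by (rule chart_smooth_compose[OF is_chart_prod[OF c c'] c op(1) _ A _ chart_smooth_prod_coord(1)[OF c c' op] F])
      (use A in \<open>auto simp: prod_chart_eq\<close>)
qed

lemma chart_smooth_snd:
  assumes c: "is_chart M c" and c': "is_chart N c'" and A: "openin (mtop N) A" "A \<subseteq> fst c'"
    and F: "chart_smooth (mdim N) c' A F"
  shows "chart_smooth (mdim (prod_mfd M N)) (prod_chart (mdim M) c c') (fst c \<times> A) (\<lambda>z. F (snd z))"
proof -
  have op: "openin (mtop (prod_mfd M N)) (fst c \<times> A)" "fst c \<times> A \<subseteq> fst c \<times> fst c'"
    using A is_chart_openin[OF c] by (auto simp: openin_prod_Times_iff)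
  show ?thesis
    by (rule chart_smooth_compose[OF is_chart_prod[OF c c'] c' op(1) _ A _ chart_smooth_prod_coord(2)[OF c c' op] F])
      (use A in \<open>auto simp: prod_chart_eq\<close>)
qed

lemma smooth_manifold_prod:
  assumes M: "smooth_manifold M" and N: "smooth_manifold N"
  shows "smooth_manifold (prod_mfd M N)"
proof -
  have ch: "is_chart M c" if "c \<in> atlas M" for c using M that by (simp add: smooth_manifold_def)
  have ch': "is_chart N c" if "c \<in> atlas N" for c using N that by (simp add: smooth_manifold_def)
  have tr: "smooth_transition (prod_mfd M N) (prod_chart (mdim M) c c') (prod_chart (mdim M) d d')"
    if c: "c \<in> atlas M" "c' \<in> atlas N" and d: "d \<in> atlas M" "d' \<in> atlas N" for c c' d d'
    unfolding smooth_transition_iff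
  proof
    fix i
    have op: "openin (mtop M) (fst c \<inter> fst d)" "openin (mtop N) (fst c' \<inter> fst d')"
      using is_chart_openin ch[OF c(1)] ch[OF d(1)] ch'[OF c(2)] ch'[OF d(2)] by blast+
    show "chart_smooth (mdim (prod_mfd M N)) (prod_chart (mdim M) c c')
        (fst (prod_chart (mdim M) c c') \<inter> fst (prod_chart (mdim M) d d'))
        (\<lambda>z. snd (prod_chart (mdim M) d d') z i)"
    proof (cases "i < mdim M")
      case True
      have "chart_smooth (mdim M) c (fst c \<inter> fst d) (\<lambda>x. snd d x i)"
        using M c d by (auto simp: smooth_manifold_def smooth_transition_iff)
      from chart_smooth_fst[OF ch[OF c(1)] ch'[OF c(2)] op(1) Int_lower1 this] show ?thesis
        using True by (auto simp: prod_chart_eq join_def elim!: chart_smooth_mono)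
    next
      case False
      have "chart_smooth (mdim N) c' (fst c' \<inter> fst d') (\<lambda>x. snd d' x (i - mdim M))"
        using N c d by (auto simp: smooth_manifold_def smooth_transition_iff)
      from chart_smooth_snd[OF ch[OF c(1)] ch'[OF c(2)] op(2) Int_lower1 this] show ?thesis
        using False by (auto simp: prod_chart_eq join_def elim!: chart_smooth_mono)
    qed
  qed
  have cover: "(\<Union>c\<in>atlas (prod_mfd M N). fst c) = topspace (mtop (prod_mfd M N))"
  proof -
    have "(\<Union>c\<in>atlas M. fst c) = topspace (mtop M)" "(\<Union>c\<in>atlas N. fst c) = topspace (mtop N)"
      using M N by (auto simp: smooth_manifold_def)
    moreover have "(\<Union>c\<in>atlas (prod_mfd M N). fst c) = (\<Union>c\<in>atlas M. fst c) \<times> (\<Union>c\<in>atlas N. fst c)"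
      unfolding prod_mfd_simps prod_chart_eq by force
    ultimately show ?thesis by simp
  qed
  have "Hausdorff_space (mtop (prod_mfd M N))" "second_countable (mtop (prod_mfd M N))"
    using M N by (simp_all add: smooth_manifold_def Hausdorff_space_prod_topology second_countable_prod_topology)
  moreover have "\<forall>c\<in>atlas (prod_mfd M N). is_chart (prod_mfd M N) c"
    unfolding prod_mfd_simps using is_chart_prod ch ch' by blast
  moreover have "\<forall>c\<in>atlas (prod_mfd M N). \<forall>c'\<in>atlas (prod_mfd M N). smooth_transition (prod_mfd M N) c c'"
    unfolding prod_mfd_simps using tr by blast
  ultimately show ?thesis using cover unfolding smooth_manifold_def by blast
qed

lemma prod_chart_max_atlas:
  assumes M: "smooth_manifold M" and N: "smooth_manifold N" and c: "c \<in> atlas M" "c' \<in> atlas N"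
  shows "prod_chart (mdim M) c c' \<in> max_atlas (prod_mfd M N)"
  using atlas_subset_max_atlas[OF smooth_manifold_prod[OF M N]] c unfolding prod_mfd_simps by blast

lemma smooth_fun_prodI:
  assumes M: "smooth_manifold M" and N: "smooth_manifold N" and A: "openin (mtop (prod_mfd M N)) A"
    and F: "\<And>c c'. c \<in> max_atlas M \<Longrightarrow> c' \<in> max_atlas N \<Longrightarrow>
      chart_smooth (mdim (prod_mfd M N)) (prod_chart (mdim M) c c') (A \<inter> fst c \<times> fst c') F"
  shows "smooth_fun (prod_mfd M N) A F"
proof (rule smooth_funI[OF smooth_manifold_prod[OF M N] A])
  fix z assume "z \<in> A"
  then have z: "fst z \<in> topspace (mtop M)" "snd z \<in> topspace (mtop N)"
    using openin_subset[OF A] by auto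
  obtain c where c: "c \<in> atlas M" "fst z \<in> fst c" "c \<in> max_atlas M" using atlas_cover[OF M z(1)] .
  obtain c' where c': "c' \<in> atlas N" "snd z \<in> fst c'" "c' \<in> max_atlas N" using atlas_cover[OF N z(2)] .
  have "openin (mtop (prod_mfd M N)) (fst c \<times> fst c')"
    using is_chart_openin[OF max_atlas_is_chart[OF c(3)]] is_chart_openin[OF max_atlas_is_chart[OF c'(3)]]
    unfolding prod_mfd_simps openin_prod_Times_iff by blast
  then have "openin (mtop (prod_mfd M N)) (A \<inter> fst c \<times> fst c')" using A by blast
  then show "\<exists>c\<in>max_atlas (prod_mfd M N). \<exists>B. openin (mtop (prod_mfd M N)) B \<and> z \<in> B \<and> B \<subseteq> fst c \<and>
      chart_smooth (mdim (prod_mfd M N)) c B F"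
    using F[OF c(3) c'(3)] \<open>z \<in> A\<close> c(2) c'(2)
    by (intro bexI[OF _ prod_chart_max_atlas[OF M N c(1) c'(1)]] exI[of _ "A \<inter> fst c \<times> fst c'"])
      (auto simp: prod_chart_eq mem_Times_iff)
qed

lemma smooth_fun_fst:
  assumes M: "smooth_manifold M" and N: "smooth_manifold N" and A: "openin (mtop M) A" and F: "smooth_fun M A F"
  shows "smooth_fun (prod_mfd M N) (A \<times> topspace (mtop N)) (\<lambda>z. F (fst z))"
proof (rule smooth_fun_prodI[OF M N])
  fix c c' assume c: "c \<in> max_atlas M" and c': "c' \<in> max_atlas N"
  note ch = max_atlas_is_chart[OF c] and ch' = max_atlas_is_chart[OF c']
  have op: "openin (mtop M) (fst c \<inter> A)" using is_chart_openin[OF ch] A by (rule openin_Int)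
  show "chart_smooth (mdim (prod_mfd M N)) (prod_chart (mdim M) c c')
      (A \<times> topspace (mtop N) \<inter> fst c \<times> fst c') (\<lambda>z. F (fst z))"
    by (rule chart_smooth_mono[OF chart_smooth_fst[OF ch ch' op Int_lower1 smooth_funD[OF F c]]]) blast
qed (use A in \<open>simp add: openin_prod_Times_iff\<close>)

lemma smooth_fun_snd:
  assumes M: "smooth_manifold M" and N: "smooth_manifold N" and A: "openin (mtop N) A" and F: "smooth_fun N A F"
  shows "smooth_fun (prod_mfd M N) (topspace (mtop M) \<times> A) (\<lambda>z. F (snd z))"
proof (rule smooth_fun_prodI[OF M N])
  fix c c' assume c: "c \<in> max_atlas M" and c': "c' \<in> max_atlas N"
  note ch = max_atlas_is_chart[OF c] and ch' = max_atlas_is_chart[OF c']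
  have op: "openin (mtop N) (fst c' \<inter> A)" using is_chart_openin[OF ch'] A by (rule openin_Int)
  show "chart_smooth (mdim (prod_mfd M N)) (prod_chart (mdim M) c c')
      (topspace (mtop M) \<times> A \<inter> fst c \<times> fst c') (\<lambda>z. F (snd z))"
    by (rule chart_smooth_mono[OF chart_smooth_snd[OF ch ch' op Int_lower1 smooth_funD[OF F c']]]) blast
qed (use A in \<open>simp add: openin_prod_Times_iff\<close>)

lemma atlas_is_chart: "smooth_manifold M \<Longrightarrow> c \<in> atlas M \<Longrightarrow> is_chart M c"
  by (simp add: smooth_manifold_def)

lemma smooth_map_fst:
  assumes M: "smooth_manifold M" and N: "smooth_manifold N"
  shows "smooth_map (prod_mfd M N) M fst"
  unfolding smooth_map_iff[OF smooth_manifold_prod[OF M N] M]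
proof (intro conjI ballI allI)
  show "continuous_map (mtop (prod_mfd M N)) (mtop M) fst" by (simp add: continuous_map_fst)
  fix c i assume c: "c \<in> atlas M"
  then have "c \<in> max_atlas M" using atlas_subset_max_atlas[OF M] by blast
  from smooth_fun_fst[OF M N is_chart_openin[OF atlas_is_chart[OF M c]] smooth_fun_coord[OF M this]]
  show "smooth_fun (prod_mfd M N) (topspace (mtop (prod_mfd M N)) \<inter> fst -` fst c) (\<lambda>z. snd c (fst z) i)"
    by (rule smooth_fun_mono) auto
qed

lemma smooth_map_snd:
  assumes M: "smooth_manifold M" and N: "smooth_manifold N"
  shows "smooth_map (prod_mfd M N) N snd"
  unfolding smooth_map_iff[OF smooth_manifold_prod[OF M N] N]
proof (intro conjI ballI allI)
  show "continuous_map (mtop (prod_mfd M N)) (mtop N) snd" by (simp add: continuous_map_snd)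
  fix c i assume c: "c \<in> atlas N"
  then have "c \<in> max_atlas N" using atlas_subset_max_atlas[OF N] by blast
  from smooth_fun_snd[OF M N is_chart_openin[OF atlas_is_chart[OF N c]] smooth_fun_coord[OF N this]]
  show "smooth_fun (prod_mfd M N) (topspace (mtop (prod_mfd M N)) \<inter> snd -` fst c) (\<lambda>z. snd c (snd z) i)"
    by (rule smooth_fun_mono) auto
qed

lemma smooth_map_pair:
  assumes T: "smooth_manifold T" and M: "smooth_manifold M" and N: "smooth_manifold N"
    and a: "smooth_map T M a" and b: "smooth_map T N b"
  shows "smooth_map T (prod_mfd M N) (\<lambda>t. (a t, b t))"
  unfolding smooth_map_iff[OF T smooth_manifold_prod[OF M N]]
proof (intro conjI ballI allI)
  show "continuous_map (mtop T) (mtop (prod_mfd M N)) (\<lambda>t. (a t, b t))"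
    using a b by (simp add: continuous_map_pairedI smooth_map_def)
  fix e i assume "e \<in> atlas (prod_mfd M N)"
  then obtain c c' where c: "c \<in> atlas M" "c' \<in> atlas N" and e: "e = prod_chart (mdim M) c c'" by auto
  have "smooth_fun T (topspace (mtop T) \<inter> a -` fst c) (\<lambda>t. snd c (a t) i)"
    using a c unfolding smooth_map_iff[OF T M] by blast
  moreover have "smooth_fun T (topspace (mtop T) \<inter> b -` fst c') (\<lambda>t. snd c' (b t) (i - mdim M))"
    using b c unfolding smooth_map_iff[OF T N] by blast
  ultimately show "smooth_fun T (topspace (mtop T) \<inter> (\<lambda>t. (a t, b t)) -` fst e) (\<lambda>t. snd e (a t, b t) i)"
    by (cases "i < mdim M") (auto simp: e prod_chart_eq join_def elim!: smooth_fun_mono)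
qed

section \<open>Submanifolds and tangent vectors\<close>

definition slice_chart :: "'a mfd \<Rightarrow> 'a set \<Rightarrow> nat \<Rightarrow> 'a chart \<Rightarrow> bool" where
  "slice_chart P S d c \<longleftrightarrow> c \<in> max_atlas P \<and> snd c ` (fst c \<inter> S) = snd c ` fst c \<inter> R_pow d"

lemma embedded_submfd_simps [simp]:
  "mtop (embedded_submfd P S d) = subtopology (mtop P) S" "mdim (embedded_submfd P S d) = d"
  "atlas (embedded_submfd P S d) = {(fst c \<inter> S, snd c) | c. slice_chart P S d c}"
  by (simp_all add: embedded_submfd_def slice_chart_def topspace_Euclidean_space)

lemma slice_chart_max_atlas: "slice_chart P S d c \<Longrightarrow> c \<in> max_atlas P"
  by (simp add: slice_chart_def)

lemma slice_chart_is_chart: "slice_chart P S d c \<Longrightarrow> is_chart P c"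
  by (simp add: slice_chart_def max_atlas_is_chart)

text \<open>The slice condition localizes: by injectivity of the chart, a point of \<open>A\<close>
  whose image lies in \<open>R_pow d\<close> is the very point of \<open>S\<close> with that
  image.\<close>

lemma slice_chart_image:
  assumes c: "slice_chart P S d c" and A: "A \<subseteq> fst c"
  shows "snd c ` (A \<inter> S) = snd c ` A \<inter> R_pow d"
proof (intro equalityI subsetI)
  fix q assume "q \<in> snd c ` (A \<inter> S)"
  then show "q \<in> snd c ` A \<inter> R_pow d" using c A by (fastforce simp: slice_chart_def)
next
  fix q assume q: "q \<in> snd c ` A \<inter> R_pow d"
  then obtain t where t: "t \<in> A" "q = snd c t" by blast
  have "q \<in> snd c ` (fst c \<inter> S)" using q A c by (auto simp: slice_chart_def)
  then obtain s where s: "s \<in> fst c" "s \<in> S" "q = snd c s" by blast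
  then have "s = t" using is_chart_inj[OF slice_chart_is_chart[OF c]] t A by (auto dest: inj_onD)
  with s t show "q \<in> snd c ` (A \<inter> S)" by blast
qed

text \<open>Both topologies are induced from the same space of functions, so one open set
  \<open>T\<close> cuts out the image in \<open>R_pow (mdim P)\<close> as well as in
  \<open>R_pow d\<close>.\<close>

lemma slice_chart_open_image:
  assumes c: "slice_chart P S d c" and A: "openin (mtop P) A" "A \<subseteq> fst c" and d: "d \<le> mdim P"
  shows "openin (Euclidean_space d) (snd c ` (A \<inter> S))"
proof -
  have "openin (Euclidean_space (mdim P)) (snd c ` A)"
    by (rule is_chart_open_image[OF slice_chart_is_chart[OF c] A])
  then obtain T where T: "open T" "snd c ` A = R_pow (mdim P) \<inter> T"
    unfolding Euclidean_space_eq_top_of_set openin_open by blast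
  have "snd c ` (A \<inter> S) = R_pow d \<inter> T"
    unfolding slice_chart_image[OF c A(2)] T(2) using d by auto
  with T(1) show ?thesis unfolding Euclidean_space_eq_top_of_set openin_open by blast
qed

lemma is_chart_slice:
  assumes c: "slice_chart P S d c" and d: "d \<le> mdim P"
  shows "is_chart (embedded_submfd P S d) (fst c \<inter> S, snd c)"
proof -
  note ch = slice_chart_is_chart[OF c]
  let ?Q = "embedded_submfd P S d"
  show ?thesis
  proof (rule is_chartI)
    show "openin (mtop ?Q) (fst c \<inter> S)"
      using is_chart_openin[OF ch] by (auto simp: openin_subtopology)
    show "inj_on (snd c) (fst c \<inter> S)" using is_chart_inj[OF ch] by (rule inj_on_subset) simp
    have eq: "subtopology (mtop ?Q) (fst c \<inter> S) = subtopology (mtop P) (fst c \<inter> S)"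
      by (simp add: subtopology_subtopology Int_commute Int_left_absorb)
    have "continuous_map (subtopology (mtop P) (fst c \<inter> S)) (Euclidean_space (mdim P)) (snd c)"
      by (rule continuous_map_from_subtopology_mono[OF is_chart_continuous[OF ch]]) simp
    moreover have "snd c x \<in> R_pow d" if "x \<in> fst c \<inter> S" for x
      using that slice_chart_image[OF c order_refl] by blast
    ultimately show "continuous_map (subtopology (mtop ?Q) (fst c \<inter> S)) (Euclidean_space (mdim ?Q)) (snd c)"
      unfolding eq continuous_map_Euclidean_space_componentwise by simp
  next
    fix A assume A: "openin (mtop ?Q) A" "A \<subseteq> fst c \<inter> S"
    then obtain T where T: "openin (mtop P) T" "A = T \<inter> S" by (auto simp: openin_subtopology)
    then have "A = (T \<inter> fst c) \<inter> S" using A(2) by blast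
    then show "openin (Euclidean_space (mdim ?Q)) (snd c ` A)"
      using slice_chart_open_image[OF c openin_Int[OF T(1) is_chart_openin[OF ch]] Int_lower2 d] by simp
  qed
qed

lemma slice_chart_inv:
  assumes c: "slice_chart P S d c" and q: "q \<in> snd c ` (fst c \<inter> S)"
  shows "inv_into (fst c \<inter> S) (snd c) q = chart_inv c q"
proof -
  note inj = is_chart_inj[OF slice_chart_is_chart[OF c]]
  obtain x where x: "x \<in> fst c \<inter> S" "q = snd c x" using q by blast
  have "x \<in> fst c" using x by blast
  then show ?thesis
    using inv_into_f_f[OF inj] inv_into_f_f[OF inj_on_subset[OF inj Int_lower1] x(1)] x(2) by simp
qed

lemma chart_smooth_slice:
  assumes c: "slice_chart P S d c" and d: "d \<le> mdim P" and A: "openin (mtop P) A" "A \<subseteq> fst c"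
    and F: "chart_smooth (mdim P) c A F"
  shows "chart_smooth d (fst c \<inter> S, snd c) (A \<inter> S) F"
  unfolding chart_smooth_def
proof
  fix k
  have "Ck_on k d (snd c ` (A \<inter> S)) (F \<circ> chart_inv c)"
    using Ck_on_slice[OF d chart_smoothD[OF F]] by (simp add: slice_chart_image[OF c A(2)])
  then have "Ck_on k d (snd c ` (A \<inter> S)) (F \<circ> inv_into (fst c \<inter> S) (snd c))"
  proof (rule Ck_on_cong[OF slice_chart_open_image[OF c A d]])
    fix q assume "q \<in> snd c ` (A \<inter> S)"
    then have "q \<in> snd c ` (fst c \<inter> S)" using A(2) by blast
    then show "(F \<circ> chart_inv c) q = (F \<circ> inv_into (fst c \<inter> S) (snd c)) q"
      by (simp add: slice_chart_inv[OF c])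
  qed
  then show "Ck_on k d (snd (fst c \<inter> S, snd c) ` (A \<inter> S)) (F \<circ> chart_inv (fst c \<inter> S, snd c))"
    by simp
qed

text \<open>The first \<open>d\<close> partial derivatives agree, and \<open>w\<close> has no other
  components.\<close>

lemma cdiff_slice:
  assumes c: "slice_chart P S d c" and d: "d \<le> mdim P" and x: "x \<in> fst c" "x \<in> S" and w: "w \<in> R_pow d"
  shows "cdiff d (fst c \<inter> S, snd c) F x w = cdiff (mdim P) c F x w"
proof -
  note op = slice_chart_open_image[OF c is_chart_openin[OF slice_chart_is_chart[OF c]] order_refl d]
  have "partial_deriv j (F \<circ> inv_into (fst c \<inter> S) (snd c)) (snd c x) = partial_deriv j (F \<circ> chart_inv c) (snd c x)"
    if "j < d" for j
    by (rule partial_deriv_cong(1)[OF op _ that]) (use x in \<open>simp_all add: slice_chart_inv[OF c]\<close>)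
  then have "cdiff d (fst c \<inter> S, snd c) F x w = (\<Sum>j<d. partial_deriv j (F \<circ> chart_inv c) (snd c x) * w j)"
    unfolding cdiff_def by simp
  also have "\<dots> = cdiff (mdim P) c F x w"
    unfolding cdiff_def using d w by (intro sum.mono_neutral_left) auto
  finally show ?thesis .
qed

text \<open>Compatibility is inherited from the maximal atlas of \<open>P\<close>; what must be
  supplied is that slice charts cover \<open>S\<close>.\<close>

lemma smooth_manifold_embedded:
  assumes P: "smooth_manifold P" and d: "d \<le> mdim P" and S: "S \<subseteq> topspace (mtop P)"
    and cover: "\<And>x. x \<in> S \<Longrightarrow> \<exists>c. slice_chart P S d c \<and> x \<in> fst c"
  shows "smooth_manifold (embedded_submfd P S d)"
  unfolding smooth_manifold_def
proof (intro conjI)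
  let ?Q = "embedded_submfd P S d"
  show "Hausdorff_space (mtop ?Q)" "second_countable (mtop ?Q)"
    using P by (simp_all add: smooth_manifold_def Hausdorff_space_subtopology second_countable_subtopology)
  show "\<forall>c\<in>atlas ?Q. is_chart ?Q c"
    unfolding embedded_submfd_simps using is_chart_slice[OF _ d] by blast
  have "(\<Union>c\<in>atlas ?Q. fst c) = S"
    unfolding embedded_submfd_simps using cover by force
  then show "(\<Union>c\<in>atlas ?Q. fst c) = topspace (mtop ?Q)"
    using S by auto
  have "smooth_transition ?Q (fst c \<inter> S, snd c) (fst c' \<inter> S, snd c')"
    if c: "slice_chart P S d c" and c': "slice_chart P S d c'" for c c'
    unfolding smooth_transition_iff
  proof
    fix i
    have op: "openin (mtop P) (fst c \<inter> fst c')"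
      using is_chart_openin slice_chart_is_chart[OF c] slice_chart_is_chart[OF c'] by blast
    have "chart_smooth (mdim P) c (fst c \<inter> fst c') (\<lambda>x. snd c' x i)"
      using max_atlas_transition[OF P slice_chart_max_atlas[OF c] slice_chart_max_atlas[OF c']]
      by (simp add: smooth_transition_iff)
    from chart_smooth_slice[OF c d op Int_lower1 this]
    have "chart_smooth d (fst c \<inter> S, snd c) ((fst c \<inter> fst c') \<inter> S) (\<lambda>x. snd c' x i)" .
    then show "chart_smooth (mdim ?Q) (fst c \<inter> S, snd c) (fst (fst c \<inter> S, snd c) \<inter> fst (fst c' \<inter> S, snd c'))
        (\<lambda>x. snd (fst c' \<inter> S, snd c') x i)"
      by (simp only: embedded_submfd_simps fst_conv snd_conv) (rule chart_smooth_mono, auto)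
  qed
  then show "\<forall>c\<in>atlas ?Q. \<forall>c'\<in>atlas ?Q. smooth_transition ?Q c c'"
    unfolding embedded_submfd_simps by blast
qed

context
  fixes P :: "'a mfd" and S d
  assumes P: "smooth_manifold P" and d: "d \<le> mdim P" and S: "S \<subseteq> topspace (mtop P)"
    and cover: "\<And>x. x \<in> S \<Longrightarrow> \<exists>c. slice_chart P S d c \<and> x \<in> fst c"
begin

private abbreviation (input) "Q \<equiv> embedded_submfd P S d"
private lemma QM: "smooth_manifold Q"
  by (rule smooth_manifold_embedded[OF P d S]) (rule cover)

lemma smooth_fun_embedded:
  assumes A: "openin (mtop P) A" and F: "smooth_fun P A F"
  shows "smooth_fun Q (A \<inter> S) F"
proof (rule smooth_funI[OF QM])
  show "openin (mtop Q) (A \<inter> S)" using A by (auto simp: openin_subtopology)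
  fix x assume x: "x \<in> A \<inter> S"
  then obtain c where c: "slice_chart P S d c" "x \<in> fst c" using cover by blast
  have op: "openin (mtop P) (fst c \<inter> A)"
    using is_chart_openin[OF slice_chart_is_chart[OF c(1)]] A by (rule openin_Int)
  have "(fst c \<inter> S, snd c) \<in> max_atlas Q"
    using atlas_subset_max_atlas[OF QM] c(1) unfolding embedded_submfd_simps by blast
  moreover have "openin (mtop Q) ((fst c \<inter> A) \<inter> S)" using op by (auto simp: openin_subtopology)
  moreover have "chart_smooth (mdim Q) (fst c \<inter> S, snd c) ((fst c \<inter> A) \<inter> S) F"
    using chart_smooth_slice[OF c(1) d op Int_lower1 smooth_funD[OF F slice_chart_max_atlas[OF c(1)]]] by simp
  moreover have "x \<in> (fst c \<inter> A) \<inter> S" "(fst c \<inter> A) \<inter> S \<subseteq> fst (fst c \<inter> S, snd c)" using x c(2) by auto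
  ultimately show "\<exists>c\<in>max_atlas Q. \<exists>B. openin (mtop Q) B \<and> x \<in> B \<and> B \<subseteq> fst c \<and> chart_smooth (mdim Q) c B F"
    by blast
qed

lemma smooth_map_embedded_inclusion: "smooth_map Q P (\<lambda>x. x)"
  unfolding smooth_map_iff[OF QM P]
proof (intro conjI ballI allI)
  show "continuous_map (mtop Q) (mtop P) (\<lambda>x. x)" by (simp add: continuous_map_from_subtopology)
  fix c i assume "c \<in> atlas P"
  then have c: "c \<in> max_atlas P" using atlas_subset_max_atlas[OF P] by blast
  show "smooth_fun Q (topspace (mtop Q) \<inter> (\<lambda>x. x) -` fst c) (\<lambda>x. snd c x i)"
    by (rule smooth_fun_mono[OF smooth_fun_embedded[OF is_chart_openin[OF max_atlas_is_chart[OF c]] smooth_fun_coord[OF P c]]])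
      auto
qed

text \<open>A slice chart has the coordinate functions of the ambient chart that it restricts, so no
  new function has to be shown smooth. This yields the universal property stratum by
  stratum.\<close>

lemma smooth_map_into_embedded:
  assumes T: "smooth_manifold T" and f: "smooth_map T P f" and fS: "f ` topspace (mtop T) \<subseteq> S"
  shows "smooth_map T Q f"
  unfolding smooth_map_iff[OF T QM]
proof (intro conjI ballI allI)
  show "continuous_map (mtop T) (mtop Q) f"
    using f fS by (auto simp: smooth_map_def continuous_map_in_subtopology)
  fix e i assume "e \<in> atlas Q"
  then obtain c where c: "slice_chart P S d c" and e: "e = (fst c \<inter> S, snd c)" by auto
  note cm = slice_chart_max_atlas[OF c]
  have "smooth_fun T (topspace (mtop T) \<inter> f -` fst c) (\<lambda>x. snd c (f x) i)"
    by (rule smooth_map_pullback[OF T P f is_chart_openin[OF max_atlas_is_chart[OF cm]] smooth_fun_coord[OF P cm]])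
  then show "smooth_fun T (topspace (mtop T) \<inter> f -` fst e) (\<lambda>x. snd e (f x) i)"
    unfolding e fst_conv snd_conv by (rule smooth_fun_mono) auto
qed

end

section \<open>Open submanifolds\<close>

lemma open_submfd_simps [simp]:
  "mtop (open_submfd M U) = subtopology (mtop M) U" "mdim (open_submfd M U) = mdim M"
  "atlas (open_submfd M U) = (\<lambda>c. (fst c \<inter> U, snd c)) ` atlas M"
  unfolding open_submfd_def Setcompr_eq_image by simp_all

lemma is_chart_open_submfd:
  assumes c: "is_chart M c" and U: "openin (mtop M) U"
  shows "is_chart (open_submfd M U) (fst c \<inter> U, snd c)"
proof (rule is_chartI)
  have op: "openin (mtop (open_submfd M U)) A \<longleftrightarrow> openin (mtop M) A \<and> A \<subseteq> U" for A
    using U by (simp add: openin_open_subtopology)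
  show "openin (mtop (open_submfd M U)) (fst c \<inter> U)"
    unfolding op using is_chart_openin[OF c] U by auto
  show "inj_on (snd c) (fst c \<inter> U)" using is_chart_inj[OF c] by (rule inj_on_subset) simp
  have "subtopology (mtop (open_submfd M U)) (fst c \<inter> U) = subtopology (mtop M) (fst c \<inter> U)"
    by (simp add: subtopology_subtopology Int_commute Int_left_absorb)
  then show "continuous_map (subtopology (mtop (open_submfd M U)) (fst c \<inter> U))
      (Euclidean_space (mdim (open_submfd M U))) (snd c)"
    using continuous_map_from_subtopology_mono[OF is_chart_continuous[OF c], of "fst c \<inter> U"] by simp
  show "openin (Euclidean_space (mdim (open_submfd M U))) (snd c ` A)"
    if "openin (mtop (open_submfd M U)) A" "A \<subseteq> fst c \<inter> U" for A
    using is_chart_open_image[OF c, of A] that unfolding op by simp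
qed

lemma chart_smooth_open_submfd:
  assumes c: "is_chart M c" and A: "openin (mtop M) A" "A \<subseteq> fst c" "A \<subseteq> U"
  shows "chart_smooth (mdim M) (fst c \<inter> U, snd c) A F \<longleftrightarrow> chart_smooth (mdim M) c A F"
  using chart_smooth_restrict[of M "fst c" "snd c" A "fst c \<inter> U" F] assms by simp

lemma smooth_manifold_open_submfd:
  assumes M: "smooth_manifold M" and U: "openin (mtop M) U"
  shows "smooth_manifold (open_submfd M U)"
  unfolding smooth_manifold_def
proof (intro conjI)
  let ?O = "open_submfd M U"
  show "Hausdorff_space (mtop ?O)" "second_countable (mtop ?O)"
    using M by (simp_all add: smooth_manifold_def Hausdorff_space_subtopology second_countable_subtopology)
  show "\<forall>c\<in>atlas ?O. is_chart ?O c"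
    unfolding open_submfd_simps using is_chart_open_submfd[OF atlas_is_chart[OF M] U] by blast
  have "(\<Union>c\<in>atlas M. fst c) = topspace (mtop M)" using M by (simp add: smooth_manifold_def)
  moreover have "(\<Union>c\<in>atlas ?O. fst c) = (\<Union>c\<in>atlas M. fst c) \<inter> U"
    unfolding open_submfd_simps by auto
  ultimately show "(\<Union>c\<in>atlas ?O. fst c) = topspace (mtop ?O)"
    by simp
  have "smooth_transition ?O (fst c \<inter> U, snd c) (fst c' \<inter> U, snd c')"
    if c: "c \<in> atlas M" and c': "c' \<in> atlas M" for c c'
    unfolding smooth_transition_iff
  proof
    fix i
    have op: "openin (mtop M) ((fst c \<inter> U) \<inter> (fst c' \<inter> U))"
      using is_chart_openin[OF atlas_is_chart[OF M c]] is_chart_openin[OF atlas_is_chart[OF M c']] U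
      by (intro openin_Int)
    have "chart_smooth (mdim M) c (fst c \<inter> fst c') (\<lambda>x. snd c' x i)"
      using M c c' by (auto simp: smooth_manifold_def smooth_transition_iff)
    then have "chart_smooth (mdim M) c ((fst c \<inter> U) \<inter> (fst c' \<inter> U)) (\<lambda>x. snd c' x i)"
      by (rule chart_smooth_mono) auto
    then have "chart_smooth (mdim M) (fst c \<inter> U, snd c) ((fst c \<inter> U) \<inter> (fst c' \<inter> U)) (\<lambda>x. snd c' x i)"
      by (subst chart_smooth_open_submfd[OF atlas_is_chart[OF M c] op]) auto
    then show "chart_smooth (mdim ?O) (fst c \<inter> U, snd c) (fst (fst c \<inter> U, snd c) \<inter> fst (fst c' \<inter> U, snd c'))
        (\<lambda>x. snd (fst c' \<inter> U, snd c') x i)"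
      by simp
  qed
  then show "\<forall>c\<in>atlas ?O. \<forall>c'\<in>atlas ?O. smooth_transition ?O c c'"
    unfolding open_submfd_simps by blast
qed

section \<open>Tangent vectors and injectivity of differentials\<close>

lemma cdiff_change:
  assumes M: "smooth_manifold M" and c: "c \<in> max_atlas M" "x \<in> fst c" and c': "c' \<in> max_atlas M" "x \<in> fst c'"
    and A: "openin (mtop M) A" "x \<in> A" and F: "smooth_fun M A F"
  shows "cdiff (mdim M) c F x w = cdiff (mdim M) c' F x (\<lambda>i. cdiff (mdim M) c (\<lambda>y. snd c' y i) x w)"
proof -
  note ch = max_atlas_is_chart[OF c(1)] and ch' = max_atlas_is_chart[OF c'(1)]
  define B where "B = A \<inter> fst c \<inter> fst c'"
  have B: "openin (mtop M) B" "B \<subseteq> fst c" "B \<subseteq> fst c'" "B \<subseteq> A" "x \<in> B"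
    using openin_Int[OF openin_Int[OF A(1) is_chart_openin[OF ch]] is_chart_openin[OF ch']] A(2) c(2) c'(2)
    by (auto simp: B_def)
  have "chart_smooth (mdim M) c B (\<lambda>y. snd c' y i)" for i
    by (rule smooth_fun_chart_smooth[OF smooth_fun_coord[OF M c'(1)] c(1) B(2,3)])
  moreover have "chart_smooth (mdim M) c' B F"
    by (rule smooth_fun_chart_smooth[OF F c'(1) B(3,4)])
  ultimately show ?thesis
    using cdiff_chain[OF ch ch' B(1,2) B(1,3), of "\<lambda>y. y" F x w] B(5) by simp
qed

text \<open>Coordinates from \<open>mdim M\<close> on are constantly 0; thus a transformed
  coordinate vector stays in \<open>R_pow (mdim M)\<close>.\<close>

lemma cdiff_coord_zero:
  assumes c: "is_chart M c" "x \<in> fst c" and c': "is_chart M c'" "x \<in> fst c'" and i: "mdim M \<le> i"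
  shows "cdiff (mdim M) c (\<lambda>y. snd c' y i) x w = 0"
proof -
  have "cdiff (mdim M) c (\<lambda>y. snd c' y i) x w = cdiff (mdim M) c (\<lambda>y. 0) x w"
  proof (rule cdiff_cong[OF c(1) openin_Int[OF is_chart_openin[OF c(1)] is_chart_openin[OF c'(1)]] Int_lower1])
    show "x \<in> fst c \<inter> fst c'" using c(2) c'(2) by blast
    show "snd c' y i = 0" if "y \<in> fst c \<inter> fst c'" for y
      using is_chart_R_pow[OF c'(1), of y] that i by simp
  qed
  also have "\<dots> = 0" by (simp add: cdiff_def partial_deriv_def o_def)
  finally show ?thesis .
qed

lemma charts_atD: "smooth_manifold M \<Longrightarrow> c \<in> charts_at M x \<Longrightarrow> c \<in> max_atlas M \<and> x \<in> fst c \<and> is_chart M c"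
  using atlas_subset_max_atlas[of M] atlas_is_chart[of M c] by (auto simp: charts_at_def)

text \<open>One coordinate vector determines the whole family: it is carried to every other chart by
  the differential of the transition, and compatibility of two transported vectors is the chain rule
  \<open>cdiff_change\<close>. So linear algebra on a tangent space can be done in a single
  chart.\<close>

lemma tangent_vector_exists:
  assumes M: "smooth_manifold M" and c: "c \<in> charts_at M x" and w: "w \<in> R_pow (mdim M)"
  obtains v where "v \<in> tangent_space M x" "v c = w"
proof -
  let ?n = "mdim M"
  define v where "v c' = (if c' \<in> charts_at M x then (\<lambda>i. cdiff ?n c (\<lambda>y. snd c' y i) x w) else (\<lambda>i. 0))" for c'
  have c1: "c \<in> max_atlas M" "x \<in> fst c" "is_chart M c" using charts_atD[OF M c] by auto
  have vw: "v c i = w i" for i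
  proof (cases "i < ?n")
    case True
    then show ?thesis using cdiff_coord[OF c1(3,2) True, of w] c by (simp add: v_def)
  next
    case False
    then show ?thesis using cdiff_coord_zero[OF c1(3,2) c1(3,2), of i w] c w by (simp add: v_def)
  qed
  have "v \<in> tangent_space M x"
    unfolding tangent_space_def
  proof (intro CollectI conjI allI impI ballI)
    fix c' assume "c' \<notin> charts_at M x"
    then show "v c' = (\<lambda>i. 0)" by (simp add: v_def)
  next
    fix c' assume c': "c' \<in> charts_at M x"
    then have "is_chart M c'" "x \<in> fst c'" using charts_atD[OF M c'] by auto
    then show "v c' \<in> topspace (Euclidean_space ?n)"
      using c' cdiff_coord_zero[OF c1(3,2)] by (simp add: v_def topspace_Euclidean_space)
  next
    fix c' c'' assume c': "c' \<in> charts_at M x" and c'': "c'' \<in> charts_at M x"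
    have m: "c' \<in> max_atlas M" "x \<in> fst c'" "c'' \<in> max_atlas M" "x \<in> fst c''" "is_chart M c''"
      using charts_atD[OF M c'] charts_atD[OF M c''] by auto
    have vc: "v c' = (\<lambda>i. cdiff ?n c (\<lambda>y. snd c' y i) x w)" "v c'' = (\<lambda>i. cdiff ?n c (\<lambda>y. snd c'' y i) x w)"
      using c' c'' by (simp_all add: v_def)
    have "v c'' i = jac ?n (coord_rep c' c'' id) (snd c' x) (v c') i" for i
      unfolding vc jac_eq_cdiff id_apply
      by (rule cdiff_change[OF M c1(1,2) m(1,2) is_chart_openin[OF m(5)] m(4) smooth_fun_coord[OF M m(3)]])
    then show "v c'' = jac ?n (coord_rep c' c'' id) (snd c' x) (v c')" by (rule ext)
  qed
  moreover have "v c = w" by (rule ext) (rule vw)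
  ultimately show ?thesis by (rule that)
qed

lemma tangent_space_transform:
  assumes "v \<in> tangent_space M x" "c \<in> charts_at M x" "c' \<in> charts_at M x"
  shows "v c' = (\<lambda>i. cdiff (mdim M) c (\<lambda>y. snd c' y i) x (v c))"
proof
  fix i
  have "v c' = jac (mdim M) (coord_rep c c' id) (snd c x) (v c)"
    using assms unfolding tangent_space_def by blast
  then have "v c' i = jac (mdim M) (coord_rep c c' id) (snd c x) (v c) i"
    by (rule fun_cong)
  then show "v c' i = cdiff (mdim M) c (\<lambda>y. snd c' y i) x (v c)"
    unfolding jac_eq_cdiff id_apply .
qed

text \<open>Frees later arguments from the particular chart that \<open>SOME\<close> selects in
  \<open>tangent_map\<close>.\<close>

lemma cdiff_tangent_vector:
  assumes M: "smooth_manifold M" and v: "v \<in> tangent_space M x" and c: "c \<in> charts_at M x" "c' \<in> charts_at M x"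
    and A: "openin (mtop M) A" "x \<in> A" and F: "smooth_fun M A F"
  shows "cdiff (mdim M) c F x (v c) = cdiff (mdim M) c' F x (v c')"
  unfolding tangent_space_transform[OF v c]
  by (rule cdiff_change[OF M _ _ _ _ A F]) (use charts_atD[OF M c(1)] charts_atD[OF M c(2)] in blast)+

lemma tangent_map_eq_cdiff:
  assumes "c' \<in> charts_at N (f x)" "c = (SOME c. c \<in> charts_at M x)"
  shows "tangent_map M N f x v c' i = cdiff (mdim M) c (\<lambda>y. snd c' (f y) i) x (v c)"
  unfolding tangent_map_def Let_def assms(2)[symmetric] using assms(1) by (simp only: if_True jac_eq_cdiff)

lemma some_charts_at:
  assumes M: "smooth_manifold M" and "x \<in> topspace (mtop M)"
  shows "(SOME c. c \<in> charts_at M x) \<in> charts_at M x"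
proof -
  from atlas_cover[OF assms] obtain c where "c \<in> atlas M" "x \<in> fst c" by blast
  then have "c \<in> charts_at M x" by (simp add: charts_at_def)
  then show ?thesis by (rule someI)
qed

text \<open>Trivial kernel of the differential in one chart, the form in which the immersion
  property passes to slices and to products.\<close>

definition inj_diff :: "nat \<Rightarrow> 'a chart \<Rightarrow> ('a \<Rightarrow> nat \<Rightarrow> real) \<Rightarrow> 'a \<Rightarrow> bool" where
  "inj_diff n c f x \<longleftrightarrow> (\<forall>w\<in>R_pow n. (\<forall>i. cdiff n c (\<lambda>y. f y i) x w = 0) \<longrightarrow> w = (\<lambda>i. 0))"

lemma inj_diff_change:
  assumes M: "smooth_manifold M" and c: "c \<in> max_atlas M" "x \<in> fst c" and c': "c' \<in> max_atlas M" "x \<in> fst c'"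
    and A: "openin (mtop M) A" "x \<in> A" and f: "\<And>i. smooth_fun M A (\<lambda>y. f y i)"
    and inj: "inj_diff (mdim M) c f x"
  shows "inj_diff (mdim M) c' f x"
  unfolding inj_diff_def
proof (intro ballI impI)
  fix w assume w: "w \<in> R_pow (mdim M)" and 0: "\<forall>i. cdiff (mdim M) c' (\<lambda>y. f y i) x w = 0"
  note ch = max_atlas_is_chart[OF c(1)] and ch' = max_atlas_is_chart[OF c'(1)]
  define u where "u i = cdiff (mdim M) c' (\<lambda>y. snd c y i) x w" for i
  have u: "u = (\<lambda>i. 0)"
  proof -
    have "u \<in> R_pow (mdim M)" using cdiff_coord_zero[OF ch' c'(2) ch c(2)] by (simp add: u_def)
    moreover have "cdiff (mdim M) c (\<lambda>y. f y i) x u = 0" for i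
      using cdiff_change[OF M c' c A f, of i w] 0 by (simp add: u_def[abs_def])
    ultimately show ?thesis using inj unfolding inj_diff_def by blast
  qed
  \<comment> \<open>A component of \<open>w\<close> is the differential of a coordinate function of
    \<open>c'\<close> at \<open>w\<close>; computed in the chart \<open>c\<close> it is a linear
    function of \<open>u\<close>, and \<open>u\<close> vanishes.\<close>
  have "w i = 0" for i
  proof (cases "i < mdim M")
    case True
    have "w i = cdiff (mdim M) c' (\<lambda>y. snd c' y i) x w" by (rule cdiff_coord[OF ch' c'(2) True, symmetric])
    also have "\<dots> = cdiff (mdim M) c (\<lambda>y. snd c' y i) x u"
      using cdiff_change[OF M c' c is_chart_openin[OF ch'] c'(2) smooth_fun_coord[OF M c'(1)], of i w]
      by (simp add: u_def[abs_def])
    also have "\<dots> = 0" unfolding u by (simp add: cdiff_def)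
    finally show ?thesis .
  next
    case False
    then show ?thesis using w by simp
  qed
  then show "w = (\<lambda>i. 0)" by (rule ext)
qed

text \<open>In the chart \<open>c\<close> the tangent map is linear, a tangent vector is determined
  by its coordinates, and every vector of \<open>R_pow (mdim M)\<close> occurs by
  \<open>tangent_vector_exists\<close>. Injectivity is therefore triviality of the kernel.\<close>

lemma inj_tangent_map_iff:
  assumes M: "smooth_manifold M" and A: "openin (mtop M) A" "x \<in> A" and f: "\<And>i. smooth_fun M A (\<lambda>y. f y i)"
    and fx: "f x \<in> R_pow N" and c: "c \<in> charts_at M x"
  shows "inj_on (tangent_map M (eucl_mfd N) f x) (tangent_space M x) \<longleftrightarrow> inj_diff (mdim M) c f x"
proof -
  let ?n = "mdim M"
  have xM: "x \<in> topspace (mtop M)" using A openin_subset by blast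
  define c0 where "c0 = (SOME c. c \<in> charts_at M x)"
  have c0: "c0 \<in> charts_at M x" unfolding c0_def by (rule some_charts_at[OF M xM])
  let ?e = "(topspace (Euclidean_space N), \<lambda>p. p) :: (nat \<Rightarrow> real) chart"
  \<comment> \<open>The Euclidean manifold has a single chart, so the image vector is known from its
    component there and is 0 elsewhere.\<close>
  have ce: "charts_at (eucl_mfd N) (f x) = {?e}"
    using fx by (auto simp: charts_at_def eucl_mfd_def topspace_Euclidean_space)
  have tm: "tangent_map M (eucl_mfd N) f x v ?e i = cdiff ?n c (\<lambda>y. f y i) x (v c)"
    if v: "v \<in> tangent_space M x" for v i
    using tangent_map_eq_cdiff[OF _ c0_def, of ?e "eucl_mfd N" f v i] ce
      cdiff_tangent_vector[OF M v c0 c A f, of i] by simp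
  have tm0: "tangent_map M (eucl_mfd N) f x v e = (\<lambda>i. 0)" if "e \<noteq> ?e" for v e
    using that ce by (simp add: tangent_map_def Let_def)
  have teq: "tangent_map M (eucl_mfd N) f x u = tangent_map M (eucl_mfd N) f x v \<longleftrightarrow>
      (\<forall>i. cdiff ?n c (\<lambda>y. f y i) x (u c) = cdiff ?n c (\<lambda>y. f y i) x (v c))"
    if u: "u \<in> tangent_space M x" and v: "v \<in> tangent_space M x" for u v
  proof
    assume "tangent_map M (eucl_mfd N) f x u = tangent_map M (eucl_mfd N) f x v"
    then have "tangent_map M (eucl_mfd N) f x u ?e i = tangent_map M (eucl_mfd N) f x v ?e i" for i by simp
    then show "\<forall>i. cdiff ?n c (\<lambda>y. f y i) x (u c) = cdiff ?n c (\<lambda>y. f y i) x (v c)"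
      unfolding tm[OF u] tm[OF v] by blast
  next
    assume *: "\<forall>i. cdiff ?n c (\<lambda>y. f y i) x (u c) = cdiff ?n c (\<lambda>y. f y i) x (v c)"
    have "tangent_map M (eucl_mfd N) f x u e i = tangent_map M (eucl_mfd N) f x v e i" for e i
    proof (cases "e = ?e")
      case True
      then show ?thesis using * by (simp only: tm[OF u] tm[OF v])
    next
      case False
      show ?thesis by (simp only: tm0[OF False])
    qed
    then show "tangent_map M (eucl_mfd N) f x u = tangent_map M (eucl_mfd N) f x v" by (intro ext)
  qed
  have R: "v c \<in> R_pow ?n" if "v \<in> tangent_space M x" for v
    using that c unfolding tangent_space_def topspace_Euclidean_space by blast
  show ?thesis
  proof
    assume inj: "inj_on (tangent_map M (eucl_mfd N) f x) (tangent_space M x)"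
    show "inj_diff ?n c f x"
      unfolding inj_diff_def
    proof (intro ballI impI)
      fix w assume w: "w \<in> R_pow ?n" and 0: "\<forall>i. cdiff ?n c (\<lambda>y. f y i) x w = 0"
      obtain v where v: "v \<in> tangent_space M x" "v c = w" using tangent_vector_exists[OF M c w] .
      have "(\<lambda>i. 0) \<in> R_pow ?n" by simp
      then obtain z where z: "z \<in> tangent_space M x" "z c = (\<lambda>i. 0)" by (rule tangent_vector_exists[OF M c])
      have "tangent_map M (eucl_mfd N) f x v = tangent_map M (eucl_mfd N) f x z"
        unfolding teq[OF v(1) z(1)] v(2) z(2) using 0 by (simp add: cdiff_zero_coord)
      then have "v = z" using inj v(1) z(1) by (auto dest: inj_onD)
      then show "w = (\<lambda>i. 0)" using v(2) z(2) by simp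
    qed
  next
    assume inj: "inj_diff ?n c f x"
    show "inj_on (tangent_map M (eucl_mfd N) f x) (tangent_space M x)"
    proof (rule inj_onI)
      fix u v assume u: "u \<in> tangent_space M x" and v: "v \<in> tangent_space M x"
        and eq: "tangent_map M (eucl_mfd N) f x u = tangent_map M (eucl_mfd N) f x v"
      have "(\<lambda>i. u c i - v c i) = (\<lambda>i. 0)"
      proof -
        have "(\<lambda>i. u c i - v c i) \<in> R_pow ?n" using R[OF u] R[OF v] by simp
        moreover have "\<forall>i. cdiff ?n c (\<lambda>y. f y i) x (\<lambda>i. u c i - v c i) = 0"
          using eq unfolding teq[OF u v] cdiff_minus_arg by simp
        ultimately show ?thesis using inj unfolding inj_diff_def by blast
      qed
      then have uv: "u c = v c" by (simp add: fun_eq_iff)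
      have "u c' = v c'" for c'
      proof (cases "c' \<in> charts_at M x")
        case True
        then show ?thesis
          unfolding tangent_space_transform[OF u c True] tangent_space_transform[OF v c True] uv by simp
      next
        case False
        have "t c' = (\<lambda>i. 0)" if "t \<in> tangent_space M x" for t
          using that False unfolding tangent_space_def by blast
        from this[OF u] this[OF v] show ?thesis by (simp only:)
      qed
      then show "u = v" by (rule ext)
    qed
  qed
qed

section \<open>Transverse fibre products of manifolds\<close>

lemma second_countable_euclidean: "second_countable (euclidean :: 'a::second_countable_topology topology)"
proof -
  obtain \<B> :: "'a set set" where B: "countable \<B>" "\<And>C. C \<in> \<B> \<Longrightarrow> open C"
    "\<And>S. open S \<Longrightarrow> \<exists>U. U \<subseteq> \<B> \<and> S = \<Union>U"
    by (rule univ_second_countable) blast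
  have "\<exists>V\<in>\<B>. x \<in> V \<and> V \<subseteq> U" if U: "open U" "x \<in> U" for U x
  proof -
    obtain W where "W \<subseteq> \<B>" "U = \<Union>W" using B(3)[OF U(1)] by blast
    with U(2) show ?thesis by blast
  qed
  with B(1,2) show ?thesis
    unfolding second_countable_def open_openin[symmetric] by (intro exI[of _ \<B>]) simp
qed

lemma smooth_manifold_eucl: "smooth_manifold (eucl_mfd N)"
proof -
  let ?e = "(topspace (Euclidean_space N), \<lambda>p. p) :: (nat \<Rightarrow> real) chart"
  have E: "mtop (eucl_mfd N) = Euclidean_space N" "mdim (eucl_mfd N) = N" "atlas (eucl_mfd N) = {?e}"
    by (simp_all add: eucl_mfd_def)
  have ch: "is_chart (eucl_mfd N) ?e"
    by (rule is_chartI) (simp_all add: E)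
  have "Hausdorff_space (Euclidean_space N)" "second_countable (Euclidean_space N)"
    unfolding Euclidean_space_eq_top_of_set
    by (simp_all add: Hausdorff_space_subtopology second_countable_subtopology second_countable_euclidean)
  moreover have "smooth_transition (eucl_mfd N) ?e ?e"
    unfolding smooth_transition_iff
    using chart_smooth_coord[OF ch is_chart_openin[OF ch] order_refl] by simp
  ultimately show ?thesis using ch by (simp add: smooth_manifold_def E)
qed

lemma smooth_embedding_eucl_iff:
  assumes M: "smooth_manifold M"
  shows "smooth_embedding M (eucl_mfd N) f \<longleftrightarrow> embedding_map (mtop M) (Euclidean_space N) f \<and>
    (\<forall>i. smooth_fun M (topspace (mtop M)) (\<lambda>y. f y i)) \<and>
    (\<forall>x\<in>topspace (mtop M). \<forall>c\<in>charts_at M x. inj_diff (mdim M) c f x)"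
proof (cases "embedding_map (mtop M) (Euclidean_space N) f")
  case True
  let ?e = "(topspace (Euclidean_space N), \<lambda>p. p) :: (nat \<Rightarrow> real) chart"
  have E: "mtop (eucl_mfd N) = Euclidean_space N" "atlas (eucl_mfd N) = {?e}"
    by (simp_all add: eucl_mfd_def)
  have cont: "continuous_map (mtop M) (Euclidean_space N) f"
    using homeomorphic_imp_continuous_map[OF True[unfolded embedding_map_def]]
    by (simp add: continuous_map_in_subtopology)
  then have R: "f x \<in> R_pow N" if "x \<in> topspace (mtop M)" for x
    using that by (simp add: continuous_map_Euclidean_space_componentwise)
  have "topspace (mtop M) \<inter> f -` topspace (Euclidean_space N) = topspace (mtop M)"
    using R by (auto simp: topspace_Euclidean_space)
  then have sm: "smooth_map M (eucl_mfd N) f \<longleftrightarrow> (\<forall>i. smooth_fun M (topspace (mtop M)) (\<lambda>y. f y i))"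
    unfolding smooth_map_iff[OF M smooth_manifold_eucl] E using cont by simp
  have "inj_on (tangent_map M (eucl_mfd N) f x) (tangent_space M x) \<longleftrightarrow>
      (\<forall>c\<in>charts_at M x. inj_diff (mdim M) c f x)"
    if "\<forall>i. smooth_fun M (topspace (mtop M)) (\<lambda>y. f y i)" "x \<in> topspace (mtop M)" for x
  proof -
    have "inj_on (tangent_map M (eucl_mfd N) f x) (tangent_space M x) \<longleftrightarrow> inj_diff (mdim M) c f x"
      if "c \<in> charts_at M x" for c
      by (rule inj_tangent_map_iff[OF M openin_topspace \<open>x \<in> topspace (mtop M)\<close> _ R that])
        (use \<open>\<forall>i. smooth_fun M (topspace (mtop M)) (\<lambda>y. f y i)\<close> \<open>x \<in> topspace (mtop M)\<close> in simp_all)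
    with some_charts_at[OF M that(2)] show ?thesis by blast
  qed
  with True sm show ?thesis unfolding smooth_embedding_def E by blast
qed (simp add: smooth_embedding_def eucl_mfd_def)

text \<open>Coordinates from \<open>mdim P\<close> on always vanish, so finitely many equations cut
  out the slice.\<close>

lemma slice_chartI:
  assumes c: "c \<in> max_atlas P" and d: "d \<le> mdim P"
    and S: "\<And>x. x \<in> fst c \<Longrightarrow> x \<in> S \<longleftrightarrow> (\<forall>i\<in>{d..<mdim P}. snd c x i = 0)"
  shows "slice_chart P S d c"
proof -
  have "x \<in> S \<longleftrightarrow> snd c x \<in> R_pow d" if x: "x \<in> fst c" for x
  proof -
    have "snd c x \<in> R_pow (mdim P)" by (rule is_chart_R_pow[OF max_atlas_is_chart[OF c] x])
    then have "(\<forall>i\<in>{d..<mdim P}. snd c x i = 0) \<longleftrightarrow> snd c x \<in> R_pow d"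
      by (auto simp: not_le[symmetric])
    with S[OF x] show ?thesis by simp
  qed
  then have "snd c ` (fst c \<inter> S) = snd c ` fst c \<inter> R_pow d" by blast
  with c show ?thesis by (simp add: slice_chart_def)
qed

section \<open>Slice charts by exchange of coordinates\<close>

definition swap_coords :: "nat \<Rightarrow> nat \<Rightarrow> (nat \<Rightarrow> real) \<Rightarrow> (nat \<Rightarrow> real)" where
  "swap_coords a b p = (\<lambda>i. p (if i = a then b else if i = b then a else i))"

lemma swap_coords_invol: "swap_coords a b (swap_coords a b p) = p"
  by (auto simp: swap_coords_def fun_eq_iff)

text \<open>\<open>swap_coords\<close> is smooth and its own inverse. It will bring an exchanged
  coordinate to its place near the end.\<close>

lemma max_atlas_swap:
  assumes M: "smooth_manifold M" and c: "c \<in> max_atlas M" and ab: "a < mdim M" "b < mdim M"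
  shows "(fst c, \<lambda>x. swap_coords a b (snd c x)) \<in> max_atlas M"
proof -
  let ?E = "Euclidean_space (mdim M)"
  let ?\<sigma> = "swap_coords a b"
  define V where "V = snd c ` fst c"
  have V: "openin ?E V" using max_atlas_is_chart[OF c] by (simp add: V_def is_chart_def)
  have inj: "inj_on ?\<sigma> V" by (rule inj_on_inverseI[where g = ?\<sigma>]) (rule swap_coords_invol)
  have "continuous_map ?E ?E ?\<sigma>"
    unfolding continuous_map_Euclidean_space_componentwise
  proof (intro conjI allI)
    fix i
    show "continuous_map ?E euclideanreal (\<lambda>x. ?\<sigma> x i)"
      using continuous_map_coordinate[OF continuous_map_id] by (simp add: swap_coords_def id_def)
  qed (use ab in \<open>auto simp: swap_coords_def topspace_Euclidean_space\<close>)
  from openin_continuous_map_preimage[OF this V]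
  have "openin ?E {x \<in> topspace ?E. ?\<sigma> x \<in> V}" .
  moreover have "{x \<in> topspace ?E. ?\<sigma> x \<in> V} = ?\<sigma> ` V"
  proof (intro equalityI subsetI)
    fix x assume "x \<in> {x \<in> topspace ?E. ?\<sigma> x \<in> V}"
    then show "x \<in> ?\<sigma> ` V" using swap_coords_invol[of a b x] by (metis (mono_tags, lifting) image_eqI mem_Collect_eq)
  next
    fix x assume "x \<in> ?\<sigma> ` V"
    then obtain p where p: "p \<in> V" "x = ?\<sigma> p" by blast
    then have "p \<in> R_pow (mdim M)" using openin_Euclidean_space_subset[OF V] by blast
    then have "x \<in> topspace ?E" using ab p(2) by (auto simp: swap_coords_def topspace_Euclidean_space)
    with p show "x \<in> {x \<in> topspace ?E. ?\<sigma> x \<in> V}" by (simp add: swap_coords_invol)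
  qed
  ultimately have \<sigma>V: "openin ?E (?\<sigma> ` V)" by simp
  have 1: "Ck_on k (mdim M) W (\<lambda>p. ?\<sigma> p i)" if "openin ?E W" for k i W
    unfolding swap_coords_def using Ck_on_coord[OF that] by simp
  have 2: "Ck_on k (mdim M) (?\<sigma> ` V) (\<lambda>q. inv_into V ?\<sigma> q i)" for k i
  proof (rule Ck_on_cong[OF \<sigma>V 1[OF \<sigma>V, of k i]])
    fix q assume "q \<in> ?\<sigma> ` V"
    then obtain p where "p \<in> V" "q = ?\<sigma> p" by blast
    then show "?\<sigma> q i = inv_into V ?\<sigma> q i" using inv_into_f_f[OF inj] by (simp add: swap_coords_invol)
  qed
  have "({x \<in> fst c. snd c x \<in> V}, \<lambda>x. ?\<sigma> (snd c x)) \<in> max_atlas M"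
    by (rule max_atlas_compose[OF M c V _ inj \<sigma>V 1[OF V] 2]) (simp add: V_def)
  moreover have "{x \<in> fst c. snd c x \<in> V} = fst c" by (auto simp: V_def)
  ultimately show ?thesis by simp
qed

lemma max_atlas_replace:
  assumes M: "smooth_manifold M" and c: "c \<in> max_atlas M" and w: "w \<in> fst c"
    and B: "fst c \<subseteq> B" and F: "smooth_fun M B F" and j: "j < mdim M"
    and nz: "partial_deriv j (F \<circ> chart_inv c) (snd c w) \<noteq> 0"
  obtains c' where "c' \<in> max_atlas M" "w \<in> fst c'" "fst c' \<subseteq> fst c"
    "\<And>x. x \<in> fst c' \<Longrightarrow> snd c' x = replace_coord j (F \<circ> chart_inv c) (snd c x)"
proof -
  let ?E = "Euclidean_space (mdim M)"
  let ?f = "F \<circ> chart_inv c"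
  note ch = max_atlas_is_chart[OF c]
  have op: "openin ?E (snd c ` fst c)" using ch by (simp add: is_chart_def)
  have f: "Ck_on k (mdim M) (snd c ` fst c) ?f" for k
    by (rule chart_smoothD[OF smooth_fun_chart_smooth[OF F c order_refl B]])
  obtain V where V: "openin ?E V" "snd c w \<in> V" "V \<subseteq> snd c ` fst c" "inj_on (replace_coord j ?f) V"
    "openin ?E (replace_coord j ?f ` V)"
    "\<And>k l. Ck_on k (mdim M) (replace_coord j ?f ` V) (\<lambda>q. inv_into V (replace_coord j ?f) q l)"
    using replace_coordinate_local_diffeo[OF op f imageI[OF w] j nz] by metis
  have sm: "Ck_on k (mdim M) V (\<lambda>p. replace_coord j ?f p i)" for k i
  proof (cases "i = j")
    case True
    then have "(\<lambda>p. replace_coord j ?f p i) = ?f" by (simp add: replace_coord_apply fun_eq_iff)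
    then show ?thesis using Ck_on_mono[OF f V(3)] by (simp only:)
  next
    case False
    then show ?thesis using Ck_on_coord[OF V(1)] by (simp add: replace_coord_apply)
  qed
  have "({x \<in> fst c. snd c x \<in> V}, \<lambda>x. replace_coord j ?f (snd c x)) \<in> max_atlas M"
    by (rule max_atlas_compose[OF M c V(1,3,4,5) sm V(6)])
  from that[OF this] w V(2) show ?thesis by simp
qed

text \<open>Each step makes one more of the functions \<open>F s\<close> a coordinate: a tangent vector annihilated by the
  earlier ones but not by \<open>F r\<close> shows that \<open>F r\<close> has a nonzero partial derivative in a coordinate not
  yet used.\<close>

lemma straighten:
  assumes M: "smooth_manifold M" and c0: "c0 \<in> max_atlas M" "w \<in> fst c0"
    and B: "openin (mtop M) B" "w \<in> B" and F: "\<And>s. s < k \<Longrightarrow> smooth_fun M B (F s)"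
    and v: "\<And>s r. s < k \<Longrightarrow> r < k \<Longrightarrow> cdiff (mdim M) c0 (F s) w (v r) = (if s = r then 1 else 0)"
  shows "r \<le> k \<Longrightarrow> r \<le> mdim M \<and> (\<exists>c\<in>max_atlas M. w \<in> fst c \<and> fst c \<subseteq> B \<and>
    (\<forall>x\<in>fst c. \<forall>s<r. snd c x (mdim M - 1 - s) = F s x))"
proof (induction r)
  case 0
  note ch0 = max_atlas_is_chart[OF c0(1)]
  have A: "openin (mtop M) (fst c0 \<inter> B)" using is_chart_openin[OF ch0] B(1) by (rule openin_Int)
  \<comment> \<open>No function has been placed yet, so the chart is only shrunk into
    \<open>B\<close>; this is the case of the identity in \<open>max_atlas_compose\<close>.\<close>
  define V where "V = snd c0 ` (fst c0 \<inter> B)"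
  have V: "openin (Euclidean_space (mdim M)) V" unfolding V_def by (rule is_chart_open_image[OF ch0 A]) simp
  have id: "(\<lambda>p. p) ` V = V" by simp
  have inv: "inv_into V (\<lambda>p. p) q i = q i" if "q \<in> V" for q i
    using inv_into_f_f[of "\<lambda>p. p" V q] that by simp
  have "({x \<in> fst c0. snd c0 x \<in> V}, \<lambda>x. snd c0 x) \<in> max_atlas M"
  proof (rule max_atlas_compose[OF M c0(1) V, where \<Theta> = "\<lambda>p. p"])
    show "V \<subseteq> snd c0 ` fst c0" by (auto simp: V_def)
    show "Ck_on k (mdim M) ((\<lambda>p. p) ` V) (\<lambda>q. inv_into V (\<lambda>p. p) q i)" for k i
      unfolding id by (rule Ck_on_cong[OF V Ck_on_coord[OF V]]) (simp add: inv)
  qed (simp_all add: V Ck_on_coord[OF V])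
  moreover have "{x \<in> fst c0. snd c0 x \<in> V} = fst c0 \<inter> B"
    using is_chart_inj[OF ch0] by (auto simp: V_def dest: inj_onD)
  ultimately show ?case
    using c0(2) B(2) by (intro conjI bexI[of _ "(fst c0 \<inter> B, \<lambda>x. snd c0 x)"]) simp_all
next
  case (Suc r)
  let ?n = "mdim M"
  have r: "r < k" using Suc.prems by simp
  then obtain c where c: "c \<in> max_atlas M" "w \<in> fst c" "fst c \<subseteq> B"
    and Fc: "\<And>x s. x \<in> fst c \<Longrightarrow> s < r \<Longrightarrow> snd c x (?n - 1 - s) = F s x" and rn: "r \<le> ?n"
    using Suc.IH by auto
  note ch = max_atlas_is_chart[OF c(1)]
  \<comment> \<open>The vector \<open>v r\<close>, given in the chart \<open>c0\<close>, in the
    coordinates of the current chart.\<close>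
  define u where "u i = cdiff ?n c0 (\<lambda>y. snd c y i) w (v r)" for i
  have u: "cdiff ?n c (F s) w u = (if s = r then 1 else 0)" if "s < k" for s
    using cdiff_change[OF M c0 c(1,2) B F[OF that], of "v r"] v[OF that r] by (simp add: u_def[abs_def])
  \<comment> \<open>The last \<open>r\<close> coordinates are the functions \<open>F s\<close> with
    \<open>s < r\<close>, which \<open>v r\<close> annihilates.\<close>
  have u0: "u (?n - 1 - s) = 0" if "s < r" for s
  proof -
    have "u (?n - 1 - s) = cdiff ?n c (\<lambda>y. snd c y (?n - 1 - s)) w u"
      using that rn by (intro cdiff_coord[OF ch c(2), symmetric]) simp
    also have "\<dots> = cdiff ?n c (F s) w u"
      by (rule cdiff_cong[OF ch is_chart_openin[OF ch] order_refl c(2)]) (rule Fc[OF _ that])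
    also have "\<dots> = 0" using u[of s] that r by simp
    finally show ?thesis .
  qed
  have "(\<Sum>j<?n. partial_deriv j (F r \<circ> chart_inv c) (snd c w) * u j) \<noteq> 0"
    using u[OF r] by (simp add: cdiff_def)
  then obtain j where "j \<in> {..<?n}" "partial_deriv j (F r \<circ> chart_inv c) (snd c w) * u j \<noteq> 0"
    by (rule sum.not_neutral_contains_not_neutral)
  then have j: "j < ?n" "partial_deriv j (F r \<circ> chart_inv c) (snd c w) \<noteq> 0" "u j \<noteq> 0"
    by simp_all
  have jr: "j < ?n - r"
  proof (rule ccontr)
    assume "\<not> j < ?n - r"
    then have "?n - 1 - j < r" "?n - 1 - (?n - 1 - j) = j" using j(1) rn by auto
    with u0[of "?n - 1 - j"] j(3) show False by simp
  qed
  obtain c1 where c1: "c1 \<in> max_atlas M" "w \<in> fst c1" "fst c1 \<subseteq> fst c"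
    "\<And>x. x \<in> fst c1 \<Longrightarrow> snd c1 x = replace_coord j (F r \<circ> chart_inv c) (snd c x)"
    using max_atlas_replace[OF M c(1,2,3) F[OF r] j(1,2)] by metis
  \<comment> \<open>The new function sits at position \<open>j\<close> and is moved next to the
    earlier ones, so that the functions fill the coordinates from the last one downwards.\<close>
  let ?c = "(fst c1, \<lambda>x. swap_coords j (?n - 1 - r) (snd c1 x))"
  have "?c \<in> max_atlas M" using jr by (intro max_atlas_swap[OF M c1(1) j(1)]) simp
  moreover have "snd ?c x (?n - 1 - s) = F s x" if x: "x \<in> fst ?c" and s: "s < Suc r" for x s
  proof (cases "s = r")
    case True
    have "chart_inv c (snd c x) = x" by (rule chart_inv_apply[OF ch]) (use x c1(3) in auto)
    then show ?thesis using True c1(4)[of x] x by (simp add: swap_coords_def replace_coord_apply)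
  next
    case False
    with s have "s < r" by simp
    then have "?n - 1 - s \<noteq> j" "?n - 1 - s \<noteq> ?n - 1 - r" using jr by auto
    then have "snd ?c x (?n - 1 - s) = snd c x (?n - 1 - s)"
      using c1(4)[of x] x by (simp add: swap_coords_def replace_coord_apply)
    also have "\<dots> = F s x" using x c1(3) \<open>s < r\<close> by (intro Fc) auto
    finally show ?thesis .
  qed
  ultimately show ?case
    using c1(2,3) c(3) jr by (intro conjI bexI[of _ ?c]) auto
qed

section \<open>Differentials on products and slice charts of fibre products\<close>

lemma cdiff_arg_cong: "(\<And>j. j < n \<Longrightarrow> u j = v j) \<Longrightarrow> cdiff n c F x u = cdiff n c F x v"
  by (simp add: cdiff_def)

text \<open>The coordinates of the first factor have differentials \<open>w j\<close>, so the chain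
  rule returns the differential in \<open>c\<close>. The vector \<open>w\<close> can stay
  untruncated, as only its first \<open>mdim M\<close> entries are read there.\<close>

lemma cdiff_fst:
  assumes c: "is_chart M c" and c': "is_chart N c'" and A: "openin (mtop M) A" "A \<subseteq> fst c"
    and F: "chart_smooth (mdim M) c A F" and x: "x \<in> A" and y: "y \<in> fst c'"
  shows "cdiff (mdim (prod_mfd M N)) (prod_chart (mdim M) c c') (\<lambda>z. F (fst z)) (x, y) w = cdiff (mdim M) c F x w"
proof -
  let ?C = "prod_chart (mdim M) c c'" and ?d = "mdim (prod_mfd M N)"
  note ch = is_chart_prod[OF c c']
  have op: "openin (mtop (prod_mfd M N)) (A \<times> fst c')" "A \<times> fst c' \<subseteq> fst c \<times> fst c'"
    using A is_chart_openin[OF c'] by (auto simp: openin_prod_Times_iff)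
  have sub: "A \<times> fst c' \<subseteq> fst ?C" "fst ` (A \<times> fst c') \<subseteq> A" "(x, y) \<in> A \<times> fst c'"
    using A x y by (auto simp: prod_chart_eq)
  have "cdiff ?d ?C (\<lambda>z. snd c (fst z) j) (x, y) w = w j" if "j < mdim M" for j
  proof -
    have "cdiff ?d ?C (\<lambda>z. snd c (fst z) j) (x, y) w = cdiff ?d ?C (\<lambda>z. snd ?C z j) (x, y) w"
      by (rule cdiff_cong[OF ch op(1) sub(1,3)]) (simp add: prod_chart_eq join_def that)
    also have "\<dots> = w j"
      by (rule cdiff_coord[OF ch subsetD[OF sub(1,3)]]) (use that in simp)
    finally show ?thesis .
  qed
  then show ?thesis
    unfolding cdiff_chain[OF ch c op(1) sub(1) A sub(2) chart_smooth_prod_coord(1)[OF c c' op] F sub(3)] fst_conv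
    by (rule cdiff_arg_cong)
qed

lemma cdiff_snd:
  assumes c: "is_chart M c" and c': "is_chart N c'" and A: "openin (mtop N) A" "A \<subseteq> fst c'"
    and F: "chart_smooth (mdim N) c' A F" and x: "x \<in> fst c" and y: "y \<in> A"
  shows "cdiff (mdim (prod_mfd M N)) (prod_chart (mdim M) c c') (\<lambda>z. F (snd z)) (x, y) w =
    cdiff (mdim N) c' F y (shift (mdim M) w)"
proof -
  let ?C = "prod_chart (mdim M) c c'" and ?d = "mdim (prod_mfd M N)"
  note ch = is_chart_prod[OF c c']
  have op: "openin (mtop (prod_mfd M N)) (fst c \<times> A)" "fst c \<times> A \<subseteq> fst c \<times> fst c'"
    using A is_chart_openin[OF c] by (auto simp: openin_prod_Times_iff)
  have sub: "fst c \<times> A \<subseteq> fst ?C" "snd ` (fst c \<times> A) \<subseteq> A" "(x, y) \<in> fst c \<times> A"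
    using A x y by (auto simp: prod_chart_eq)
  have "cdiff ?d ?C (\<lambda>z. snd c' (snd z) j) (x, y) w = shift (mdim M) w j" if "j < mdim N" for j
  proof -
    have "cdiff ?d ?C (\<lambda>z. snd c' (snd z) j) (x, y) w = cdiff ?d ?C (\<lambda>z. snd ?C z (j + mdim M)) (x, y) w"
      by (rule cdiff_cong[OF ch op(1) sub(1,3)]) (simp add: prod_chart_eq join_def)
    also have "\<dots> = w (j + mdim M)"
      by (rule cdiff_coord[OF ch subsetD[OF sub(1,3)]]) (use that in simp)
    finally show ?thesis by (simp add: shift_def)
  qed
  then show ?thesis
    unfolding cdiff_chain[OF ch c' op(1) sub(1) A sub(2) chart_smooth_prod_coord(2)[OF c c' op] F sub(3)] snd_conv
    by (rule cdiff_arg_cong)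
qed

definition transverse_at :: "'a mfd \<Rightarrow> 'b mfd \<Rightarrow> 'c mfd \<Rightarrow> ('a \<Rightarrow> 'c) \<Rightarrow> ('b \<Rightarrow> 'c) \<Rightarrow> 'a \<Rightarrow> 'b \<Rightarrow> bool" where
  "transverse_at M N P g h x y \<longleftrightarrow>
    (\<lambda>(u, v) c i. tangent_map M P g x u c i + tangent_map N P h y v c i) `
      (tangent_space M x \<times> tangent_space N y) = tangent_space P (g x)"

text \<open>In a chart \<open>cz\<close> around the common value, the fibre product is the zero set
  of \<open>F = G - H\<close>. Surjectivity of the sum of the tangent maps gives the differential of
  \<open>F\<close> a right inverse, with columns \<open>V r\<close>, and \<open>straighten\<close>
  turns the \<open>F s\<close> into coordinates. The number of equations is thereby bounded by
  \<open>mdim M + mdim N\<close>.\<close>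

lemma fibre_product_slice:
  assumes M: "smooth_manifold M" and N: "smooth_manifold N" and P: "smooth_manifold P"
    and g: "smooth_map M P g" and h: "smooth_map N P h"
    and x: "x \<in> topspace (mtop M)" and y: "y \<in> topspace (mtop N)" and gh: "g x = h y"
    and tv: "transverse_at M N P g h x y"
  shows "mdim P \<le> mdim M + mdim N \<and> (\<exists>c. slice_chart (prod_mfd M N)
    {(x, y). x \<in> topspace (mtop M) \<and> y \<in> topspace (mtop N) \<and> g x = h y}
    (mdim M + mdim N - mdim P) c \<and> (x, y) \<in> fst c)"
proof -
  let ?m = "mdim M" and ?n = "mdim N" and ?k = "mdim P"
  let ?Q = "prod_mfd M N"
  note QM = smooth_manifold_prod[OF M N]
  have cg: "continuous_map (mtop M) (mtop P) g" and chh: "continuous_map (mtop N) (mtop P) h"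
    using g h by (simp_all add: smooth_map_def)
  have gx: "g x \<in> topspace (mtop P)" using cg x continuous_map_image_subset_topspace by blast
  then obtain cz where cz: "cz \<in> atlas P" "g x \<in> fst cz" "cz \<in> max_atlas P" by (rule atlas_cover[OF P])
  note chz = max_atlas_is_chart[OF cz(3)]
  define A where "A = topspace (mtop M) \<inter> g -` fst cz"
  define B where "B = topspace (mtop N) \<inter> h -` fst cz"
  have A: "openin (mtop M) A" "x \<in> A"
    using openin_continuous_map_preimage[OF cg is_chart_openin[OF chz]] x cz(2) by (auto simp: A_def vimage_def Int_def)
  have B: "openin (mtop N) B" "y \<in> B"
    using openin_continuous_map_preimage[OF chh is_chart_openin[OF chz]] y cz(2) gh by (auto simp: B_def vimage_def Int_def)
  have AB: "openin (mtop ?Q) (A \<times> B)" using A B by (simp add: openin_prod_Times_iff)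
  define G where "G s z = snd cz (g (fst z)) s" for s and z :: "'a \<times> 'b"
  define H where "H s z = snd cz (h (snd z)) s" for s and z :: "'a \<times> 'b"
  define F where "F s z = G s z - H s z" for s and z :: "'a \<times> 'b"
  have gs: "smooth_fun M A (\<lambda>x. snd cz (g x) s)" for s
    using g cz(1) unfolding smooth_map_iff[OF M P] A_def by blast
  have hs: "smooth_fun N B (\<lambda>x. snd cz (h x) s)" for s
    using h cz(1) unfolding smooth_map_iff[OF N P] B_def by blast
  have G: "smooth_fun ?Q (A \<times> B) (G s)" for s
    unfolding G_def by (rule smooth_fun_mono[OF smooth_fun_fst[OF M N A(1) gs]]) (use openin_subset[OF B(1)] in auto)
  have H: "smooth_fun ?Q (A \<times> B) (H s)" for s
    unfolding H_def by (rule smooth_fun_mono[OF smooth_fun_snd[OF M N B(1) hs]]) (use openin_subset[OF A(1)] in auto)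
  have F: "smooth_fun ?Q (A \<times> B) (F s)" for s
    unfolding F_def by (rule smooth_fun_diff[OF AB G H])
  \<comment> \<open>The same choice as in \<open>tangent_map\<close>, so that its values can be read
    off in these charts.\<close>
  define cx where "cx = (SOME c. c \<in> charts_at M x)"
  define cy where "cy = (SOME c. c \<in> charts_at N y)"
  have cx: "cx \<in> charts_at M x" unfolding cx_def by (rule some_charts_at[OF M x])
  have cy: "cy \<in> charts_at N y" unfolding cy_def by (rule some_charts_at[OF N y])
  have cx': "cx \<in> atlas M" "x \<in> fst cx" "is_chart M cx" using cx charts_atD[OF M cx] by (auto simp: charts_at_def)
  have cy': "cy \<in> atlas N" "y \<in> fst cy" "is_chart N cy" using cy charts_atD[OF N cy] by (auto simp: charts_at_def)
  have opx: "openin (mtop M) (fst cx \<inter> A)" and opy: "openin (mtop N) (fst cy \<inter> B)"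
    using is_chart_openin[OF cx'(3)] is_chart_openin[OF cy'(3)] A(1) B(1) by (auto intro: openin_Int)
  define c0 where "c0 = prod_chart ?m cx cy"
  have c0: "c0 \<in> max_atlas ?Q" "(x, y) \<in> fst c0"
    using prod_chart_max_atlas[OF M N cx'(1) cy'(1)] cx'(2) cy'(2) by (simp_all add: c0_def prod_chart_eq)
  have cz': "cz \<in> charts_at P (g x)" using cz by (simp add: charts_at_def)
  have "\<exists>V. \<forall>s<?k. cdiff (mdim ?Q) c0 (F s) (x, y) V = (if s = r then 1 else 0)" if r: "r < ?k" for r
  proof -
    \<comment> \<open>The \<open>r\<close>-th unit vector at the common image point, to be split by
      transversality.\<close>
    have "(\<lambda>i. if i = r then 1 else 0) \<in> R_pow ?k" using r by auto
    then obtain t where t: "t \<in> tangent_space P (g x)" "t cz = (\<lambda>i. if i = r then 1 else 0)"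
      by (rule tangent_vector_exists[OF P cz'])
    have "t \<in> (\<lambda>(u, v) c i. tangent_map M P g x u c i + tangent_map N P h y v c i) `
        (tangent_space M x \<times> tangent_space N y)"
      using t(1) tv unfolding transverse_at_def by (simp only:)
    then obtain p where p: "t = (\<lambda>(u, v) c i. tangent_map M P g x u c i + tangent_map N P h y v c i) p"
      by (rule imageE)
    define u where "u = fst p"
    define v where "v = snd p"
    have te: "t = (\<lambda>c i. tangent_map M P g x u c i + tangent_map N P h y v c i)"
      unfolding p u_def v_def by (simp only: split_beta)
    \<comment> \<open>The sign compensates that of \<open>H\<close> in \<open>F\<close>, so that the
      differential of \<open>F\<close> becomes the sum in \<open>transverse_at\<close>; writing
      \<open>0 - v cy i\<close> fits \<open>cdiff_minus_arg\<close>.\<close>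
    define V where "V = join ?m (u cx) (\<lambda>i. 0 - v cy i)"
    have "cdiff (mdim ?Q) c0 (F s) (x, y) V = (if s = r then 1 else 0)" for s
    proof -
      have "cdiff (mdim ?Q) c0 (F s) (x, y) V = cdiff (mdim ?Q) c0 (G s) (x, y) V - cdiff (mdim ?Q) c0 (H s) (x, y) V"
        unfolding F_def
      proof (rule cdiff_diff[OF max_atlas_is_chart[OF c0(1)]])
        show "openin (mtop ?Q) (fst c0 \<inter> A \<times> B)"
          using is_chart_openin[OF max_atlas_is_chart[OF c0(1)]] AB by (rule openin_Int)
        show "chart_smooth (mdim ?Q) c0 (fst c0 \<inter> A \<times> B) (G s)" by (rule smooth_funD[OF G c0(1)])
        show "chart_smooth (mdim ?Q) c0 (fst c0 \<inter> A \<times> B) (H s)" by (rule smooth_funD[OF H c0(1)])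
      qed (use A(2) B(2) c0(2) in auto)
      also have "cdiff (mdim ?Q) c0 (G s) (x, y) V = cdiff ?m cx (\<lambda>x. snd cz (g x) s) x V"
        unfolding c0_def G_def
        by (rule cdiff_fst[OF cx'(3) cy'(3) opx Int_lower1 smooth_funD[OF gs] _ cy'(2)])
          (use charts_atD[OF M cx] A(2) in auto)
      also have "\<dots> = cdiff ?m cx (\<lambda>x. snd cz (g x) s) x (u cx)"
        by (rule cdiff_arg_cong) (simp add: V_def join_def)
      also have "\<dots> = tangent_map M P g x u cz s"
        by (rule tangent_map_eq_cdiff[where f = g and x = x, OF cz' cx_def, symmetric])
      also have "cdiff (mdim ?Q) c0 (H s) (x, y) V = cdiff ?n cy (\<lambda>x. snd cz (h x) s) y (shift ?m V)"
        unfolding c0_def H_def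
        by (rule cdiff_snd[OF cx'(3) cy'(3) opy Int_lower1 smooth_funD[OF hs] cx'(2)])
          (use charts_atD[OF N cy] B(2) in auto)
      also have "\<dots> = cdiff ?n cy (\<lambda>x. snd cz (h x) s) y (\<lambda>i. 0) - cdiff ?n cy (\<lambda>x. snd cz (h x) s) y (v cy)"
        unfolding V_def shift_join by (rule cdiff_minus_arg)
      also have "\<dots> = - tangent_map N P h y v cz s"
        using tangent_map_eq_cdiff[where f = h and x = y and v = v and i = s, OF cz'[unfolded gh] cy_def] by (simp add: cdiff_zero_coord)
      also have "tangent_map M P g x u cz s - - tangent_map N P h y v cz s = t cz s"
        unfolding te by simp
      finally show ?thesis using t(2) by simp
    qed
    then show ?thesis by blast
  qed
  then obtain V where V: "\<And>s r. s < ?k \<Longrightarrow> r < ?k \<Longrightarrow>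
      cdiff (mdim ?Q) c0 (F s) (x, y) (V r) = (if s = r then 1 else 0)"
    by metis
  have wAB: "(x, y) \<in> A \<times> B" using A(2) B(2) by simp
  from straighten[OF QM c0 AB wAB F V order_refl]
  obtain c where kn: "?k \<le> mdim ?Q" and c: "c \<in> max_atlas ?Q" "(x, y) \<in> fst c" "fst c \<subseteq> A \<times> B"
    "\<And>z s. z \<in> fst c \<Longrightarrow> s < ?k \<Longrightarrow> snd c z (mdim ?Q - 1 - s) = F s z"
    by blast
  have "slice_chart ?Q {(x, y). x \<in> topspace (mtop M) \<and> y \<in> topspace (mtop N) \<and> g x = h y} (?m + ?n - ?k) c"
  proof (rule slice_chartI[OF c(1)])
    show "?m + ?n - ?k \<le> mdim ?Q" by simp
    fix z assume z: "z \<in> fst c"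
    obtain a b where ab: "z = (a, b)" by (cases z)
    have a: "a \<in> topspace (mtop M)" "b \<in> topspace (mtop N)" "g a \<in> fst cz" "h b \<in> fst cz"
      using z c(3) ab by (auto simp: A_def B_def)
    \<comment> \<open>The last \<open>mdim P\<close> coordinates are the functions
      \<open>F s\<close> in reverse order.\<close>
    have "(\<forall>i\<in>{?m + ?n - ?k..<mdim ?Q}. snd c z i = 0) \<longleftrightarrow> (\<forall>s<?k. F s z = 0)"
    proof
      assume *: "\<forall>i\<in>{?m + ?n - ?k..<mdim ?Q}. snd c z i = 0"
      show "\<forall>s<?k. F s z = 0"
      proof (intro allI impI)
        fix s assume s: "s < ?k"
        then have "mdim ?Q - 1 - s \<in> {?m + ?n - ?k..<mdim ?Q}" using kn by auto
        with * c(4)[OF z s] show "F s z = 0" by simp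
      qed
    next
      assume *: "\<forall>s<?k. F s z = 0"
      show "\<forall>i\<in>{?m + ?n - ?k..<mdim ?Q}. snd c z i = 0"
      proof
        fix i assume i: "i \<in> {?m + ?n - ?k..<mdim ?Q}"
        then have "mdim ?Q - 1 - i < ?k" "mdim ?Q - 1 - (mdim ?Q - 1 - i) = i" by auto
        with * c(4)[OF z, of "mdim ?Q - 1 - i"] show "snd c z i = 0" by simp
      qed
    qed
    also have "\<dots> \<longleftrightarrow> snd cz (g a) = snd cz (h b)"
    proof
      assume *: "\<forall>s<?k. F s z = 0"
      \<comment> \<open>Coordinates from \<open>mdim P\<close> on vanish on both sides, so the
        finitely many \<open>F s\<close> detect equality in the chart.\<close>
      have "snd cz (g a) s = snd cz (h b) s" for s
      proof (cases "s < ?k")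
        case True
        then show ?thesis using * by (simp add: F_def G_def H_def ab)
      next
        case False
        then show ?thesis using is_chart_R_pow[OF chz a(3)] is_chart_R_pow[OF chz a(4)] by simp
      qed
      then show "snd cz (g a) = snd cz (h b)" by (rule ext)
    qed (simp add: F_def G_def H_def ab)
    also have "\<dots> \<longleftrightarrow> g a = h b"
      using inj_on_eq_iff[OF is_chart_inj[OF chz] a(3,4)] .
    finally show "z \<in> {(x, y). x \<in> topspace (mtop M) \<and> y \<in> topspace (mtop N) \<and> g x = h y} \<longleftrightarrow>
        (\<forall>i\<in>{?m + ?n - ?k..<mdim ?Q}. snd c z i = 0)"
      using a(1,2) ab by simp
  qed
  with kn c(2) show ?thesis unfolding prod_mfd_simps by blast
qed

text \<open>The open set of a local embedding lives in the whole s-manifold and need not be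
  contained in a stratum; cutting it with the stratum gives an open subset of the latter with the
  same structure.\<close>

lemma open_submfd_restrict:
  assumes M: "smooth_manifold M"
  shows "open_submfd M U = open_submfd M (topspace (mtop M) \<inter> U)"
proof -
  have "(\<lambda>c. (fst c \<inter> U, snd c)) ` atlas M = (\<lambda>c. (fst c \<inter> (topspace (mtop M) \<inter> U), snd c)) ` atlas M"
  proof (rule image_cong[OF refl])
    fix c assume "c \<in> atlas M"
    then have "fst c \<subseteq> topspace (mtop M)" using is_chart_subset[OF atlas_is_chart[OF M]] by blast
    then have "fst c \<inter> U = fst c \<inter> (topspace (mtop M) \<inter> U)" by blast
    then show "(fst c \<inter> U, snd c) = (fst c \<inter> (topspace (mtop M) \<inter> U), snd c)" by simp
  qed
  moreover have "subtopology (mtop M) U = subtopology (mtop M) (topspace (mtop M) \<inter> U)"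
    by (simp add: subtopology_restrict)
  ultimately show ?thesis
    unfolding open_submfd_def Setcompr_eq_image by simp
qed

section \<open>Local embeddings of fibre products\<close>

lemma smooth_fun_open_submfd_iff:
  assumes M: "smooth_manifold M" and U: "openin (mtop M) U"
  shows "smooth_fun (open_submfd M U) U F \<longleftrightarrow> smooth_fun M U F"
proof -
  let ?O = "open_submfd M U"
  note OM = smooth_manifold_open_submfd[OF M U]
  have op: "openin (mtop ?O) A \<longleftrightarrow> openin (mtop M) A \<and> A \<subseteq> U" for A
    using U by (simp add: openin_open_subtopology)
  have opc: "openin (mtop M) (fst c \<inter> U)" if "c \<in> atlas M" for c
    using is_chart_openin[OF atlas_is_chart[OF M that]] U by (rule openin_Int)
  have cO: "(fst c \<inter> U, snd c) \<in> max_atlas ?O" if "c \<in> atlas M" for c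
    using atlas_subset_max_atlas[OF OM] that unfolding open_submfd_simps by blast
  have iff: "chart_smooth (mdim M) (fst c \<inter> U, snd c) (fst c \<inter> U) F \<longleftrightarrow> chart_smooth (mdim M) c (fst c \<inter> U) F"
    if "c \<in> atlas M" for c
    by (rule chart_smooth_open_submfd[OF atlas_is_chart[OF M that] opc[OF that]]) auto
  show ?thesis
  proof
    assume F: "smooth_fun ?O U F"
    show "smooth_fun M U F"
    proof (rule smooth_funI[OF M U])
      fix x assume x: "x \<in> U"
      then have "x \<in> topspace (mtop M)" using openin_subset[OF U] by blast
      then obtain c where c: "c \<in> atlas M" "x \<in> fst c" "c \<in> max_atlas M" by (rule atlas_cover[OF M])
      have "chart_smooth (mdim M) (fst c \<inter> U, snd c) (fst c \<inter> U) F"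
        using smooth_funD[OF F cO[OF c(1)]] by (simp add: Int_assoc)
      then show "\<exists>c\<in>max_atlas M. \<exists>B. openin (mtop M) B \<and> x \<in> B \<and> B \<subseteq> fst c \<and> chart_smooth (mdim M) c B F"
        unfolding iff[OF c(1)] using c x opc[OF c(1)] by (intro bexI[of _ c] exI[of _ "fst c \<inter> U"]) auto
    qed
  next
    assume F: "smooth_fun M U F"
    show "smooth_fun ?O U F"
    proof (rule smooth_funI[OF OM])
      show "openin (mtop ?O) U" unfolding op using U by simp
      fix x assume x: "x \<in> U"
      then have "x \<in> topspace (mtop M)" using openin_subset[OF U] by blast
      then obtain c where c: "c \<in> atlas M" "x \<in> fst c" "c \<in> max_atlas M" by (rule atlas_cover[OF M])
      have "chart_smooth (mdim M) (fst c \<inter> U, snd c) (fst c \<inter> U) F"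
        unfolding iff[OF c(1)] by (rule smooth_funD[OF F c(3)])
      moreover have "openin (mtop ?O) (fst c \<inter> U)" unfolding op using opc[OF c(1)] by simp
      ultimately show "\<exists>c\<in>max_atlas ?O. \<exists>B. openin (mtop ?O) B \<and> x \<in> B \<and> B \<subseteq> fst c \<and> chart_smooth (mdim ?O) c B F"
        using c(2) x by (intro bexI[OF _ cO[OF c(1)]] exI[of _ "fst c \<inter> U"]) auto
    qed
  qed
qed

lemma smooth_embedding_open_submfd_iff:
  assumes M: "smooth_manifold M" and U: "openin (mtop M) U"
  shows "smooth_embedding (open_submfd M U) (eucl_mfd N) f \<longleftrightarrow>
    embedding_map (subtopology (mtop M) U) (Euclidean_space N) f \<and>
    (\<forall>i. smooth_fun M U (\<lambda>y. f y i)) \<and> (\<forall>x\<in>U. \<forall>c\<in>charts_at M x. inj_diff (mdim M) c f x)"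
proof -
  let ?O = "open_submfd M U"
  have top: "topspace (mtop ?O) = U" using openin_subset[OF U] by auto
  have ch: "charts_at ?O x = (\<lambda>c. (fst c \<inter> U, snd c)) ` charts_at M x" if "x \<in> U" for x
    using that by (auto simp: charts_at_def)
  have "inj_diff (mdim M) (fst c \<inter> U, snd c) f x \<longleftrightarrow> inj_diff (mdim M) c f x"
    if x: "x \<in> U" and c: "c \<in> charts_at M x" for x c
  proof -
    have c': "is_chart M c" "x \<in> fst c" using charts_atD[OF M c] by auto
    have "openin (mtop M) (fst c \<inter> U)" using is_chart_openin[OF c'(1)] U by (rule openin_Int)
    then have "cdiff (mdim M) (fst c \<inter> U, snd c) F x w = cdiff (mdim M) c F x w" for F w
      using cdiff_restrict[of M "fst c" "snd c" "fst c \<inter> U" "fst c \<inter> U" x F w] c' x by simp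
    then show ?thesis by (simp add: inj_diff_def)
  qed
  then have "(\<forall>x\<in>U. \<forall>c\<in>charts_at ?O x. inj_diff (mdim ?O) c f x) \<longleftrightarrow>
      (\<forall>x\<in>U. \<forall>c\<in>charts_at M x. inj_diff (mdim M) c f x)"
    by (simp add: ch)
  then show ?thesis
    unfolding smooth_embedding_eucl_iff[OF smooth_manifold_open_submfd[OF M U]] top
      smooth_fun_open_submfd_iff[OF M U] by simp
qed

lemma embedding_map_subtopology:
  assumes "embedding_map X Y f"
  shows "embedding_map (subtopology X S) Y f"
proof -
  have "homeomorphic_map (subtopology X S)
      (subtopology (subtopology Y (f ` topspace X)) (f ` (topspace X \<inter> S))) f"
  proof (rule homeomorphic_map_subtopologies)
    show h: "homeomorphic_map X (subtopology Y (f ` topspace X)) f"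
      using assms by (simp add: embedding_map_def)
    have "f ` topspace X = topspace (subtopology Y (f ` topspace X))"
      using homeomorphic_imp_surjective_map[OF h] .
    then show "f ` (topspace X \<inter> S) = topspace (subtopology Y (f ` topspace X)) \<inter> f ` (topspace X \<inter> S)" by blast
  qed
  moreover have "f ` topspace X \<inter> f ` (topspace X \<inter> S) = f ` (topspace X \<inter> S)" by blast
  ultimately show ?thesis
    by (simp add: embedding_map_def subtopology_subtopology)
qed

text \<open>On the slice the differential is a restriction of the ambient one, so its kernel is no
  larger.\<close>

lemma inj_diff_slice:
  assumes c: "slice_chart P S d c" and d: "d \<le> mdim P" and x: "x \<in> fst c" "x \<in> S"
    and inj: "inj_diff (mdim P) c f x"
  shows "inj_diff d (fst c \<inter> S, snd c) f x"
  unfolding inj_diff_def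
proof (intro ballI impI)
  fix w assume w: "w \<in> R_pow d" and 0: "\<forall>i. cdiff d (fst c \<inter> S, snd c) (\<lambda>y. f y i) x w = 0"
  have w': "w \<in> R_pow (mdim P)" using w d by auto
  have "\<forall>i. cdiff (mdim P) c (\<lambda>y. f y i) x w = 0"
    using 0 unfolding cdiff_slice[OF c d x w] .
  with w' inj show "w = (\<lambda>i. 0)" unfolding inj_diff_def by blast
qed

text \<open>The differential is block diagonal: components below \<open>p\<close> see only the first
  factor's part of \<open>w\<close>, the others only the second's. Each part lies in a trivial
  kernel.\<close>

lemma inj_diff_join:
  assumes c: "is_chart M c" and c': "is_chart N c'"
    and U: "openin (mtop M) U" "U \<subseteq> fst c" "x \<in> U" and V: "openin (mtop N) V" "V \<subseteq> fst c'" "y \<in> V"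
    and sa: "\<And>i. chart_smooth (mdim M) c U (\<lambda>x. a x i)" and sb: "\<And>i. chart_smooth (mdim N) c' V (\<lambda>y. b y i)"
    and aR: "\<And>x. x \<in> U \<Longrightarrow> a x \<in> R_pow p"
    and a: "inj_diff (mdim M) c a x" and b: "inj_diff (mdim N) c' b y"
  shows "inj_diff (mdim (prod_mfd M N)) (prod_chart (mdim M) c c') (\<lambda>z. join p (a (fst z)) (b (snd z))) (x, y)"
  unfolding inj_diff_def
proof (intro ballI impI)
  let ?m = "mdim M" and ?n = "mdim N" and ?d = "mdim (prod_mfd M N)"
  fix w assume w: "w \<in> R_pow ?d"
    and 0: "\<forall>i. cdiff ?d (prod_chart ?m c c') (\<lambda>z. join p (a (fst z)) (b (snd z)) i) (x, y) w = 0"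
  have x: "x \<in> fst c" and y: "y \<in> fst c'" using U V by blast+
  have "cdiff ?m c (\<lambda>x. a x i) x (trunc ?m w) = 0" for i
  proof (cases "i < p")
    case True
    have "cdiff ?m c (\<lambda>x. a x i) x (trunc ?m w) = cdiff ?m c (\<lambda>x. a x i) x w"
      by (rule cdiff_arg_cong) (simp add: trunc_def)
    also have "\<dots> = cdiff ?d (prod_chart ?m c c') (\<lambda>z. a (fst z) i) (x, y) w"
      by (rule cdiff_fst[OF c c' U(1,2) sa U(3) y, symmetric])
    also have "\<dots> = 0" using 0[rule_format, of i] True by (simp add: join_def)
    finally show ?thesis .
  next
    \<comment> \<open>These components of \<open>a\<close> do not occur in the join, but by
      \<open>aR\<close> they are constantly 0.\<close>
    case False
    have "cdiff ?m c (\<lambda>x. a x i) x (trunc ?m w) = cdiff ?m c (\<lambda>x. 0) x (trunc ?m w)"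
      by (rule cdiff_cong[OF c U]) (use aR False in simp)
    also have "\<dots> = 0" by (simp add: cdiff_def partial_deriv_def o_def)
    finally show ?thesis .
  qed
  moreover have "trunc ?m w \<in> R_pow ?m" by (simp add: trunc_def)
  ultimately have 1: "trunc ?m w = (\<lambda>i. 0)" using a unfolding inj_diff_def by blast
  have "cdiff ?n c' (\<lambda>y. b y i) y (shift ?m w) = 0" for i
  proof -
    have "cdiff ?n c' (\<lambda>y. b y i) y (shift ?m w) = cdiff ?d (prod_chart ?m c c') (\<lambda>z. b (snd z) i) (x, y) w"
      by (rule cdiff_snd[OF c c' V(1,2) sb x V(3), symmetric])
    also have "\<dots> = 0" using 0[rule_format, of "i + p"] by (simp add: join_def)
    finally show ?thesis .
  qed
  moreover have "shift ?m w \<in> R_pow ?n" using w by (simp add: shift_def)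
  ultimately have 2: "shift ?m w = (\<lambda>i. 0)" using b unfolding inj_diff_def by blast
  have "w = join ?m (\<lambda>i. 0) (\<lambda>i. 0)" using join_trunc_shift[of ?m w] unfolding 1 2 by simp
  then show "w = (\<lambda>i. 0)" by (simp add: join_def)
qed

lemma smooth_fun_join:
  assumes "smooth_fun M A (\<lambda>z. a z i)" "smooth_fun M A (\<lambda>z. b z (i - p))"
  shows "smooth_fun M A (\<lambda>z. join p (a z) (b z) i)"
  using assms by (cases "i < p") (simp_all add: join_def)

text \<open>The topological embedding and smoothness restrict from the product to \<open>S\<close>.
  Injectivity of the differential is checked in a product chart, where it splits into the two
  factors, then carried to a slice chart and restricted to the slice.\<close>

lemma smooth_embedding_fibre:
  fixes S :: "('a \<times> 'b) set"
  assumes M: "smooth_manifold M" and N: "smooth_manifold N"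
    and d: "d \<le> mdim M + mdim N" and S: "S \<subseteq> topspace (mtop (prod_mfd M N))"
    and cover: "\<And>x. x \<in> S \<Longrightarrow> \<exists>c. slice_chart (prod_mfd M N) S d c \<and> x \<in> fst c"
    and U: "openin (mtop M) U" and V: "openin (mtop N) V"
    and a: "smooth_embedding (open_submfd M U) (eucl_mfd p) a"
    and b: "smooth_embedding (open_submfd N V) (eucl_mfd q) b"
  shows "smooth_embedding (open_submfd (embedded_submfd (prod_mfd M N) S d) (S \<inter> U \<times> V)) (eucl_mfd (p + q))
    (\<lambda>z. join p (a (fst z)) (b (snd z)))"
proof -
  let ?P = "prod_mfd M N"
  let ?Q = "embedded_submfd ?P S d"
  let ?f = "\<lambda>z. join p (a (fst z)) (b (snd z))"
  note PM = smooth_manifold_prod[OF M N]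
  have d': "d \<le> mdim ?P" using d by simp
  have QM: "smooth_manifold ?Q" by (rule smooth_manifold_embedded[OF PM d' S cover])
  have UV: "openin (mtop ?P) (U \<times> V)" using U V by (simp add: openin_prod_Times_iff)
  have W: "openin (mtop ?Q) (S \<inter> U \<times> V)"
    using UV by (auto simp: openin_subtopology)
  note a' = a[unfolded smooth_embedding_open_submfd_iff[OF M U]]
  note b' = b[unfolded smooth_embedding_open_submfd_iff[OF N V]]
  have top: "topspace (subtopology (mtop M) U) = U" using openin_subset[OF U] by auto
  have "continuous_map (subtopology (mtop M) U) (Euclidean_space p) a"
    using homeomorphic_imp_continuous_map[OF conjunct1[OF a', unfolded embedding_map_def]]
    by (simp add: continuous_map_in_subtopology)
  then have aR: "a x \<in> R_pow p" if "x \<in> U" for x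
    using that unfolding continuous_map_Euclidean_space_componentwise top by blast
  have sa: "smooth_fun ?P (U \<times> V) (\<lambda>z. a (fst z) i)" for i
    using a' openin_subset[OF V] by (intro smooth_fun_mono[OF smooth_fun_fst[OF M N U]]) auto
  have sb: "smooth_fun ?P (U \<times> V) (\<lambda>z. b (snd z) i)" for i
    using b' openin_subset[OF U] by (intro smooth_fun_mono[OF smooth_fun_snd[OF M N V]]) auto
  have sf: "smooth_fun ?P (U \<times> V) (\<lambda>z. ?f z i)" for i
    by (rule smooth_fun_join[OF sa sb])
  show ?thesis
    unfolding smooth_embedding_open_submfd_iff[OF QM W]
  proof (intro conjI allI ballI)
    have "embedding_map (prod_topology (subtopology (mtop M) U) (subtopology (mtop N) V)) (Euclidean_space (p + q)) ?f"
      using embedding_map_join a' b' by blast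
    then have "embedding_map (subtopology (subtopology (prod_topology (mtop M) (mtop N)) (U \<times> V)) S) (Euclidean_space (p + q)) ?f"
      unfolding subtopology_Times by (rule embedding_map_subtopology)
    then show "embedding_map (subtopology (mtop ?Q) (S \<inter> U \<times> V)) (Euclidean_space (p + q)) ?f"
      by (simp add: subtopology_subtopology Int_commute Int_left_absorb)
    show "smooth_fun ?Q (S \<inter> U \<times> V) (\<lambda>z. ?f z i)" for i
      using smooth_fun_embedded[OF PM d' S cover UV sf] by (simp add: Int_commute)
    fix z e assume z: "z \<in> S \<inter> U \<times> V" and "e \<in> charts_at ?Q z"
    then obtain c where c: "slice_chart ?P S d c" "z \<in> fst c" and e: "e = (fst c \<inter> S, snd c)"
      by (auto simp: charts_at_def)
    obtain x y where xy: "z = (x, y)" by (cases z)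
    have xU: "x \<in> U" and yV: "y \<in> V" and zS: "z \<in> S" using z xy by auto
    have "x \<in> topspace (mtop M)" "y \<in> topspace (mtop N)"
      using xU yV openin_subset[OF U] openin_subset[OF V] by blast+
    then obtain cx cy where cx: "cx \<in> atlas M" "x \<in> fst cx" "cx \<in> max_atlas M"
      and cy: "cy \<in> atlas N" "y \<in> fst cy" "cy \<in> max_atlas N"
      using atlas_cover[OF M] atlas_cover[OF N] by metis
    note chx = max_atlas_is_chart[OF cx(3)] and chy = max_atlas_is_chart[OF cy(3)]
    have "inj_diff (mdim ?P) (prod_chart (mdim M) cx cy) ?f (x, y)"
    proof (rule inj_diff_join[OF chx chy])
      show "openin (mtop M) (fst cx \<inter> U)" "openin (mtop N) (fst cy \<inter> V)"
        by (rule openin_Int[OF is_chart_openin[OF chx] U] openin_Int[OF is_chart_openin[OF chy] V])+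
      show "chart_smooth (mdim M) cx (fst cx \<inter> U) (\<lambda>x. a x i)" "chart_smooth (mdim N) cy (fst cy \<inter> V) (\<lambda>y. b y i)" for i
        using a' b' smooth_funD[OF _ cx(3)] smooth_funD[OF _ cy(3)] by blast+
      have "cx \<in> charts_at M x" "cy \<in> charts_at N y" using cx cy by (simp_all add: charts_at_def)
      then show "inj_diff (mdim M) cx a x" "inj_diff (mdim N) cy b y" using a' b' xU yV by blast+
      show "a x \<in> R_pow p" if "x \<in> fst cx \<inter> U" for x using aR that by blast
    qed (use cx(2) cy(2) xU yV in auto)
    then have "inj_diff (mdim ?P) c ?f z"
      unfolding xy using inj_diff_change[OF PM prod_chart_max_atlas[OF M N cx(1) cy(1)] _
          slice_chart_max_atlas[OF c(1)] c(2)[unfolded xy] UV _ sf] cx(2) cy(2) xU yV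
      by (simp add: prod_chart_eq)
    from inj_diff_slice[OF c(1) d' c(2) zS this]
    show "inj_diff (mdim ?Q) e ?f z" unfolding e embedded_submfd_simps .
  qed
qed

section \<open>Fibre products of s-manifolds\<close>

lemma s_manifold_stratum:
  assumes "s_manifold n X" "i \<in> sidx X"
  shows "stratum X i \<noteq> {}" "smooth_manifold (stratum_mfd X i)" "int (sdim X i) \<le> n"
    "stratum X i \<subseteq> topspace (stop X)"
  using assms unfolding s_manifold_def by blast+

lemma s_manifold_stratum_unique:
  assumes "s_manifold n X" "i \<in> sidx X" "j \<in> sidx X" "x \<in> stratum X i" "x \<in> stratum X j"
  shows "i = j"
  using assms unfolding s_manifold_def disjoint_family_on_def by blast

lemma s_manifold_stratum_exists:
  assumes "s_manifold n X" "x \<in> topspace (stop X)"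
  obtains i where "i \<in> sidx X" "x \<in> stratum X i"
  using assms unfolding s_manifold_def by blast

lemma stratum_at_eq:
  assumes "s_manifold n X" "i \<in> sidx X" "x \<in> stratum X i"
  shows "stratum_at X x = i"
  unfolding stratum_at_def
  by (rule the_equality) (use assms s_manifold_stratum_unique[OF assms(1)] in blast)+

lemma stratum_mfd_simps [simp]:
  "mtop (stratum_mfd X i) = subtopology (stop X) (stratum X i)" "mdim (stratum_mfd X i) = sdim X i"
  "atlas (stratum_mfd X i) = satlas X i"
  by (simp_all add: stratum_mfd_def)

lemma s_smooth_stratum:
  assumes "s_smooth X Y f" "i \<in> sidx X"
  obtains j where "j \<in> sidx Y" "f ` stratum X i \<subseteq> stratum Y j"
  using assms unfolding s_smooth_def by blast

lemma s_smooth_smooth_map: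
  assumes "s_smooth X Y f" "i \<in> sidx X" "j \<in> sidx Y" "f ` stratum X i \<subseteq> stratum Y j"
  shows "smooth_map (stratum_mfd X i) (stratum_mfd Y j) f"
  using assms unfolding s_smooth_def by blast

definition transverse_dims :: "int \<Rightarrow> int \<Rightarrow> int \<Rightarrow> int \<Rightarrow> int \<Rightarrow> int \<Rightarrow> bool" where
  "transverse_dims l m n a b c \<longleftrightarrow> (a, b, c) = (l, m, n) \<or> (a, b, c) = (l - 1, m, n) \<or> (a, b, c) = (l, m - 1, n) \<or>
    (a, b, c) = (l - 1, m - 1, n - 1) \<or> a + b - c \<le> l + m - n - 2"

text \<open>If both values are at least \<open>l + m - n - 1\<close>, only the four explicit
  alternatives remain for the two triples, and a factor that changes drops from its top dimension by
  exactly one. If one factor is fixed, then \<open>c = c'\<close> and this is the drop; if both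
  change, the triples are \<open>(l, m, n)\<close> and \<open>(l - 1, m - 1, n - 1)\<close>. If the
  second value were large but the first not, the same drops would make the first larger than the
  second, where for two changing factors \<open>c \<le> n\<close> enters.\<close>

lemma transverse_dims_frontier:
  assumes "transverse_dims l m n a b c" "transverse_dims l m n a' b' c'" "a \<le> l" "b \<le> m" "c \<le> n"
    and "a = a' \<and> c = c' \<and> eqX \<or> \<not> eqX \<and> (a \<in> {l - 1, l} \<and> a' < a \<or> a \<le> l - 2 \<and> a' \<le> l - 2)"
    and "b = b' \<and> c = c' \<and> eqY \<or> \<not> eqY \<and> (b \<in> {m - 1, m} \<and> b' < b \<or> b \<le> m - 2 \<and> b' \<le> m - 2)"
    and "\<not> (eqX \<and> eqY)"
  shows "a + b - c \<in> {l + m - n - 1, l + m - n} \<and> a' + b' - c' < a + b - c \<or>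
    a + b - c \<le> l + m - n - 2 \<and> a' + b' - c' \<le> l + m - n - 2"
  using assms unfolding transverse_dims_def prod.inject insert_iff empty_iff by smt

definition local_strata :: "('a, 'i) smfd \<Rightarrow> 'a set \<Rightarrow> 'i set" where
  "local_strata X V = {i \<in> sidx X. V \<inter> stratum X i \<noteq> {}}"

text \<open>The condition at one neighbourhood with the order as a parameter, so that the orders of
  two factors can be combined.\<close>

definition frontier_order :: "int \<Rightarrow> ('a, 'i) smfd \<Rightarrow> 'a set \<Rightarrow> ('i \<times> 'i) set \<Rightarrow> bool" where
  "frontier_order n X V R \<longleftrightarrow> finite (local_strata X V) \<and> partial_order_on (local_strata X V) R \<and>
    (\<forall>i\<in>local_strata X V. subtopology (stop X) V closure_of (V \<inter> stratum X i)
      \<subseteq> (\<Union>j\<in>{j \<in> local_strata X V. (i, j) \<in> R}. V \<inter> stratum X j)) \<and>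
    (\<forall>i\<in>local_strata X V. \<forall>j\<in>local_strata X V. i \<noteq> j \<and> (i, j) \<in> R \<longrightarrow>
      int (sdim X i) \<in> {n - 1, n} \<and> sdim X j < sdim X i \<or>
      int (sdim X i) \<le> n - 2 \<and> int (sdim X j) \<le> n - 2)"

lemma sm_frontier_condition_iff:
  "sm_frontier_condition n X \<longleftrightarrow>
    (\<forall>x\<in>topspace (stop X). \<exists>V R. openin (stop X) V \<and> x \<in> V \<and> frontier_order n X V R)"
  unfolding sm_frontier_condition_def frontier_order_def local_strata_def Let_def by (simp only: ex_simps)

text \<open>Source strata are nonempty and target strata disjoint, so uniqueness of the target
  stratum comes for free.\<close>

lemma s_smoothI:
  assumes Y: "s_manifold n Y" and "continuous_map (stop X) (stop Y) f"
    and X: "\<And>i. i \<in> sidx X \<Longrightarrow> stratum X i \<noteq> {}"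
    and f: "\<And>i. i \<in> sidx X \<Longrightarrow> \<exists>j\<in>sidx Y. f ` stratum X i \<subseteq> stratum Y j \<and>
      smooth_map (stratum_mfd X i) (stratum_mfd Y j) f"
  shows "s_smooth X Y f"
  unfolding s_smooth_def
proof (intro conjI ballI)
  fix i assume i: "i \<in> sidx X"
  obtain j where j: "j \<in> sidx Y" "f ` stratum X i \<subseteq> stratum Y j" "smooth_map (stratum_mfd X i) (stratum_mfd Y j) f"
    using f[OF i] by blast
  have u: "j' = j" if "j' \<in> sidx Y" "f ` stratum X i \<subseteq> stratum Y j'" for j'
  proof -
    obtain x where "x \<in> stratum X i" using X[OF i] by blast
    then have "f x \<in> stratum Y j'" "f x \<in> stratum Y j" using that(2) j(2) by blast+
    then show ?thesis by (rule s_manifold_stratum_unique[OF Y that(1) j(1)])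
  qed
  show "\<exists>!j. j \<in> sidx Y \<and> f ` stratum X i \<subseteq> stratum Y j"
    by (rule ex1I[of _ j]) (use j u in blast)+
  fix j' assume j': "j' \<in> sidx Y"
  show "f ` stratum X i \<subseteq> stratum Y j' \<longrightarrow> smooth_map (stratum_mfd X i) (stratum_mfd Y j') f"
    using u[OF j'] j(3) by (metis (no_types, lifting))
qed (rule assms(2))

section \<open>The fibre product and its strata\<close>

context
  fixes X :: "('a, 'i) smfd" and Y :: "('b, 'j) smfd" and Z :: "('c, 'k) smfd"
    and g :: "'a \<Rightarrow> 'c" and h :: "'b \<Rightarrow> 'c" and l m n :: int
  assumes X: "s_manifold l X" and Y: "s_manifold m Y" and Z: "s_manifold n Z"
    and g: "s_smooth X Z g" and h: "s_smooth Y Z h" and trans: "s_transverse l m n X Y Z g h"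
begin

private abbreviation (input) "W \<equiv> s_fibre_product X Y Z g h"

private definition pts :: "('a \<times> 'b) set" where
  "pts = {(x, y). x \<in> topspace (stop X) \<and> y \<in> topspace (stop Y) \<and> g x = h y}"

private lemma W_simps:
  "stop W = subtopology (prod_topology (stop X) (stop Y)) pts"
  "stratum W (i, j, k) = pts \<inter> stratum X i \<times> stratum Y j"
  "sidx W = {(i, j, k). i \<in> sidx X \<and> j \<in> sidx Y \<and> k \<in> sidx Z \<and> g ` stratum X i \<subseteq> stratum Z k \<and>
    h ` stratum Y j \<subseteq> stratum Z k \<and> pts \<inter> stratum X i \<times> stratum Y j \<noteq> {}}"
  "sdim W (i, j, k) = sdim X i + sdim Y j - sdim Z k"
  "satlas W (i, j, k) = atlas (fibre_product_mfd (stratum_mfd X i) (stratum_mfd Y j) (stratum_mfd Z k) g h)"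
proof -
  have *: "{(x, y) \<in> pts. x \<in> stratum X i \<and> y \<in> stratum Y j} = pts \<inter> stratum X i \<times> stratum Y j" for i j
    by auto
  show "stop W = subtopology (prod_topology (stop X) (stop Y)) pts"
    "stratum W (i, j, k) = pts \<inter> stratum X i \<times> stratum Y j"
    "sidx W = {(i, j, k). i \<in> sidx X \<and> j \<in> sidx Y \<and> k \<in> sidx Z \<and> g ` stratum X i \<subseteq> stratum Z k \<and>
      h ` stratum Y j \<subseteq> stratum Z k \<and> pts \<inter> stratum X i \<times> stratum Y j \<noteq> {}}"
    "sdim W (i, j, k) = sdim X i + sdim Y j - sdim Z k"
    "satlas W (i, j, k) = atlas (fibre_product_mfd (stratum_mfd X i) (stratum_mfd Y j) (stratum_mfd Z k) g h)"
    unfolding s_fibre_product_def Let_def pts_def[symmetric] smfd.simps prod.case *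
    by (simp_all only: fibre_product_mfd_def embedded_submfd_simps stratum_mfd_simps)
qed

private lemma W_idx:
  assumes "(i, j, k) \<in> sidx W"
  shows "i \<in> sidx X" "j \<in> sidx Y" "k \<in> sidx Z" "g ` stratum X i \<subseteq> stratum Z k" "h ` stratum Y j \<subseteq> stratum Z k"
    "pts \<inter> stratum X i \<times> stratum Y j \<noteq> {}"
  using assms unfolding W_simps by blast+

private lemma pts_top: "pts \<subseteq> topspace (prod_topology (stop X) (stop Y))"
  by (auto simp: pts_def)

private lemma W_topspace: "topspace (stop W) = pts"
  unfolding W_simps using pts_top by auto

text \<open>The index \<open>k\<close> can be read off from the image of any point of the nonempty
  stratum of index \<open>i\<close>.\<close>

private lemma W_idx_unique:
  assumes "(i, j, k) \<in> sidx W" "(i, j, k') \<in> sidx W"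
  shows "k = k'"
proof -
  obtain x where "x \<in> stratum X i" using s_manifold_stratum(1)[OF X W_idx(1)[OF assms(1)]] by blast
  then have "g x \<in> stratum Z k" "g x \<in> stratum Z k'" using W_idx(4)[OF assms(1)] W_idx(4)[OF assms(2)] by blast+
  then show ?thesis using s_manifold_stratum_unique[OF Z] W_idx(3)[OF assms(1)] W_idx(3)[OF assms(2)] by blast
qed

text \<open>The strata of \<open>Z\<close> that receive the two given strata meet in
  \<open>g x = h y\<close>, hence coincide.\<close>

private lemma W_idx_exists:
  assumes xy: "(x, y) \<in> pts" and i: "i \<in> sidx X" "x \<in> stratum X i" and j: "j \<in> sidx Y" "y \<in> stratum Y j"
  obtains k where "(i, j, k) \<in> sidx W"
proof -
  obtain k where k: "k \<in> sidx Z" "g ` stratum X i \<subseteq> stratum Z k" by (rule s_smooth_stratum[OF g i(1)])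
  obtain k' where k': "k' \<in> sidx Z" "h ` stratum Y j \<subseteq> stratum Z k'" by (rule s_smooth_stratum[OF h j(1)])
  have "g x \<in> stratum Z k" "g x \<in> stratum Z k'" using xy i(2) j(2) k(2) k'(2) unfolding pts_def by auto
  then have "k = k'" by (rule s_manifold_stratum_unique[OF Z k(1) k'(1)])
  then have "(i, j, k) \<in> sidx W" using xy i j k k' unfolding W_simps by blast
  then show ?thesis by (rule that)
qed

text \<open>Charts and dimension agree by definition; the point is the topology, induced from
  \<open>W\<close> on one side and from the product of two strata on the other.\<close>

private lemma W_stratum:
  assumes ijk: "(i, j, k) \<in> sidx W"
  shows "stratum_mfd W (i, j, k) = embedded_submfd (prod_mfd (stratum_mfd X i) (stratum_mfd Y j))
    (stratum W (i, j, k)) (sdim W (i, j, k))"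
    and "stratum W (i, j, k) = {(x, y). x \<in> topspace (mtop (stratum_mfd X i)) \<and>
      y \<in> topspace (mtop (stratum_mfd Y j)) \<and> g x = h y}"
proof -
  have sub: "stratum X i \<subseteq> topspace (stop X)" "stratum Y j \<subseteq> topspace (stop Y)"
    using s_manifold_stratum(4)[OF X] s_manifold_stratum(4)[OF Y] W_idx[OF ijk] by blast+
  then have top: "topspace (mtop (stratum_mfd X i)) = stratum X i" "topspace (mtop (stratum_mfd Y j)) = stratum Y j"
    by auto
  show eq: "stratum W (i, j, k) = {(x, y). x \<in> topspace (mtop (stratum_mfd X i)) \<and>
      y \<in> topspace (mtop (stratum_mfd Y j)) \<and> g x = h y}"
    unfolding top W_simps pts_def using sub by auto
  have "pts \<inter> (pts \<inter> stratum X i \<times> stratum Y j) = pts \<inter> stratum X i \<times> stratum Y j"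
    "(stratum X i \<times> stratum Y j) \<inter> (pts \<inter> stratum X i \<times> stratum Y j) = pts \<inter> stratum X i \<times> stratum Y j" by blast+
  then have "mtop (stratum_mfd W (i, j, k)) = mtop (embedded_submfd (prod_mfd (stratum_mfd X i) (stratum_mfd Y j))
      (stratum W (i, j, k)) (sdim W (i, j, k)))"
    unfolding stratum_mfd_simps embedded_submfd_simps prod_mfd_simps subtopology_Times[symmetric]
      W_simps subtopology_subtopology by simp
  moreover have "atlas (stratum_mfd W (i, j, k)) = atlas (embedded_submfd (prod_mfd (stratum_mfd X i) (stratum_mfd Y j))
      (stratum W (i, j, k)) (sdim W (i, j, k)))"
    by (simp only: stratum_mfd_simps(2,3) W_simps(4,5) fibre_product_mfd_def eq)
  ultimately show "stratum_mfd W (i, j, k) = embedded_submfd (prod_mfd (stratum_mfd X i) (stratum_mfd Y j))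
      (stratum W (i, j, k)) (sdim W (i, j, k))"
    by (intro mfd.equality) simp_all
qed

private lemma W_transverse:
  assumes ijk: "(i, j, k) \<in> sidx W" and xy: "(x, y) \<in> stratum W (i, j, k)"
  shows "transverse_at (stratum_mfd X i) (stratum_mfd Y j) (stratum_mfd Z k) g h x y"
    and "transverse_dims l m n (int (sdim X i)) (int (sdim Y j)) (int (sdim Z k))"
proof -
  have *: "x \<in> topspace (stop X)" "y \<in> topspace (stop Y)" "h y = g x" "x \<in> stratum X i" "y \<in> stratum Y j"
    using xy unfolding W_simps pts_def by auto
  have gx: "g x \<in> stratum Z k" using W_idx(4)[OF ijk] *(4) by blast
  have s: "stratum_at X x = i" "stratum_at Y y = j" "stratum_at Z (g x) = k"
    by (rule stratum_at_eq[OF X W_idx(1)[OF ijk] *(4)] stratum_at_eq[OF Y W_idx(2)[OF ijk] *(5)]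
        stratum_at_eq[OF Z W_idx(3)[OF ijk] gx])+
  note t = trans[unfolded s_transverse_def, rule_format, OF *(1,2) conjI[OF refl *(3)]]
  show "transverse_at (stratum_mfd X i) (stratum_mfd Y j) (stratum_mfd Z k) g h x y"
    using conjunct1[OF t] unfolding transverse_at_def s_tangent_map_def s_tangent_space_def *(3) s .
  show "transverse_dims l m n (int (sdim X i)) (int (sdim Y j)) (int (sdim Z k))"
    using conjunct2[OF t] unfolding dim_at_def s transverse_dims_def .
qed

private lemma W_slices:
  assumes ijk: "(i, j, k) \<in> sidx W" and xy: "(x, y) \<in> stratum W (i, j, k)"
  shows "sdim Z k \<le> sdim X i + sdim Y j"
    "\<exists>c. slice_chart (prod_mfd (stratum_mfd X i) (stratum_mfd Y j)) (stratum W (i, j, k)) (sdim W (i, j, k)) c \<and> (x, y) \<in> fst c"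
proof -
  note M = s_manifold_stratum(2)[OF X W_idx(1)[OF ijk]]
  note N = s_manifold_stratum(2)[OF Y W_idx(2)[OF ijk]]
  note P = s_manifold_stratum(2)[OF Z W_idx(3)[OF ijk]]
  note gs = s_smooth_smooth_map[OF g W_idx(1,3,4)[OF ijk]]
  note hs = s_smooth_smooth_map[OF h W_idx(2,3,5)[OF ijk]]
  have xy': "x \<in> topspace (mtop (stratum_mfd X i))" "y \<in> topspace (mtop (stratum_mfd Y j))" "g x = h y"
    using xy unfolding W_stratum(2)[OF ijk] by blast+
  from fibre_product_slice[OF M N P gs hs xy' W_transverse(1)[OF ijk xy], folded W_stratum(2)[OF ijk]]
  show "sdim Z k \<le> sdim X i + sdim Y j"
    "\<exists>c. slice_chart (prod_mfd (stratum_mfd X i) (stratum_mfd Y j)) (stratum W (i, j, k)) (sdim W (i, j, k)) c \<and> (x, y) \<in> fst c"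
    unfolding stratum_mfd_simps(2) W_simps(4) by blast+
qed

text \<open>Indices in \<open>sidx W\<close> have nonempty strata, and a point of the stratum
  supplies both the alternatives of transversality and the slice chart that makes the subtraction of
  natural numbers exact.\<close>

private lemma W_dims:
  assumes ijk: "(i, j, k) \<in> sidx W"
  shows "int (sdim W (i, j, k)) = int (sdim X i) + int (sdim Y j) - int (sdim Z k)"
    and "transverse_dims l m n (int (sdim X i)) (int (sdim Y j)) (int (sdim Z k))"
    and "int (sdim W (i, j, k)) \<le> l + m - n"
proof -
  obtain x y where xy: "(x, y) \<in> stratum W (i, j, k)"
    using W_idx(6)[OF ijk] unfolding W_simps by fast
  show 1: "int (sdim W (i, j, k)) = int (sdim X i) + int (sdim Y j) - int (sdim Z k)"
    using W_slices(1)[OF ijk xy] unfolding W_simps(4) by simp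
  show 2: "transverse_dims l m n (int (sdim X i)) (int (sdim Y j)) (int (sdim Z k))"
    by (rule W_transverse(2)[OF ijk xy])
  show "int (sdim W (i, j, k)) \<le> l + m - n"
    unfolding 1 using 2 unfolding transverse_dims_def prod.inject by linarith
qed

private lemma W_stratum_context:
  assumes ijk: "(i, j, k) \<in> sidx W"
  shows "smooth_manifold (stratum_mfd X i)" "smooth_manifold (stratum_mfd Y j)"
    "smooth_manifold (prod_mfd (stratum_mfd X i) (stratum_mfd Y j))"
    "sdim W (i, j, k) \<le> mdim (prod_mfd (stratum_mfd X i) (stratum_mfd Y j))"
    "stratum W (i, j, k) \<subseteq> topspace (mtop (prod_mfd (stratum_mfd X i) (stratum_mfd Y j)))"
    "z \<in> stratum W (i, j, k) \<Longrightarrow> \<exists>c. slice_chart (prod_mfd (stratum_mfd X i) (stratum_mfd Y j))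
       (stratum W (i, j, k)) (sdim W (i, j, k)) c \<and> z \<in> fst c"
proof -
  show M: "smooth_manifold (stratum_mfd X i)" "smooth_manifold (stratum_mfd Y j)"
    by (rule s_manifold_stratum(2)[OF X W_idx(1)[OF ijk]] s_manifold_stratum(2)[OF Y W_idx(2)[OF ijk]])+
  then show "smooth_manifold (prod_mfd (stratum_mfd X i) (stratum_mfd Y j))" by (rule smooth_manifold_prod)
  show "sdim W (i, j, k) \<le> mdim (prod_mfd (stratum_mfd X i) (stratum_mfd Y j))" by (simp add: W_simps(4))
  show "stratum W (i, j, k) \<subseteq> topspace (mtop (prod_mfd (stratum_mfd X i) (stratum_mfd Y j)))"
    unfolding W_stratum(2)[OF ijk] by auto
  assume "z \<in> stratum W (i, j, k)"
  then show "\<exists>c. slice_chart (prod_mfd (stratum_mfd X i) (stratum_mfd Y j))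
       (stratum W (i, j, k)) (sdim W (i, j, k)) c \<and> z \<in> fst c"
    using W_slices(2)[OF ijk, of "fst z" "snd z"] by simp
qed

section \<open>The axioms of an s-manifold\<close>

private lemma W_smooth_manifold:
  assumes ijk: "(i, j, k) \<in> sidx W"
  shows "smooth_manifold (stratum_mfd W (i, j, k))"
  unfolding W_stratum(1)[OF ijk]
  by (rule smooth_manifold_embedded[OF W_stratum_context(3-5)[OF ijk]]) (rule W_stratum_context(6)[OF ijk])

private lemma W_smooth_inclusion:
  assumes ijk: "(i, j, k) \<in> sidx W"
  shows "smooth_map (stratum_mfd W (i, j, k)) (prod_mfd (stratum_mfd X i) (stratum_mfd Y j)) (\<lambda>z. z)"
  unfolding W_stratum(1)[OF ijk]
  by (rule smooth_map_embedded_inclusion[OF W_stratum_context(3-5)[OF ijk]]) (rule W_stratum_context(6)[OF ijk])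

text \<open>Equality of two continuous maps into the Hausdorff space \<open>Z\<close> is a closed
  condition. Local compactness of the product passes to \<open>W\<close> for this reason.\<close>

private lemma W_closed: "closedin (prod_topology (stop X) (stop Y)) pts"
proof -
  have "continuous_map (stop X) (stop Z) g" "continuous_map (stop Y) (stop Z) h"
    using g h unfolding s_smooth_def by (blast dest: conjunct1)+
  then have "continuous_map (prod_topology (stop X) (stop Y)) (stop Z) (\<lambda>z. g (fst z))"
    "continuous_map (prod_topology (stop X) (stop Y)) (stop Z) (\<lambda>z. h (snd z))"
    by (simp_all add: continuous_map_compose[OF continuous_map_fst, unfolded o_def]
        continuous_map_compose[OF continuous_map_snd, unfolded o_def])
  moreover have "Hausdorff_space (stop Z)" using Z by (simp add: s_manifold_def)
  ultimately have "closedin (prod_topology (stop X) (stop Y))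
      {z \<in> topspace (prod_topology (stop X) (stop Y)). g (fst z) = h (snd z)}"
    by (intro closedin_continuous_maps_eq)
  also have "{z \<in> topspace (prod_topology (stop X) (stop Y)). g (fst z) = h (snd z)} = pts"
    by (auto simp: pts_def)
  finally show ?thesis .
qed

private lemma W_locally_closed:
  assumes ijk: "(i, j, k) \<in> sidx W"
  shows "\<exists>A B. openin (stop W) A \<and> closedin (stop W) B \<and> stratum W (i, j, k) = A \<inter> B"
proof -
  obtain A1 B1 where 1: "openin (stop X) A1" "closedin (stop X) B1" "stratum X i = A1 \<inter> B1"
    using X W_idx(1)[OF ijk] unfolding s_manifold_def by blast
  obtain A2 B2 where 2: "openin (stop Y) A2" "closedin (stop Y) B2" "stratum Y j = A2 \<inter> B2"
    using Y W_idx(2)[OF ijk] unfolding s_manifold_def by blast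
  have "openin (stop W) ((A1 \<times> A2) \<inter> pts)"
    unfolding W_simps openin_subtopology using 1(1) 2(1) openin_prod_Times_iff by blast
  moreover have "closedin (stop W) ((B1 \<times> B2) \<inter> pts)"
    unfolding W_simps closedin_subtopology using 1(2) 2(2) closedin_prod_Times_iff by blast
  moreover have "stratum W (i, j, k) = ((A1 \<times> A2) \<inter> pts) \<inter> ((B1 \<times> B2) \<inter> pts)"
    unfolding W_simps 1(3) 2(3) by blast
  ultimately show ?thesis by blast
qed

text \<open>The join of local embeddings of the factors restricts to \<open>W\<close>, and on each
  stratum \<open>smooth_embedding_fibre\<close> applies to the parts of the two neighbourhoods
  inside the strata of \<open>X\<close> and \<open>Y\<close>.\<close>

private lemma W_locally_embedded: "sm_locally_embedded W"
  unfolding sm_locally_embedded_def W_topspace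
proof
  fix z assume "z \<in> pts"
  then obtain x y where z: "z = (x, y)" "x \<in> topspace (stop X)" "y \<in> topspace (stop Y)"
    unfolding pts_def by blast
  have "sm_locally_embedded X" "sm_locally_embedded Y"
    using X Y unfolding s_manifold_def by blast+
  then obtain U p a V q b where U: "openin (stop X) U" "x \<in> U" "embedding_map (subtopology (stop X) U) (Euclidean_space p) a"
      "\<forall>i\<in>sidx X. smooth_embedding (open_submfd (stratum_mfd X i) U) (eucl_mfd p) a"
    and V: "openin (stop Y) V" "y \<in> V" "embedding_map (subtopology (stop Y) V) (Euclidean_space q) b"
      "\<forall>j\<in>sidx Y. smooth_embedding (open_submfd (stratum_mfd Y j) V) (eucl_mfd q) b"
    using z(2,3) unfolding sm_locally_embedded_def by meson
  let ?f = "\<lambda>z. join p (a (fst z)) (b (snd z))"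
  have "openin (stop W) ((U \<times> V) \<inter> pts)"
    unfolding W_simps openin_subtopology using U(1) V(1) openin_prod_Times_iff by blast
  moreover have "z \<in> (U \<times> V) \<inter> pts" using z(1) U(2) V(2) \<open>z \<in> pts\<close> by blast
  moreover have "embedding_map (subtopology (stop W) ((U \<times> V) \<inter> pts)) (Euclidean_space (p + q)) ?f"
  proof -
    have "embedding_map (subtopology (subtopology (prod_topology (stop X) (stop Y)) (U \<times> V)) pts) (Euclidean_space (p + q)) ?f"
      unfolding subtopology_Times by (rule embedding_map_subtopology[OF embedding_map_join[OF U(3) V(3)]])
    moreover have "pts \<inter> ((U \<times> V) \<inter> pts) = (U \<times> V) \<inter> pts" by blast
    ultimately show ?thesis unfolding W_simps subtopology_subtopology by simp
  qed
  moreover have "smooth_embedding (open_submfd (stratum_mfd W ijk) ((U \<times> V) \<inter> pts)) (eucl_mfd (p + q)) ?f"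
    if ijk': "ijk \<in> sidx W" for ijk
  proof -
    obtain i j k where e: "ijk = (i, j, k)" by (cases ijk)
    note ijk = ijk'[unfolded e]
    let ?M = "stratum_mfd X i" and ?N = "stratum_mfd Y j"
    note M = W_stratum_context(1)[OF ijk] and N = W_stratum_context(2)[OF ijk]
    have U': "openin (mtop ?M) (topspace (mtop ?M) \<inter> U)" and V': "openin (mtop ?N) (topspace (mtop ?N) \<inter> V)"
      using U(1) V(1) openin_subset by (auto simp: openin_subtopology)
    have a: "smooth_embedding (open_submfd ?M (topspace (mtop ?M) \<inter> U)) (eucl_mfd p) a"
      using U(4) W_idx(1)[OF ijk] open_submfd_restrict[OF M, of U] by metis
    have b: "smooth_embedding (open_submfd ?N (topspace (mtop ?N) \<inter> V)) (eucl_mfd q) b"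
      using V(4) W_idx(2)[OF ijk] open_submfd_restrict[OF N, of V] by metis
    have d: "sdim W (i, j, k) \<le> mdim ?M + mdim ?N" using W_stratum_context(4)[OF ijk] by simp
    have "smooth_embedding (open_submfd (stratum_mfd W (i, j, k))
        (stratum W (i, j, k) \<inter> (topspace (mtop ?M) \<inter> U) \<times> (topspace (mtop ?N) \<inter> V))) (eucl_mfd (p + q)) ?f"
      unfolding W_stratum(1)[OF ijk]
      by (rule smooth_embedding_fibre[OF M N d W_stratum_context(5)[OF ijk] _ U' V' a b])
        (rule W_stratum_context(6)[OF ijk])
    also have "stratum W (i, j, k) \<inter> (topspace (mtop ?M) \<inter> U) \<times> (topspace (mtop ?N) \<inter> V) =
        topspace (mtop (stratum_mfd W (i, j, k))) \<inter> ((U \<times> V) \<inter> pts)"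
    proof -
      have "topspace (mtop (stratum_mfd W (i, j, k))) = stratum W (i, j, k)"
        unfolding stratum_mfd_simps topspace_subtopology W_topspace by (auto simp: W_simps)
      moreover have "stratum W (i, j, k) \<subseteq> pts" by (auto simp: W_simps)
      moreover have "stratum W (i, j, k) \<subseteq> topspace (mtop ?M) \<times> topspace (mtop ?N)"
        unfolding W_stratum(2)[OF ijk] by blast
      ultimately show ?thesis by blast
    qed
    finally show ?thesis
      unfolding e open_submfd_restrict[OF W_smooth_manifold[OF ijk], of "(U \<times> V) \<inter> pts"] .
  qed
  ultimately show "\<exists>U N f. openin (stop W) U \<and> z \<in> U \<and> embedding_map (subtopology (stop W) U) (Euclidean_space N) f \<and>
      (\<forall>i\<in>sidx W. smooth_embedding (open_submfd (stratum_mfd W i) U) (eucl_mfd N) f)"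
    by blast
qed

private lemma W_frontier: "sm_frontier_condition (l + m - n) W"
  unfolding sm_frontier_condition_iff W_topspace
proof
  fix z assume "z \<in> pts"
  then obtain x y where z: "z = (x, y)" "x \<in> topspace (stop X)" "y \<in> topspace (stop Y)"
    unfolding pts_def by blast
  obtain U RX where U: "openin (stop X) U" "x \<in> U" and RX: "frontier_order l X U RX"
    using X z(2) unfolding s_manifold_def sm_frontier_condition_iff by blast
  obtain V RY where V: "openin (stop Y) V" "y \<in> V" and RY: "frontier_order m Y V RY"
    using Y z(3) unfolding s_manifold_def sm_frontier_condition_iff by blast
  define IU where "IU = local_strata X U"
  define IV where "IV = local_strata Y V"
  note fX = RX[unfolded frontier_order_def, folded IU_def] and fY = RY[unfolded frontier_order_def, folded IV_def]
  note finX = fX[THEN conjunct1] and poX = fX[THEN conjunct2, THEN conjunct1]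
    and clX = fX[THEN conjunct2, THEN conjunct2, THEN conjunct1, rule_format]
    and dimX = fX[THEN conjunct2, THEN conjunct2, THEN conjunct2, rule_format]
  note finY = fY[THEN conjunct1] and poY = fY[THEN conjunct2, THEN conjunct1]
    and clY = fY[THEN conjunct2, THEN conjunct2, THEN conjunct1, rule_format]
    and dimY = fY[THEN conjunct2, THEN conjunct2, THEN conjunct2, rule_format]
  define D where "D = (U \<times> V) \<inter> pts"
  define IO where "IO = local_strata W D"
  \<comment> \<open>Restricted to \<open>IO\<close>, as comparable pairs of indices need not come
    from a stratum of \<open>W\<close> that meets \<open>D\<close>.\<close>
  define R where "R = {((i, j, k), (i', j', k')). (i, j, k) \<in> IO \<and> (i', j', k') \<in> IO \<and> (i, i') \<in> RX \<and> (j, j') \<in> RY}"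
  have IO: "(i, j, k) \<in> sidx W" "i \<in> IU" "j \<in> IV" if "(i, j, k) \<in> IO" for i j k
  proof -
    show ijk: "(i, j, k) \<in> sidx W" using that unfolding IO_def local_strata_def mem_Collect_eq by (elim conjE)
    have "D \<inter> stratum W (i, j, k) \<noteq> {}" using that unfolding IO_def local_strata_def mem_Collect_eq by (elim conjE)
    then obtain x y where "x \<in> U" "y \<in> V" "x \<in> stratum X i" "y \<in> stratum Y j"
      unfolding D_def W_simps(2) by auto
    then show "i \<in> IU" "j \<in> IV"
      unfolding IU_def IV_def local_strata_def using W_idx(1,2)[OF ijk] by auto
  qed
  have OW: "openin (stop W) D"
    unfolding W_simps openin_subtopology D_def using U(1) V(1) openin_prod_Times_iff by blast
  \<comment> \<open>Forgetting \<open>k\<close> embeds the local indices into a product of two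
    finite sets.\<close>
  have finO: "finite IO"
  proof (rule inj_on_finite[of "\<lambda>(i, j, k). (i, j)" IO "IU \<times> IV"])
    show "inj_on (\<lambda>(i, j, k). (i, j)) IO"
    proof (rule inj_onI)
      fix p q assume pq: "p \<in> IO" "q \<in> IO" "(\<lambda>(i, j, k). (i, j)) p = (\<lambda>(i, j, k). (i, j)) q"
      obtain i j k i' j' k' where e: "p = (i, j, k)" "q = (i', j', k')" by (cases p, cases q) blast
      have ij: "i' = i" "j' = j" using pq(3) unfolding e by simp_all
      have "k = k'" by (rule W_idx_unique[OF IO(1)[OF pq(1)[unfolded e]] IO(1)[OF pq(2)[unfolded e ij]]])
      then show "p = q" unfolding e ij by simp
    qed
    show "(\<lambda>(i, j, k). (i, j)) ` IO \<subseteq> IU \<times> IV"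
    proof
      fix r assume "r \<in> (\<lambda>(i, j, k). (i, j)) ` IO"
      then obtain p where p: "p \<in> IO" "r = (\<lambda>(i, j, k). (i, j)) p" by (elim imageE)
      obtain i j k where e: "p = (i, j, k)" by (cases p)
      show "r \<in> IU \<times> IV" using IO(2,3)[OF p(1)[unfolded e]] p(2) unfolding e by simp
    qed
  qed (use finX finY in simp)
  have po: "partial_order_on IO R"
    unfolding partial_order_on_def preorder_on_def
  proof (intro conjI)
    have rX: "refl_on IU RX" "trans RX" "antisym RX" and rY: "refl_on IV RY" "trans RY" "antisym RY"
      using poX poY unfolding partial_order_on_def preorder_on_def by blast+
    show "R \<subseteq> IO \<times> IO" unfolding R_def by blast
    show "refl_on IO R"
      unfolding refl_on_def
    proof
      fix p assume p: "p \<in> IO"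
      obtain i j k where e: "p = (i, j, k)" by (cases p)
      show "(p, p) \<in> R"
        using p IO(2,3)[OF p[unfolded e]] rX(1) rY(1) unfolding R_def e refl_on_def by blast
    qed
    show "trans R"
    proof (rule transI)
      fix p q r assume "(p, q) \<in> R" "(q, r) \<in> R"
      then obtain i j k i' j' k' i'' j'' k'' where e: "p = (i, j, k)" "q = (i', j', k')" "r = (i'', j'', k'')"
        by (cases p, cases q, cases r) blast
      have "(i, i') \<in> RX" "(i', i'') \<in> RX" "(j, j') \<in> RY" "(j', j'') \<in> RY" "p \<in> IO" "r \<in> IO"
        using \<open>(p, q) \<in> R\<close> \<open>(q, r) \<in> R\<close> unfolding R_def e by blast+
      then show "(p, r) \<in> R" using transD[OF rX(2)] transD[OF rY(2)] unfolding R_def e by blast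
    qed
    show "antisym R"
    proof (rule antisymI)
      fix p q assume pq: "(p, q) \<in> R" "(q, p) \<in> R"
      obtain i j k i' j' k' where e: "p = (i, j, k)" "q = (i', j', k')" by (cases p, cases q) blast
      have "i = i'" "j = j'" "(i, j, k) \<in> IO" "(i', j', k') \<in> IO"
        using pq antisymD[OF rX(3)] antisymD[OF rY(3)] unfolding R_def e by blast+
      then show "p = q" unfolding e using W_idx_unique[OF IO(1) IO(1)] by blast
    qed
  qed
  have cl: "subtopology (stop W) D closure_of (D \<inter> stratum W p) \<subseteq> (\<Union>q\<in>{q \<in> IO. (p, q) \<in> R}. D \<inter> stratum W q)"
    if p: "p \<in> IO" for p
  proof
    fix z assume zc: "z \<in> subtopology (stop W) D closure_of (D \<inter> stratum W p)"
    obtain i j k where e: "p = (i, j, k)" by (cases p)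
    note ijk = IO[OF p[unfolded e]]
    \<comment> \<open>\<open>D\<close> carries the topology induced from the product of
      \<open>U\<close> and \<open>V\<close>. The projections are thus continuous into
      \<open>U\<close> and \<open>V\<close> and map closures into the closures taken there, where
      the frontier conditions of the factors apply.\<close>
    have eqT: "subtopology (stop W) D = subtopology (prod_topology (subtopology (stop X) U) (subtopology (stop Y) V)) pts"
      unfolding W_simps subtopology_subtopology subtopology_Times[symmetric] D_def
      by (rule arg_cong[of _ _ "subtopology _"]) blast
    have c: "continuous_map (subtopology (stop W) D) (subtopology (stop X) U) fst"
      "continuous_map (subtopology (stop W) D) (subtopology (stop Y) V) snd"
      unfolding eqT by (intro continuous_map_from_subtopology continuous_map_fst continuous_map_snd)+
    have "z \<in> topspace (subtopology (stop W) D)" by (rule subsetD[OF closure_of_subset_topspace zc])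
    then have zO: "z \<in> D" by simp
    obtain x y where z: "z = (x, y)" by (cases z)
    have "fst z \<in> subtopology (stop X) U closure_of (fst ` (D \<inter> stratum W p))"
      by (rule subsetD[OF continuous_map_image_closure_subset[OF c(1)] imageI[OF zc]])
    moreover have "fst ` (D \<inter> stratum W p) \<subseteq> U \<inter> stratum X i" unfolding e D_def W_simps by auto
    ultimately have "x \<in> subtopology (stop X) U closure_of (U \<inter> stratum X i)"
      using closure_of_mono unfolding z fst_conv by (meson subsetD)
    then obtain i' where i': "i' \<in> IU" "(i, i') \<in> RX" "x \<in> stratum X i'" using clX[OF ijk(2)] by blast
    have "snd z \<in> subtopology (stop Y) V closure_of (snd ` (D \<inter> stratum W p))"
      by (rule subsetD[OF continuous_map_image_closure_subset[OF c(2)] imageI[OF zc]])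
    moreover have "snd ` (D \<inter> stratum W p) \<subseteq> V \<inter> stratum Y j" unfolding e D_def W_simps by auto
    ultimately have "y \<in> subtopology (stop Y) V closure_of (V \<inter> stratum Y j)"
      using closure_of_mono unfolding z snd_conv by (meson subsetD)
    then obtain j' where j': "j' \<in> IV" "(j, j') \<in> RY" "y \<in> stratum Y j'" using clY[OF ijk(3)] by blast
    \<comment> \<open>The limit point itself lies in \<open>W\<close>, hence its two strata belong
      to an index triple.\<close>
    have "(x, y) \<in> pts" "i' \<in> sidx X" "j' \<in> sidx Y" using zO i'(1) j'(1) unfolding z D_def IU_def IV_def local_strata_def by blast+
    then obtain k' where k': "(i', j', k') \<in> sidx W" by (rule W_idx_exists[OF _ _ i'(3) _ j'(3)])
    have zs: "z \<in> stratum W (i', j', k')" unfolding W_simps z using zO i'(3) j'(3) unfolding z D_def by blast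
    then have "(i', j', k') \<in> IO" unfolding IO_def local_strata_def using k' zO by blast
    then have "(p, (i', j', k')) \<in> R" using p i'(2) j'(2) unfolding R_def e by blast
    with \<open>(i', j', k') \<in> IO\<close> zO zs show "z \<in> (\<Union>q\<in>{q \<in> IO. (p, q) \<in> R}. D \<inter> stratum W q)" by blast
  qed
  have dim: "int (sdim W p) \<in> {l + m - n - 1, l + m - n} \<and> sdim W q < sdim W p \<or>
      int (sdim W p) \<le> l + m - n - 2 \<and> int (sdim W q) \<le> l + m - n - 2"
    if pq: "p \<in> IO" "q \<in> IO" "p \<noteq> q" "(p, q) \<in> R" for p q
  proof -
    obtain i j k i' j' k' where e: "p = (i, j, k)" "q = (i', j', k')" by (cases p, cases q) blast
    note a = IO[OF pq(1)[unfolded e]] and b = IO[OF pq(2)[unfolded e]]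
    have r: "(i, i') \<in> RX" "(j, j') \<in> RY" using pq(4) unfolding R_def e by auto
    \<comment> \<open>A shared stratum is nonempty and has a single image stratum; this cancels the
      dimension in \<open>Z\<close> when one factor is fixed.\<close>
    have kk: "k = k'" if "i = i' \<or> j = j'"
    proof -
      obtain x y where xy: "x \<in> stratum X i" "y \<in> stratum Y j"
        using s_manifold_stratum(1)[OF X W_idx(1)[OF a(1)]] s_manifold_stratum(1)[OF Y W_idx(2)[OF a(1)]] by blast
      have "\<exists>z. z \<in> stratum Z k \<and> z \<in> stratum Z k'"
        using that
      proof
        assume "i = i'"
        then show ?thesis using xy(1) W_idx(4)[OF a(1)] W_idx(4)[OF b(1)] by blast
      next
        assume "j = j'"
        then show ?thesis using xy(2) W_idx(5)[OF a(1)] W_idx(5)[OF b(1)] by blast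
      qed
      then show ?thesis using s_manifold_stratum_unique[OF Z W_idx(3)[OF a(1)] W_idx(3)[OF b(1)]] by blast
    qed
    have ne: "\<not> (i = i' \<and> j = j')" using pq(3) kk unfolding e by blast
    have dX: "int (sdim X i) = int (sdim X i') \<and> int (sdim Z k) = int (sdim Z k') \<and> i = i' \<or> i \<noteq> i' \<and>
        (int (sdim X i) \<in> {l - 1, l} \<and> int (sdim X i') < int (sdim X i) \<or> int (sdim X i) \<le> l - 2 \<and> int (sdim X i') \<le> l - 2)"
      using dimX[OF a(2) b(2)] r(1) kk by (cases "i = i'") simp_all
    have dY: "int (sdim Y j) = int (sdim Y j') \<and> int (sdim Z k) = int (sdim Z k') \<and> j = j' \<or> j \<noteq> j' \<and>
        (int (sdim Y j) \<in> {m - 1, m} \<and> int (sdim Y j') < int (sdim Y j) \<or> int (sdim Y j) \<le> m - 2 \<and> int (sdim Y j') \<le> m - 2)"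
      using dimY[OF a(3) b(3)] r(2) kk by (cases "j = j'") simp_all
    have "int (sdim W p) \<in> {l + m - n - 1, l + m - n} \<and> int (sdim W q) < int (sdim W p) \<or>
      int (sdim W p) \<le> l + m - n - 2 \<and> int (sdim W q) \<le> l + m - n - 2"
      unfolding e W_dims(1)[OF a(1)] W_dims(1)[OF b(1)]
      by (rule transverse_dims_frontier[OF W_dims(2)[OF a(1)] W_dims(2)[OF b(1)] _ _ _ dX dY ne])
        (rule s_manifold_stratum(3)[OF X W_idx(1)[OF a(1)]] s_manifold_stratum(3)[OF Y W_idx(2)[OF a(1)]]
          s_manifold_stratum(3)[OF Z W_idx(3)[OF a(1)]])+
    then show ?thesis by (simp only: of_nat_less_iff)
  qed
  have zO: "z \<in> D" using \<open>z \<in> pts\<close> U(2) V(2) z(1) by (simp add: D_def)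
  have "frontier_order (l + m - n) W D R"
    unfolding frontier_order_def IO_def[symmetric] using finO po cl dim by blast
  with OW zO show "\<exists>V R. openin (stop W) V \<and> z \<in> V \<and> frontier_order (l + m - n) W V R" by blast
qed

text \<open>A point of \<open>W\<close> lies in a stratum, whose dimension is a natural number and
  at most \<open>l + m - n\<close>.\<close>

lemma s_fibre_product_dim_nonneg:
  assumes "topspace (stop W) \<noteq> {}"
  shows "0 \<le> l + m - n"
proof -
  obtain x y where xy: "(x, y) \<in> pts" using assms unfolding W_topspace by fast
  then have "x \<in> topspace (stop X)" "y \<in> topspace (stop Y)" unfolding pts_def by blast+
  then obtain i j where "i \<in> sidx X" "x \<in> stratum X i" "j \<in> sidx Y" "y \<in> stratum Y j"
    using s_manifold_stratum_exists[OF X] s_manifold_stratum_exists[OF Y] by metis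
  then obtain k where "(i, j, k) \<in> sidx W" using W_idx_exists[OF xy] by metis
  from W_dims(3)[OF this] show ?thesis by linarith
qed

lemma s_manifold_fibre_product: "s_manifold (l + m - n) W"
  unfolding s_manifold_def
proof (intro conjI)
  show "0 \<le> l + m - n \<or> topspace (stop W) = {}" using s_fibre_product_dim_nonneg by blast
  have lc: "locally_compact_space (stop X)" "locally_compact_space (stop Y)"
    and hd: "Hausdorff_space (stop X)" "Hausdorff_space (stop Y)"
    and sc: "second_countable (stop X)" "second_countable (stop Y)"
    and co: "countable (sidx X)" "countable (sidx Y)" "countable (sidx Z)"
    using X Y Z unfolding s_manifold_def by blast+
  have "locally_compact_space (prod_topology (stop X) (stop Y))"
    unfolding locally_compact_space_prod_topology using lc by blast
  then show "locally_compact_space (stop W)"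
    unfolding W_simps by (rule locally_compact_space_closed_subset[OF _ W_closed])
  show "Hausdorff_space (stop W)"
    unfolding W_simps using hd by (simp add: Hausdorff_space_subtopology Hausdorff_space_prod_topology)
  show "second_countable (stop W)"
    unfolding W_simps using sc by (simp add: second_countable_subtopology second_countable_prod_topology)
  have "sidx W \<subseteq> sidx X \<times> sidx Y \<times> sidx Z" unfolding W_simps by blast
  then show "countable (sidx W)" by (rule countable_subset) (use co in blast)
  show "\<forall>ijk\<in>sidx W. stratum W ijk \<noteq> {} \<and>
      (\<exists>A B. openin (stop W) A \<and> closedin (stop W) B \<and> stratum W ijk = A \<inter> B)"
  proof
    fix ijk assume a: "ijk \<in> sidx W"
    obtain i j k where e: "ijk = (i, j, k)" by (cases ijk)
    show "stratum W ijk \<noteq> {} \<and> (\<exists>A B. openin (stop W) A \<and> closedin (stop W) B \<and> stratum W ijk = A \<inter> B)"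
      using W_locally_closed W_idx(6) a unfolding e W_simps(2) by blast
  qed
  show "disjoint_family_on (stratum W) (sidx W)"
    unfolding disjoint_family_on_def
  proof (intro ballI impI)
    fix p q assume pq: "p \<in> sidx W" "q \<in> sidx W" "p \<noteq> q"
    obtain i j k i' j' k' where e: "p = (i, j, k)" "q = (i', j', k')" by (cases p, cases q) blast
    have "i \<noteq> i' \<or> j \<noteq> j'" using pq W_idx_unique unfolding e by blast
    then have "stratum X i \<inter> stratum X i' = {} \<or> stratum Y j \<inter> stratum Y j' = {}"
      using s_manifold_stratum_unique[OF X W_idx(1) W_idx(1)] s_manifold_stratum_unique[OF Y W_idx(2) W_idx(2)]
        pq(1,2) unfolding e by blast
    then show "stratum W p \<inter> stratum W q = {}" unfolding e W_simps by blast
  qed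
  show "(\<Union>ijk\<in>sidx W. stratum W ijk) = topspace (stop W)"
    unfolding W_topspace
  proof (intro equalityI subsetI)
    fix z assume "z \<in> (\<Union>ijk\<in>sidx W. stratum W ijk)"
    then obtain i j k where "z \<in> stratum W (i, j, k)" by force
    then show "z \<in> pts" unfolding W_simps by blast
  next
    fix z assume zp: "z \<in> pts"
    obtain x y where z: "z = (x, y)" by (cases z)
    have "x \<in> topspace (stop X)" "y \<in> topspace (stop Y)" using zp unfolding pts_def z by blast+
    then obtain i j where ij: "i \<in> sidx X" "x \<in> stratum X i" "j \<in> sidx Y" "y \<in> stratum Y j"
      using s_manifold_stratum_exists[OF X] s_manifold_stratum_exists[OF Y] by metis
    then obtain k where "(i, j, k) \<in> sidx W" using W_idx_exists[OF zp[unfolded z]] by metis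
    moreover have "z \<in> stratum W (i, j, k)" unfolding W_simps z using zp ij z by blast
    ultimately show "z \<in> (\<Union>ijk\<in>sidx W. stratum W ijk)" by blast
  qed
  show "\<forall>ijk\<in>sidx W. smooth_manifold (stratum_mfd W ijk) \<and> int (sdim W ijk) \<le> l + m - n"
    using W_smooth_manifold W_dims(3) by auto
qed (rule W_locally_embedded W_frontier)+

section \<open>Projections and the universal property\<close>

lemma s_smooth_fst: "s_smooth W X fst"
proof (rule s_smoothI[OF X])
  show "continuous_map (stop W) (stop X) fst"
    unfolding W_simps by (intro continuous_map_from_subtopology continuous_map_fst)
  show "stratum W ijk \<noteq> {}" if "ijk \<in> sidx W" for ijk
    by (rule s_manifold_stratum(1)[OF s_manifold_fibre_product that])
  fix ijk assume a: "ijk \<in> sidx W"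
  obtain i j k where e: "ijk = (i, j, k)" by (cases ijk)
  note ijk = a[unfolded e]
  have "fst ` stratum W (i, j, k) \<subseteq> stratum X i" unfolding W_simps by auto
  \<comment> \<open>Inclusion into the product of two strata, followed by the smooth projection of
    that product.\<close>
  moreover have "smooth_map (stratum_mfd W (i, j, k)) (stratum_mfd X i) fst"
    by (rule smooth_map_compose[OF W_smooth_manifold[OF ijk] W_stratum_context(3,1)[OF ijk]
          W_smooth_inclusion[OF ijk] smooth_map_fst[OF W_stratum_context(1,2)[OF ijk]]])
  ultimately show "\<exists>r\<in>sidx X. fst ` stratum W ijk \<subseteq> stratum X r \<and> smooth_map (stratum_mfd W ijk) (stratum_mfd X r) fst"
    unfolding e using W_idx(1)[OF ijk] by blast
qed

lemma s_smooth_snd: "s_smooth W Y snd"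
proof (rule s_smoothI[OF Y])
  show "continuous_map (stop W) (stop Y) snd"
    unfolding W_simps by (intro continuous_map_from_subtopology continuous_map_snd)
  show "stratum W ijk \<noteq> {}" if "ijk \<in> sidx W" for ijk
    by (rule s_manifold_stratum(1)[OF s_manifold_fibre_product that])
  fix ijk assume a: "ijk \<in> sidx W"
  obtain i j k where e: "ijk = (i, j, k)" by (cases ijk)
  note ijk = a[unfolded e]
  have "snd ` stratum W (i, j, k) \<subseteq> stratum Y j" unfolding W_simps by auto
  moreover have "smooth_map (stratum_mfd W (i, j, k)) (stratum_mfd Y j) snd"
    by (rule smooth_map_compose[OF W_smooth_manifold[OF ijk] W_stratum_context(3,2)[OF ijk]
          W_smooth_inclusion[OF ijk] smooth_map_snd[OF W_stratum_context(1,2)[OF ijk]]])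
  ultimately show "\<exists>r\<in>sidx Y. snd ` stratum W ijk \<subseteq> stratum Y r \<and> smooth_map (stratum_mfd W ijk) (stratum_mfd Y r) snd"
    unfolding e using W_idx(2)[OF ijk] by blast
qed

text \<open>On a stratum of \<open>T\<close> each of the two maps stays in one stratum, so the pair
  stays in one stratum of \<open>W\<close>; being smooth into the product of strata, it is smooth
  into the embedded submanifold.\<close>

lemma s_smooth_pair:
  fixes T :: "('t, 'q) smfd"
  assumes T: "s_manifold q T" and a: "s_smooth T X a" and b: "s_smooth T Y b"
    and eq: "\<And>t. t \<in> topspace (stop T) \<Longrightarrow> g (a t) = h (b t)"
  shows "s_smooth T W (\<lambda>t. (a t, b t))"
proof (rule s_smoothI[OF s_manifold_fibre_product])
  have ca: "continuous_map (stop T) (stop X) a" and cb: "continuous_map (stop T) (stop Y) b"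
    using a b unfolding s_smooth_def by (blast dest: conjunct1)+
  have pts: "(a t, b t) \<in> pts" if "t \<in> topspace (stop T)" for t
    using that eq continuous_map_image_subset_topspace[OF ca] continuous_map_image_subset_topspace[OF cb]
    unfolding pts_def by blast
  have "continuous_map (stop T) (prod_topology (stop X) (stop Y)) (\<lambda>t. (a t, b t))"
    by (rule continuous_map_pairedI[OF ca cb])
  then show "continuous_map (stop T) (stop W) (\<lambda>t. (a t, b t))"
    unfolding W_simps continuous_map_in_subtopology using pts by blast
  show "stratum T p \<noteq> {}" if "p \<in> sidx T" for p by (rule s_manifold_stratum(1)[OF T that])
  fix p assume p: "p \<in> sidx T"
  note sT = s_manifold_stratum[OF T p]
  \<comment> \<open>One point of the stratum suffices to see that \<open>i\<close> and
    \<open>j\<close> belong to a common index.\<close>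
  obtain t where t: "t \<in> stratum T p" using sT(1) by blast
  then have tp: "(a t, b t) \<in> pts" using pts sT(4) by blast
  obtain i where i: "i \<in> sidx X" "a ` stratum T p \<subseteq> stratum X i" by (rule s_smooth_stratum[OF a p])
  obtain j where j: "j \<in> sidx Y" "b ` stratum T p \<subseteq> stratum Y j" by (rule s_smooth_stratum[OF b p])
  have ab: "a t \<in> stratum X i" "b t \<in> stratum Y j" using i(2) j(2) t by blast+
  obtain k where ijk: "(i, j, k) \<in> sidx W" by (rule W_idx_exists[OF tp i(1) ab(1) j(1) ab(2)])
  have sub: "(\<lambda>t. (a t, b t)) ` stratum T p \<subseteq> stratum W (i, j, k)"
    unfolding W_simps using i(2) j(2) pts sT(4) by blast
  have "smooth_map (stratum_mfd T p) (prod_mfd (stratum_mfd X i) (stratum_mfd Y j)) (\<lambda>t. (a t, b t))"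
    by (rule smooth_map_pair[OF sT(2) W_stratum_context(1,2)[OF ijk] s_smooth_smooth_map[OF a p i] s_smooth_smooth_map[OF b p j]])
  moreover have "(\<lambda>t. (a t, b t)) ` topspace (mtop (stratum_mfd T p)) \<subseteq> stratum W (i, j, k)"
    using sub sT(4) by auto
  ultimately have "smooth_map (stratum_mfd T p) (stratum_mfd W (i, j, k)) (\<lambda>t. (a t, b t))"
    unfolding W_stratum(1)[OF ijk]
    by (intro smooth_map_into_embedded[OF W_stratum_context(3-5)[OF ijk] _ sT(2)])
      (rule W_stratum_context(6)[OF ijk])
  then show "\<exists>r\<in>sidx W. (\<lambda>t. (a t, b t)) ` stratum T p \<subseteq> stratum W r \<and>
      smooth_map (stratum_mfd T p) (stratum_mfd W r) (\<lambda>t. (a t, b t))"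
    using ijk sub by blast
qed

lemma s_fibre_product_commutes: "w \<in> topspace (stop W) \<Longrightarrow> g (fst w) = h (snd w)"
  unfolding W_topspace pts_def by auto

text \<open>A map into \<open>W\<close> is determined by its two components, so the pairing is the
  only candidate, and its smoothness is \<open>s_smooth_pair\<close>.\<close>

lemma SMan_cartesian_fibre_product: "SMan_cartesian TYPE(('t, 'q) smfd) W X Y Z fst snd g h"
  unfolding SMan_cartesian_def
proof (intro conjI allI impI ballI)
  fix T :: "('t, 'q) smfd" and a b
  assume *: "(\<exists>q. s_manifold q T) \<and> s_smooth T X a \<and> s_smooth T Y b \<and> (\<forall>t\<in>topspace (stop T). g (a t) = h (b t))"
  then obtain q where q: "s_manifold q T" by blast
  have "s_smooth T W (\<lambda>t. (a t, b t))"
    by (rule s_smooth_pair[OF q]) (use * in blast)+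
  then show "\<exists>u. s_smooth T W u \<and> (\<forall>t\<in>topspace (stop T). fst (u t) = a t \<and> snd (u t) = b t) \<and>
      (\<forall>u'. s_smooth T W u' \<and> (\<forall>t\<in>topspace (stop T). fst (u' t) = a t \<and> snd (u' t) = b t) \<longrightarrow>
        (\<forall>t\<in>topspace (stop T). u' t = u t))"
    by (intro exI[of _ "\<lambda>t. (a t, b t)"]) (auto simp: prod_eq_iff)
qed (rule exI[of _ "l + m - n"] exI[of _ l] exI[of _ m] exI[of _ n] s_manifold_fibre_product X Y Z g h
    s_smooth_fst s_smooth_snd s_fibre_product_commutes | assumption)+

end

theorem theorem3p25:
  fixes X :: "('a, 'i) smfd" and Y :: "('b, 'j) smfd" and Z :: "('c, 'k) smfd"
    and g :: "'a \<Rightarrow> 'c" and h :: "'b \<Rightarrow> 'c" and l m n :: nat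
  assumes "s_manifold (int l) X" and "s_manifold (int m) Y" and "s_manifold (int n) Z"
    and "s_smooth X Z g" and "s_smooth Y Z h"
    and "s_transverse (int l) (int m) (int n) X Y Z g h"
  shows "let W = s_fibre_product X Y Z g h; d = int l + int m - int n
         in s_manifold d W \<and> (topspace (stop W) \<noteq> {} \<longrightarrow> 0 \<le> d) \<and>
            s_smooth W X fst \<and> s_smooth W Y snd \<and>
            (\<forall>w\<in>topspace (stop W). g (fst w) = h (snd w)) \<and>
            SMan_cartesian TYPE(('t, 'q) smfd) W X Y Z fst snd g h"
  unfolding Let_def
  by (intro conjI impI ballI s_manifold_fibre_product[OF assms] s_fibre_product_dim_nonneg[OF assms]
      s_smooth_fst[OF assms] s_smooth_snd[OF assms] s_fibre_product_commutes[OF assms]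
      SMan_cartesian_fibre_product[OF assms])

end
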